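(* Let $\mathbb{F}_q$ be a finite field, let $t\in\mathbb{K}$ and let $V_0$ be a finite-dimensional vector space over $\mathbb{F}_q$. Let $F:\mathbf{Vect}_{\mathbb{F}_q}\to\mathbf{Vect}_{\mathbb{F}_q}/V_0$ be the functor $F:=(-)\oplus V_0$, $V\mapsto(V\oplus V_0,\mathrm{pr}_{V_0})$. Then the induced symmetric monoidal functor $$\overline{F}:\underline{\mathrm{Rep}}(GL_t(\mathbb{F}_q))=\mathcal{T}(\mathbf{Vect}_{\mathbb{F}_q},\delta_t)\to\mathcal{T}(\mathbf{Vect}_{\mathbb{F}_q}/V_0,\delta'_t)$$ preserves finite limits.
   Context: $\mathbb{K}$ is a fixed field. $\mathbf{Vect}_{\mathbb{F}_q}$ is the category of finite-dimensional $\mathbb{F}_q$-vector spaces, and $\mathbf{Vect}_{\mathbb{F}_q}/V_0$ is its slice category over $V_0$: objects are pairs $(V,p)$ with $p:V\to V_0$ linear (not necessarily surjective), morphisms $(V,p)\to(V',p')$ are linear maps $f:V\to V'$ with $p'f=p$. Both categories are regular in Knop's sense: a category $\mathcal{A}$ is regular if it has a terminal object; all morphisms have images (epi-mono factorizations, unique up to isomorphism); the pullback $x\times_z y$ exists whenever $x\to z\leftarrow y$ can be completed to a commutative square; for any epimorphism $x\twoheadrightarrow z$ and any $y\to z$ the pullback exists; and epimorphisms are preserved under pullbacks. A degree function on a regular category $\mathcal{A}$ is a map $\delta$ from the epimorphisms of $\mathcal{A}$ to $\mathbb{K}$, multiplicative under composition, equal to $1$ on identities, and invariant under pullback. On $\mathbf{Vect}_{\mathbb{F}_q}$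 put $\delta_t(e):=t^{\dim\ker e}$, and on $\mathbf{Vect}_{\mathbb{F}_q}/V_0$ let $\delta'_t(e):=\delta_t(e)$, computed on the underlying linear surjection. For a regular category $\mathcal{A}$ with degree function $\delta$, the $\mathbb{K}$-linear category $\mathcal{T}^0(\mathcal{A},\delta)$ has objects $[x]$ for $x\in\mathcal{A}$; morphisms $[x]\to[y]$ are formal $\mathbb{K}$-linear combinations of symbols $\langle r\rangle$ with $r\subset x\times y$ a subobject; composition for $r\subset x\times y$, $s\subset y\times z$ is $\langle s\rangle\circ\langle r\rangle:=\delta(e)\langle r\star s\rangle$ if $r\times_y s$ exists, where $r\star s:=\mathrm{im}(r\times_y s\to x\times z)$ and $e:r\times_y s\twoheadrightarrow r\star s$, and $0$ otherwise. $\mathcal{T}(\mathcal{A},\delta)$ is its additive Karoubi completion, symmetric monoidal via $[x]\otimes[y]:=[x\times y]$. The functor $F$ preserves pullbacks, terminal objects, epimorphisms and satisfies $\delta'_t(F(e))=\delta_t(e)$; $\overline{F}$ is the $\mathbb{K}$-linear extension to Karoubi completions of $[x]\mapsto[F(x)]$, $\langle r\rangle\mapsto\langle F(r)\rangle$, where for $r\subset x\times y$ one views $F(r)\subset F(x\times y)$ as a subobject of $F(x)\times F(y)$ via the natural map. *)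

theory Defs
  imports
    "Jordan_Normal_Form.Missing_VectorSpace"
    "HOL-Library.Poly_Mapping"
begin

section \<open>Categories, functors and finite limits\<close>

text \<open>Arrows do not carry their endpoints, so operations on arrows take the objects involved as
  arguments: for \<open>f : x \<rightarrow> y\<close> and \<open>g : y \<rightarrow> z\<close> the composite \<open>g \<circ> f\<close> is \<open>cmp C x y z g f\<close>.\<close>

record ('o, 'm) cat =
  ob :: "'o set"
  arr :: "'o \<Rightarrow> 'o \<Rightarrow> 'm set"
  cmp :: "'o \<Rightarrow> 'o \<Rightarrow> 'o \<Rightarrow> 'm \<Rightarrow> 'm \<Rightarrow> 'm"
  ide :: "'o \<Rightarrow> 'm"

definition category :: "('o, 'm) cat \<Rightarrow> bool" where
  "category C \<longleftrightarrow>
     (\<forall>x\<in>ob C. ide C x \<in> arr C x x) \<and>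
     (\<forall>x\<in>ob C. \<forall>y\<in>ob C. \<forall>z\<in>ob C. \<forall>f\<in>arr C x y. \<forall>g\<in>arr C y z. cmp C x y z g f \<in> arr C x z) \<and>
     (\<forall>x\<in>ob C. \<forall>y\<in>ob C. \<forall>f\<in>arr C x y.
        cmp C x x y f (ide C x) = f \<and> cmp C x y y (ide C y) f = f) \<and>
     (\<forall>w\<in>ob C. \<forall>x\<in>ob C. \<forall>y\<in>ob C. \<forall>z\<in>ob C. \<forall>f\<in>arr C w x. \<forall>g\<in>arr C x y. \<forall>h\<in>arr C y z.
        cmp C w y z h (cmp C w x y g f) = cmp C w x z (cmp C x y z h g) f)"

definition finite_category :: "('o, 'm) cat \<Rightarrow> bool" where
  "finite_category J \<longleftrightarrow>
     category J \<and> finite (ob J) \<and> (\<forall>i\<in>ob J. \<forall>j\<in>ob J. finite (arr J i j))"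

record ('o, 'm, 'p, 'n) func =
  fob :: "'o \<Rightarrow> 'p"
  farr :: "'o \<Rightarrow> 'o \<Rightarrow> 'm \<Rightarrow> 'n"

definition is_functor :: "('o, 'm) cat \<Rightarrow> ('p, 'n) cat \<Rightarrow> ('o, 'm, 'p, 'n) func \<Rightarrow> bool" where
  "is_functor C D G \<longleftrightarrow>
     category C \<and> category D \<and>
     (\<forall>x\<in>ob C. fob G x \<in> ob D) \<and>
     (\<forall>x\<in>ob C. \<forall>y\<in>ob C. \<forall>f\<in>arr C x y. farr G x y f \<in> arr D (fob G x) (fob G y)) \<and>
     (\<forall>x\<in>ob C. farr G x x (ide C x) = ide D (fob G x)) \<and>
     (\<forall>x\<in>ob C. \<forall>y\<in>ob C. \<forall>z\<in>ob C. \<forall>f\<in>arr C x y. \<forall>g\<in>arr C y z.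
        farr G x z (cmp C x y z g f) =
          cmp D (fob G x) (fob G y) (fob G z) (farr G y z g) (farr G x y f))"

definition func_comp ::
  "('p, 'n, 'q, 'l) func \<Rightarrow> ('o, 'm, 'p, 'n) func \<Rightarrow> ('o, 'm, 'q, 'l) func" where
  "func_comp G F =
     \<lparr>fob = (\<lambda>x. fob G (fob F x)),
      farr = (\<lambda>x y f. farr G (fob F x) (fob F y) (farr F x y f))\<rparr>"

definition is_cone ::
  "('j, 'a) cat \<Rightarrow> ('o, 'm) cat \<Rightarrow> ('j, 'a, 'o, 'm) func \<Rightarrow> 'o \<Rightarrow> ('j \<Rightarrow> 'm) \<Rightarrow> bool" where
  "is_cone J C D c l \<longleftrightarrow>
     c \<in> ob C \<and>
     (\<forall>j\<in>ob J. l j \<in> arr C c (fob D j)) \<and>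
     (\<forall>i\<in>ob J. \<forall>j\<in>ob J. \<forall>a\<in>arr J i j. cmp C c (fob D i) (fob D j) (farr D i j a) (l i) = l j)"

definition is_limit_cone ::
  "('j, 'a) cat \<Rightarrow> ('o, 'm) cat \<Rightarrow> ('j, 'a, 'o, 'm) func \<Rightarrow> 'o \<Rightarrow> ('j \<Rightarrow> 'm) \<Rightarrow> bool" where
  "is_limit_cone J C D c l \<longleftrightarrow>
     is_cone J C D c l \<and>
     (\<forall>c' l'. is_cone J C D c' l' \<longrightarrow>
        (\<exists>!h. h \<in> arr C c' c \<and> (\<forall>j\<in>ob J. cmp C c' c (fob D j) (l j) h = l' j)))"

definition preserves_limits_of_shape ::
  "('j, 'a) cat \<Rightarrow> ('o, 'm) cat \<Rightarrow> ('p, 'n) cat \<Rightarrow> ('o, 'm, 'p, 'n) func \<Rightarrow> bool" where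
  "preserves_limits_of_shape J C C' G \<longleftrightarrow>
     (\<forall>D c l. is_functor J C D \<longrightarrow> is_limit_cone J C D c l \<longrightarrow>
        is_limit_cone J C' (func_comp G D) (fob G c) (\<lambda>j. farr G c (fob D j) (l j)))"

definition slice :: "('o, 'm) cat \<Rightarrow> 'o \<Rightarrow> ('o \<times> 'm, 'm) cat" where
  "slice A z =
     \<lparr>ob = {(x, p). x \<in> ob A \<and> p \<in> arr A x z},
      arr = (\<lambda>(x, p) (y, q). {f \<in> arr A x y. cmp A x y z q f = p}),
      cmp = (\<lambda>x y w g f. cmp A (fst x) (fst y) (fst w) g f),
      ide = (\<lambda>x. ide A (fst x))\<rparr>"


section \<open>Products, pullbacks, images and subobjects\<close>

definition is_mono :: "('o, 'm) cat \<Rightarrow> 'o \<Rightarrow> 'o \<Rightarrow> 'm \<Rightarrow> bool" where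
  "is_mono A x y m \<longleftrightarrow>
     m \<in> arr A x y \<and>
     (\<forall>w\<in>ob A. \<forall>f\<in>arr A w x. \<forall>g\<in>arr A w x. cmp A w x y m f = cmp A w x y m g \<longrightarrow> f = g)"

definition is_epi :: "('o, 'm) cat \<Rightarrow> 'o \<Rightarrow> 'o \<Rightarrow> 'm \<Rightarrow> bool" where
  "is_epi A x y e \<longleftrightarrow>
     e \<in> arr A x y \<and>
     (\<forall>w\<in>ob A. \<forall>f\<in>arr A y w. \<forall>g\<in>arr A y w. cmp A x y w f e = cmp A x y w g e \<longrightarrow> f = g)"

definition is_iso :: "('o, 'm) cat \<Rightarrow> 'o \<Rightarrow> 'o \<Rightarrow> 'm \<Rightarrow> bool" where
  "is_iso A x y f \<longleftrightarrow>
     f \<in> arr A x y \<and> (\<exists>g\<in>arr A y x. cmp A x y x g f = ide A x \<and> cmp A y x y f g = ide A y)"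

definition is_product :: "('o, 'm) cat \<Rightarrow> 'o \<Rightarrow> 'o \<Rightarrow> 'o \<times> 'm \<times> 'm \<Rightarrow> bool" where
  "is_product A x y = (\<lambda>(p, u, v).
     p \<in> ob A \<and> u \<in> arr A p x \<and> v \<in> arr A p y \<and>
     (\<forall>w\<in>ob A. \<forall>f\<in>arr A w x. \<forall>g\<in>arr A w y.
        \<exists>!h. h \<in> arr A w p \<and> cmp A w p x u h = f \<and> cmp A w p y v h = g))"

definition is_pullback ::
  "('o, 'm) cat \<Rightarrow> 'o \<Rightarrow> 'o \<Rightarrow> 'o \<Rightarrow> 'm \<Rightarrow> 'm \<Rightarrow> 'o \<times> 'm \<times> 'm \<Rightarrow> bool" where
  "is_pullback A x y z f g = (\<lambda>(p, u, v).
     p \<in> ob A \<and> u \<in> arr A p x \<and> v \<in> arr A p y \<and> cmp A p x z f u = cmp A p y z g v \<and>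
     (\<forall>w\<in>ob A. \<forall>a\<in>arr A w x. \<forall>b\<in>arr A w y. cmp A w x z f a = cmp A w y z g b \<longrightarrow>
        (\<exists>!h. h \<in> arr A w p \<and> cmp A w p x u h = a \<and> cmp A w p y v h = b)))"

text \<open>An image is the middle object of an epi-mono factorization \<open>f = n \<circ> e\<close>.\<close>

definition is_image :: "('o, 'm) cat \<Rightarrow> 'o \<Rightarrow> 'o \<Rightarrow> 'm \<Rightarrow> 'o \<times> 'm \<times> 'm \<Rightarrow> bool" where
  "is_image A x y f = (\<lambda>(i, e, n).
     i \<in> ob A \<and> is_epi A x i e \<and> is_mono A i y n \<and> cmp A x i y n e = f)"

text \<open>Products are fixed by a choice; pullbacks and images are chosen where they are used.\<close>

definition product :: "('o, 'm) cat \<Rightarrow> 'o \<Rightarrow> 'o \<Rightarrow> 'o \<times> 'm \<times> 'm" where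
  "product A x y = (SOME P. is_product A x y P)"

definition prod_ob :: "('o, 'm) cat \<Rightarrow> 'o \<Rightarrow> 'o \<Rightarrow> 'o" where
  "prod_ob A x y = fst (product A x y)"

definition proj1 :: "('o, 'm) cat \<Rightarrow> 'o \<Rightarrow> 'o \<Rightarrow> 'm" where
  "proj1 A x y = fst (snd (product A x y))"

definition proj2 :: "('o, 'm) cat \<Rightarrow> 'o \<Rightarrow> 'o \<Rightarrow> 'm" where
  "proj2 A x y = snd (snd (product A x y))"

definition tuple :: "('o, 'm) cat \<Rightarrow> 'o \<Rightarrow> 'o \<Rightarrow> 'o \<Rightarrow> 'm \<Rightarrow> 'm \<Rightarrow> 'm" where
  "tuple A w x y f g = (THE h. h \<in> arr A w (prod_ob A x y) \<and>
     cmp A w (prod_ob A x y) x (proj1 A x y) h = f \<and>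
     cmp A w (prod_ob A x y) y (proj2 A x y) h = g)"

text \<open>A subobject of \<open>z\<close> is an isomorphism class of monomorphisms \<open>d \<rightarrow> z\<close>, the latter being
  represented by the pairs \<open>(d, m)\<close>.\<close>

type_synonym ('o, 'm) subobj = "('o \<times> 'm) set"

definition sub_class :: "('o, 'm) cat \<Rightarrow> 'o \<Rightarrow> 'o \<times> 'm \<Rightarrow> ('o, 'm) subobj" where
  "sub_class A z = (\<lambda>(d, m). {(d', m'). d' \<in> ob A \<and> is_mono A d' z m' \<and>
     (\<exists>i. is_iso A d d' i \<and> cmp A d d' z m' i = m)})"

definition subobjects :: "('o, 'm) cat \<Rightarrow> 'o \<Rightarrow> ('o, 'm) subobj set" where
  "subobjects A z = {sub_class A z (d, m) | d m. d \<in> ob A \<and> is_mono A d z m}"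

definition sub_rep :: "('o, 'm) subobj \<Rightarrow> 'o \<times> 'm" where
  "sub_rep r = (SOME a. a \<in> r)"


section \<open>The category \<open>\<T>\<^sup>0(\<A>, \<delta>)\<close>\<close>

text \<open>A degree function is a map \<open>\<delta>\<close> whose value at an epimorphism \<open>e : x \<rightarrow> y\<close> is \<open>\<delta> x y e\<close>; its
  values at other arguments are never used.\<close>

type_synonym ('o, 'm, 'k) degree = "'o \<Rightarrow> 'o \<Rightarrow> 'm \<Rightarrow> 'k"

text \<open>The composite \<open>\<langle>s\<rangle> \<circ> \<langle>r\<rangle>\<close> for subobjects \<open>r\<close> of \<open>x \<times> y\<close> and \<open>s\<close> of \<open>y \<times> z\<close>. Here \<open>(p, u, v)\<close> is the
  pullback \<open>r \<times>\<^sub>y s\<close>, and \<open>(i, e, n)\<close> is the factorization of \<open>p \<rightarrow> x \<times> z\<close>. All choices are unique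
  up to isomorphism if \<open>A\<close> is regular, and degree functions are invariant under isomorphisms.\<close>

definition comp_sub :: "('o, 'm) cat \<Rightarrow> ('o, 'm, 'k::field) degree \<Rightarrow> 'o \<Rightarrow> 'o \<Rightarrow> 'o \<Rightarrow>
    ('o, 'm) subobj \<Rightarrow> ('o, 'm) subobj \<Rightarrow> (('o, 'm) subobj \<Rightarrow>\<^sub>0 'k)" where
  "comp_sub A \<delta> x y z s r =
    (let (d, m) = sub_rep r;
         (d', m') = sub_rep s;
         f = cmp A d (prod_ob A x y) y (proj2 A x y) m;
         g = cmp A d' (prod_ob A y z) y (proj1 A y z) m'
     in if \<exists>P. is_pullback A d d' y f g P
        then
          let (p, u, v) = (SOME P. is_pullback A d d' y f g P);
              a = cmp A p d x (cmp A d (prod_ob A x y) x (proj1 A x y) m) u;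
              b = cmp A p d' z (cmp A d' (prod_ob A y z) z (proj2 A y z) m') v;
              (i, e, n) = (SOME I. is_image A p (prod_ob A x z) (tuple A p x z a b) I)
          in Poly_Mapping.single (sub_class A (prod_ob A x z) (i, n)) (\<delta> p i e)
        else 0)"

definition T0 :: "('o, 'm) cat \<Rightarrow> ('o, 'm, 'k::field) degree \<Rightarrow>
    ('o, ('o, 'm) subobj \<Rightarrow>\<^sub>0 'k) cat" where
  "T0 A \<delta> =
     \<lparr>ob = ob A,
      arr = (\<lambda>x y. {f. Poly_Mapping.keys f \<subseteq> subobjects A (prod_ob A x y)}),
      cmp = (\<lambda>x y z g f. \<Sum>s\<in>Poly_Mapping.keys g. \<Sum>r\<in>Poly_Mapping.keys f.
        Poly_Mapping.map ((*) (Poly_Mapping.lookup g s * Poly_Mapping.lookup f r))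
          (comp_sub A \<delta> x y z s r)),
      ide = (\<lambda>x. Poly_Mapping.single
        (sub_class A (prod_ob A x x) (x, tuple A x x x (ide A x) (ide A x))) 1)\<rparr>"

text \<open>For \<open>r \<subseteq> x \<times> y\<close>, the subobject \<open>F(r)\<close> of \<open>F(x) \<times> F(y)\<close>, formed via the natural map
  \<open>F(x \<times> y) \<rightarrow> F(x) \<times> F(y)\<close>.\<close>

definition sub_map :: "('o, 'm) cat \<Rightarrow> ('p, 'n) cat \<Rightarrow> ('o, 'm, 'p, 'n) func \<Rightarrow> 'o \<Rightarrow> 'o \<Rightarrow>
    ('o, 'm) subobj \<Rightarrow> ('p, 'n) subobj" where
  "sub_map A B F x y r =
    (let (d, m) = sub_rep r;
         xy = prod_ob A x y;
         P = prod_ob B (fob F x) (fob F y);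
         nat_map = tuple B (fob F xy) (fob F x) (fob F y)
           (farr F xy x (proj1 A x y)) (farr F xy y (proj2 A x y))
     in sub_class B P (fob F d, cmp B (fob F d) (fob F xy) P nat_map (farr F d xy m)))"

definition T0_func :: "('o, 'm) cat \<Rightarrow> ('p, 'n) cat \<Rightarrow> ('o, 'm, 'p, 'n) func \<Rightarrow>
    ('o, ('o, 'm) subobj \<Rightarrow>\<^sub>0 'k::field, 'p, ('p, 'n) subobj \<Rightarrow>\<^sub>0 'k) func" where
  "T0_func A B F =
     \<lparr>fob = fob F,
      farr = (\<lambda>x y f. \<Sum>r\<in>Poly_Mapping.keys f.
        Poly_Mapping.single (sub_map A B F x y r) (Poly_Mapping.lookup f r))\<rparr>"


section \<open>Additive and Karoubi completion\<close>

text \<open>Formal finite direct sums are lists of objects. Entry \<open>M i j\<close> of a matrix is the component from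
  the \<open>j\<close>-th summand of the source to the \<open>i\<close>-th summand of the target; entries out of range
  are \<open>0\<close>, so that equality of matrices is equality of functions.\<close>

definition additive_hull :: "('o, 'm::comm_monoid_add) cat \<Rightarrow> ('o list, nat \<Rightarrow> nat \<Rightarrow> 'm) cat" where
  "additive_hull C =
     \<lparr>ob = {xs. set xs \<subseteq> ob C},
      arr = (\<lambda>xs ys. {M. \<forall>i j. if i < length ys \<and> j < length xs
        then M i j \<in> arr C (xs ! j) (ys ! i) else M i j = 0}),
      cmp = (\<lambda>xs ys zs N M i k. if i < length zs \<and> k < length xs
        then \<Sum>j<length ys. cmp C (xs ! k) (ys ! j) (zs ! i) (N i j) (M j k) else 0),
      ide = (\<lambda>xs i j. if i = j \<and> i < length xs then ide C (xs ! i) else 0)\<rparr>"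

definition additive_hull_func :: "('o, 'm::comm_monoid_add, 'p, 'n::comm_monoid_add) func \<Rightarrow>
    ('o list, nat \<Rightarrow> nat \<Rightarrow> 'm, 'p list, nat \<Rightarrow> nat \<Rightarrow> 'n) func" where
  "additive_hull_func G =
     \<lparr>fob = map (fob G),
      farr = (\<lambda>xs ys M i j. if i < length ys \<and> j < length xs
        then farr G (xs ! j) (ys ! i) (M i j) else 0)\<rparr>"

definition karoubi :: "('o, 'm) cat \<Rightarrow> ('o \<times> 'm, 'm) cat" where
  "karoubi C =
     \<lparr>ob = {(x, e). x \<in> ob C \<and> e \<in> arr C x x \<and> cmp C x x x e e = e},
      arr = (\<lambda>(x, e) (y, e'). {f \<in> arr C x y. cmp C x y y e' (cmp C x x y f e) = f}),
      cmp = (\<lambda>x y z g f. cmp C (fst x) (fst y) (fst z) g f),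
      ide = snd\<rparr>"

definition karoubi_func :: "('o, 'm, 'p, 'n) func \<Rightarrow> ('o \<times> 'm, 'm, 'p \<times> 'n, 'n) func" where
  "karoubi_func G =
     \<lparr>fob = (\<lambda>(x, e). (fob G x, farr G x x e)),
      farr = (\<lambda>x y f. farr G (fst x) (fst y) f)\<rparr>"

text \<open>\<open>\<T>(\<A>, \<delta>)\<close>, and the functor induced on these categories by a functor \<open>F\<close> from \<open>\<A>\<close> to \<open>\<B>\<close>.\<close>

definition T_cat :: "('o, 'm) cat \<Rightarrow> ('o, 'm, 'k::field) degree \<Rightarrow>
    ('o list \<times> (nat \<Rightarrow> nat \<Rightarrow> (('o, 'm) subobj \<Rightarrow>\<^sub>0 'k)),
     nat \<Rightarrow> nat \<Rightarrow> (('o, 'm) subobj \<Rightarrow>\<^sub>0 'k)) cat" where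
  "T_cat A \<delta> = karoubi (additive_hull (T0 A \<delta>))"

definition T_func :: "('o, 'm) cat \<Rightarrow> ('p, 'n) cat \<Rightarrow> ('o, 'm, 'p, 'n) func \<Rightarrow>
    ('o list \<times> (nat \<Rightarrow> nat \<Rightarrow> (('o, 'm) subobj \<Rightarrow>\<^sub>0 'k::field)),
     nat \<Rightarrow> nat \<Rightarrow> (('o, 'm) subobj \<Rightarrow>\<^sub>0 'k),
     'p list \<times> (nat \<Rightarrow> nat \<Rightarrow> (('p, 'n) subobj \<Rightarrow>\<^sub>0 'k)),
     nat \<Rightarrow> nat \<Rightarrow> (('p, 'n) subobj \<Rightarrow>\<^sub>0 'k)) func" where
  "T_func A B F = karoubi_func (additive_hull_func (T0_func A B F))"


section \<open>Vector spaces\<close>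

text \<open>Finite-dimensional vector spaces over \<open>K\<close> with elements in the universe \<open>'v\<close>. For a finite field
  \<open>K\<close> such spaces are finite sets, so every infinite \<open>'v\<close> contains them all up to isomorphism.
  Linear maps are extensional, so that equality of arrows is equality of functions.\<close>

definition Vect :: "('f, 'r) ring_scheme \<Rightarrow> (('f, 'v) module, 'v \<Rightarrow> 'v) cat" where
  "Vect K =
     \<lparr>ob = {V. vectorspace K V \<and> vectorspace.fin_dim K V},
      arr = (\<lambda>V W. {f \<in> extensional (carrier V). linear_map K V W f}),
      cmp = (\<lambda>U V W g f. compose (carrier U) g f),
      ide = (\<lambda>V. \<lambda>v\<in>carrier V. v)\<rparr>"

definition vect_deg :: "('f, 'r) ring_scheme \<Rightarrow> 'k::field \<Rightarrow> (('f, 'v) module, 'v \<Rightarrow> 'v, 'k) degree" where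
  "vect_deg K t = (\<lambda>V W e. t ^ vectorspace.dim K (V\<lparr>carrier := mod_hom.ker V W e\<rparr>))"

definition slice_deg :: "('o, 'm, 'k) degree \<Rightarrow> ('o \<times> 'm, 'm, 'k) degree" where
  "slice_deg \<delta> = (\<lambda>x y e. \<delta> (fst x) (fst y) e)"

abbreviation Rep_GL :: "('f, 'r) ring_scheme \<Rightarrow> 'k::field \<Rightarrow> _" where
  "Rep_GL K t \<equiv> T_cat (Vect K :: (('f, 'v) module, 'v \<Rightarrow> 'v) cat) (vect_deg K t)"

text \<open>\<^const>\<open>direct_sum\<close> lives on pairs. To stay in the universe \<open>'v\<close>, it is transported along an
  injection \<open>pair : 'v \<times> 'v \<rightarrow> 'v\<close>, i.e. \<open>pair (a, b)\<close> plays the role of \<open>(a, b)\<close>.\<close>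

definition image_module :: "('b \<Rightarrow> 'c) \<Rightarrow> ('a, 'b) module \<Rightarrow> ('a, 'c) module" where
  "image_module h M =
    (let k = inv_into (carrier M) h in
     \<lparr>carrier = h ` carrier M,
      mult = (\<lambda>a b. h (k a \<otimes>\<^bsub>M\<^esub> k b)), one = h \<one>\<^bsub>M\<^esub>,
      zero = h \<zero>\<^bsub>M\<^esub>, add = (\<lambda>a b. h (k a \<oplus>\<^bsub>M\<^esub> k b)),
      smult = (\<lambda>c a. h (c \<odot>\<^bsub>M\<^esub> k a))\<rparr>)"

definition dsum :: "('v \<times> 'v \<Rightarrow> 'v) \<Rightarrow> ('f, 'v) module \<Rightarrow> ('f, 'v) module \<Rightarrow> ('f, 'v) module" where
  "dsum pair V W = image_module pair (direct_sum V W)"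

text \<open>The functor \<open>V \<mapsto> (V \<oplus> V\<^sub>0, pr\<^bsub>V\<^sub>0\<^esub>)\<close>, \<open>f \<mapsto> f \<oplus> id\<close>.\<close>

definition add_V0 :: "('v \<times> 'v \<Rightarrow> 'v) \<Rightarrow> ('f, 'v) module \<Rightarrow>
    (('f, 'v) module, 'v \<Rightarrow> 'v, ('f, 'v) module \<times> ('v \<Rightarrow> 'v), 'v \<Rightarrow> 'v) func" where
  "add_V0 pair V0 =
     \<lparr>fob = (\<lambda>V. (dsum pair V V0, \<lambda>a\<in>carrier (dsum pair V V0). snd (inv_into UNIV pair a))),
      farr = (\<lambda>V W f. \<lambda>a\<in>carrier (dsum pair V V0).
        pair (f (fst (inv_into UNIV pair a)), snd (inv_into UNIV pair a)))\<rparr>"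

end

theory Submission
  imports Defs
begin

text \<open>A functor all of whose comma categories \<open>x \<down> G\<close> have an initial object, i.e. for which every \<open>x\<close>
  admits a universal arrow \<open>n : x \<rightarrow> G u\<close>, preserves all limits. Universal arrows survive passing to
  additive hulls and to Karoubi envelopes, so it suffices to find them for
  \<open>\<T>\<^sup>0(Vect) \<rightarrow> \<T>\<^sup>0(Vect/V\<^sub>0)\<close>. There the left adjoint is induced by the forgetful functor \<open>(V, p) \<mapsto> V\<close>,
  because a relation between \<open>(V, p)\<close> and \<open>(W \<oplus> V\<^sub>0, pr)\<close> over \<open>V\<^sub>0\<close> is the same as a relation between
  \<open>V\<close> and \<open>W\<close>; the universal arrow is the graph of \<open>v \<mapsto> (v, p v)\<close>. Subobjects of products are treated
  as linear relations, composed with the weight \<open>t ^ dim {b. (0, b) \<in> R \<and> (b, 0) \<in> S}\<close>. That these weights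
  form a cocycle is proved by counting, as all spaces are finite.\<close>

section \<open>Universal arrows and limits\<close>

text \<open>On the level of spaces the functor is base change along
  \<open>V0 \<rightarrow> 0\<close>, which is where the forgetful functor as left adjoint comes
  from. What does not come for free is the passage to relations: a composite carries a power of
  \<open>t\<close>, and \<open>t\<close> may be \<open>0\<close>, so a bijection of bases that holds
  only up to such powers would not give an isomorphism of Hom-spaces. It survives because the
  universal arrow is single-valued: a relation composed after it has trivial overlap with it, hence
  exponent \<open>0\<close> for every \<open>t\<close>. For the same reason exponents are compared
  as natural numbers before \<open>t\<close> is inserted; cardinalities read in the coefficient
  field would lose information, for instance when its characteristic divides the order of
  \<open>K\<close>. The other obstacle is that products, pullbacks, images and representatives of
  subobjects are all chosen by \<open>SOME\<close>. In the language of relations these choices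
  disappear, since a subobject of a product is determined by the set of pairs that it contains. No
  left adjoint functor is constructed as such: universal arrows are chosen object by object.\<close>

lemma categoryI:
  assumes "\<And>x. x \<in> ob C \<Longrightarrow> ide C x \<in> arr C x x"
    and "\<And>x y z f g. \<lbrakk>x \<in> ob C; y \<in> ob C; z \<in> ob C; f \<in> arr C x y; g \<in> arr C y z\<rbrakk>
      \<Longrightarrow> cmp C x y z g f \<in> arr C x z"
    and "\<And>x y f. \<lbrakk>x \<in> ob C; y \<in> ob C; f \<in> arr C x y\<rbrakk> \<Longrightarrow> cmp C x x y f (ide C x) = f"
    and "\<And>x y f. \<lbrakk>x \<in> ob C; y \<in> ob C; f \<in> arr C x y\<rbrakk> \<Longrightarrow> cmp C x y y (ide C y) f = f"
    and "\<And>w x y z f g h. \<lbrakk>w \<in> ob C; x \<in> ob C; y \<in> ob C; z \<in> ob C; f \<in> arr C w x; g \<in> arr C x y;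
      h \<in> arr C y z\<rbrakk> \<Longrightarrow> cmp C w y z h (cmp C w x y g f) = cmp C w x z (cmp C x y z h g) f"
  shows "category C"
  unfolding category_def by (intro conjI ballI; rule assms; assumption)

lemma
  assumes "category C"
  shows ide_in_arr: "x \<in> ob C \<Longrightarrow> ide C x \<in> arr C x x"
    and cmp_in_arr: "\<lbrakk>x \<in> ob C; y \<in> ob C; z \<in> ob C; f \<in> arr C x y; g \<in> arr C y z\<rbrakk>
      \<Longrightarrow> cmp C x y z g f \<in> arr C x z"
    and cmp_ide_right: "\<lbrakk>x \<in> ob C; y \<in> ob C; f \<in> arr C x y\<rbrakk> \<Longrightarrow> cmp C x x y f (ide C x) = f"
    and cmp_ide_left: "\<lbrakk>x \<in> ob C; y \<in> ob C; f \<in> arr C x y\<rbrakk> \<Longrightarrow> cmp C x y y (ide C y) f = f"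
    and cmp_assoc: "\<lbrakk>w \<in> ob C; x \<in> ob C; y \<in> ob C; z \<in> ob C; f \<in> arr C w x; g \<in> arr C x y;
      h \<in> arr C y z\<rbrakk> \<Longrightarrow> cmp C w y z h (cmp C w x y g f) = cmp C w x z (cmp C x y z h g) f"
  using assms unfolding category_def by blast+

lemma is_functorI:
  assumes "category C" and "category D"
    and "\<And>x. x \<in> ob C \<Longrightarrow> fob G x \<in> ob D"
    and "\<And>x y f. \<lbrakk>x \<in> ob C; y \<in> ob C; f \<in> arr C x y\<rbrakk> \<Longrightarrow> farr G x y f \<in> arr D (fob G x) (fob G y)"
    and "\<And>x. x \<in> ob C \<Longrightarrow> farr G x x (ide C x) = ide D (fob G x)"
    and "\<And>x y z f g. \<lbrakk>x \<in> ob C; y \<in> ob C; z \<in> ob C; f \<in> arr C x y; g \<in> arr C y z\<rbrakk>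
      \<Longrightarrow> farr G x z (cmp C x y z g f) =
          cmp D (fob G x) (fob G y) (fob G z) (farr G y z g) (farr G x y f)"
  shows "is_functor C D G"
  unfolding is_functor_def by (intro conjI ballI; rule assms; assumption)

lemma
  assumes "is_functor C D G"
  shows functor_category1: "category C"
    and functor_category2: "category D"
    and fob_in_ob: "x \<in> ob C \<Longrightarrow> fob G x \<in> ob D"
    and farr_in_arr: "\<lbrakk>x \<in> ob C; y \<in> ob C; f \<in> arr C x y\<rbrakk>
      \<Longrightarrow> farr G x y f \<in> arr D (fob G x) (fob G y)"
    and farr_ide: "x \<in> ob C \<Longrightarrow> farr G x x (ide C x) = ide D (fob G x)"
    and farr_cmp: "\<lbrakk>x \<in> ob C; y \<in> ob C; z \<in> ob C; f \<in> arr C x y; g \<in> arr C y z\<rbrakk>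
      \<Longrightarrow> farr G x z (cmp C x y z g f) =
          cmp D (fob G x) (fob G y) (fob G z) (farr G y z g) (farr G x y f)"
  using assms unfolding is_functor_def by blast+

definition universal_arrow ::
  "('o, 'm) cat \<Rightarrow> ('p, 'n) cat \<Rightarrow> ('o, 'm, 'p, 'n) func \<Rightarrow> 'p \<Rightarrow> 'o \<Rightarrow> 'n \<Rightarrow> bool" where
  "universal_arrow C D G x u n \<longleftrightarrow>
     u \<in> ob C \<and> n \<in> arr D x (fob G u) \<and>
     (\<forall>y\<in>ob C. \<forall>f\<in>arr D x (fob G y).
        \<exists>!g. g \<in> arr C u y \<and> cmp D x (fob G u) (fob G y) (farr G u y g) n = f)"

lemma
  assumes "universal_arrow C D G x u n"
  shows universal_ob: "u \<in> ob C"
    and universal_arr: "n \<in> arr D x (fob G u)"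
    and universal_ex1: "\<lbrakk>y \<in> ob C; f \<in> arr D x (fob G y)\<rbrakk>
      \<Longrightarrow> \<exists>!g. g \<in> arr C u y \<and> cmp D x (fob G u) (fob G y) (farr G u y g) n = f"
  using assms unfolding universal_arrow_def by blast+

lemma universal_eqI:
  assumes "universal_arrow C D G x u n" and "is_functor C D G" and "x \<in> ob D" and "y \<in> ob C"
    and "g \<in> arr C u y" and "h \<in> arr C u y"
    and "cmp D x (fob G u) (fob G y) (farr G u y g) n = cmp D x (fob G u) (fob G y) (farr G u y h) n"
  shows "g = h"
proof -
  have "cmp D x (fob G u) (fob G y) (farr G u y h) n \<in> arr D x (fob G y)"
    using assms by (meson cmp_in_arr functor_category2 farr_in_arr fob_in_ob universal_arr universal_ob)
  then show ?thesis
    using universal_ex1[OF assms(1) \<open>y \<in> ob C\<close>] assms(5-7) by blast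
qed

text \<open>Composition with the universal arrow \<open>n\<close>, written \<open>?t\<close>,
  identifies arrows \<open>u \<rightarrow> y\<close> with arrows
  \<open>c' \<rightarrow> G y\<close>, naturally in \<open>y\<close> (\<open>t_cmp\<close>). Under
  this transposition cones over \<open>G D\<close> with apex \<open>c'\<close> become cones over
  \<open>D\<close> with apex \<open>u\<close>, and mediating arrows correspond as well, so the limit
  property of \<open>c\<close> gives that of \<open>G c\<close>.\<close>

proposition preserves_limits_of_shape_if_universal_arrows:
  assumes Gf: "is_functor C E G"
    and univ: "\<And>x. x \<in> ob E \<Longrightarrow> \<exists>u n. universal_arrow C E G x u n"
  shows "preserves_limits_of_shape J C E G"
  unfolding preserves_limits_of_shape_def
proof (intro allI impI)
  fix D c l
  assume D: "is_functor J C D" and lim: "is_limit_cone J C D c l"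
  note C = functor_category1[OF Gf] and E = functor_category2[OF Gf]
  have cone: "is_cone J C D c l"
    using lim unfolding is_limit_cone_def by blast
  have c: "c \<in> ob C" and l: "\<And>j. j \<in> ob J \<Longrightarrow> l j \<in> arr C c (fob D j)"
    and l_nat: "\<And>i j a. \<lbrakk>i \<in> ob J; j \<in> ob J; a \<in> arr J i j\<rbrakk>
      \<Longrightarrow> cmp C c (fob D i) (fob D j) (farr D i j a) (l i) = l j"
    using cone unfolding is_cone_def by blast+
  note Dj = fob_in_ob[OF D] and Da = farr_in_arr[OF D]
  let ?Gl = "\<lambda>j. farr G c (fob D j) (l j)"
  have simps: "fob (func_comp G D) j = fob G (fob D j)"
    "farr (func_comp G D) i j a = farr G (fob D i) (fob D j) (farr D i j a)" for i j a
    by (simp_all add: func_comp_def)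
  show "is_limit_cone J E (func_comp G D) (fob G c) ?Gl"
    unfolding is_limit_cone_def
  proof (intro conjI allI impI)
    show "is_cone J E (func_comp G D) (fob G c) ?Gl"
      unfolding is_cone_def simps
    proof (intro conjI ballI)
      fix i j a
      assume ij: "i \<in> ob J" "j \<in> ob J" "a \<in> arr J i j"
      then show "cmp E (fob G c) (fob G (fob D i)) (fob G (fob D j))
          (farr G (fob D i) (fob D j) (farr D i j a)) (?Gl i) = ?Gl j"
        using farr_cmp[OF Gf c Dj Dj l Da] l_nat by metis
    qed (use Gf c Dj l in \<open>auto intro: fob_in_ob farr_in_arr\<close>)
  next
    fix c' l'
    assume "is_cone J E (func_comp G D) c' l'"
    then have c': "c' \<in> ob E" and l': "\<And>j. j \<in> ob J \<Longrightarrow> l' j \<in> arr E c' (fob G (fob D j))"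
      and l'_nat: "\<And>i j a. \<lbrakk>i \<in> ob J; j \<in> ob J; a \<in> arr J i j\<rbrakk>
        \<Longrightarrow> cmp E c' (fob G (fob D i)) (fob G (fob D j))
          (farr G (fob D i) (fob D j) (farr D i j a)) (l' i) = l' j"
      unfolding is_cone_def simps by blast+
    obtain u n where un: "universal_arrow C E G c' u n"
      using univ[OF c'] by blast
    note u = universal_ob[OF un] and n = universal_arr[OF un]
    let ?t = "\<lambda>y g. cmp E c' (fob G u) (fob G y) (farr G u y g) n"
    have t_cmp: "?t z (cmp C u y z h g) = cmp E c' (fob G y) (fob G z) (farr G y z h) (?t y g)"
      if "y \<in> ob C" "z \<in> ob C" "g \<in> arr C u y" "h \<in> arr C y z" for y z g h
      using that u c' n farr_cmp[OF Gf u that]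
        cmp_assoc[OF E c' _ _ _ n farr_in_arr[OF Gf u _ that(3)] farr_in_arr[OF Gf _ _ that(4)]]
      by (simp add: fob_in_ob[OF Gf])
    have "\<exists>g. g \<in> arr C u (fob D j) \<and> ?t (fob D j) g = l' j" if "j \<in> ob J" for j
      using universal_ex1[OF un Dj[OF that] l'[OF that]] by blast
    then obtain k where k: "\<And>j. j \<in> ob J \<Longrightarrow> k j \<in> arr C u (fob D j)"
      and tk: "\<And>j. j \<in> ob J \<Longrightarrow> ?t (fob D j) (k j) = l' j"
      by metis
    \<comment> \<open>The triangles of \<open>k\<close> commute because their transposes, the
      triangles of \<open>l'\<close>, commute and transposition is injective.\<close>
    have "is_cone J C D u k"
      unfolding is_cone_def
    proof (intro conjI ballI)
      fix i j a
      assume ij: "i \<in> ob J" "j \<in> ob J" "a \<in> arr J i j"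
      have "?t (fob D j) (cmp C u (fob D i) (fob D j) (farr D i j a) (k i)) = ?t (fob D j) (k j)"
        using t_cmp[OF Dj[OF ij(1)] Dj[OF ij(2)] k[OF ij(1)] Da[OF ij]] tk l'_nat ij by simp
      then show "cmp C u (fob D i) (fob D j) (farr D i j a) (k i) = k j"
        using universal_eqI[OF un Gf c' Dj[OF ij(2)]]
          cmp_in_arr[OF C u Dj[OF ij(1)] Dj[OF ij(2)] k[OF ij(1)] Da[OF ij]] k ij by blast
    qed (use u k in auto)
    then obtain h where h: "h \<in> arr C u c"
      and lh: "\<And>j. j \<in> ob J \<Longrightarrow> cmp C u c (fob D j) (l j) h = k j"
      and h_unique: "\<And>h'. h' \<in> arr C u c \<Longrightarrow>
        (\<And>j. j \<in> ob J \<Longrightarrow> cmp C u c (fob D j) (l j) h' = k j) \<Longrightarrow> h' = h"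
      using lim unfolding is_limit_cone_def by metis
    show "\<exists>!h. h \<in> arr E c' (fob G c) \<and>
        (\<forall>j\<in>ob J. cmp E c' (fob G c) (fob (func_comp G D) j) (?Gl j) h = l' j)"
      unfolding simps
    proof (intro ex1I conjI ballI)
      show "?t c h \<in> arr E c' (fob G c)"
        using cmp_in_arr[OF E c' _ _ n farr_in_arr[OF Gf u c h]] u c by (simp add: fob_in_ob[OF Gf])
      show "cmp E c' (fob G c) (fob G (fob D j)) (?Gl j) (?t c h) = l' j" if "j \<in> ob J" for j
        using t_cmp[OF c Dj[OF that] h l[OF that]] lh[OF that] tk[OF that] by simp
    next
      fix H
      assume H: "H \<in> arr E c' (fob G c) \<and>
        (\<forall>j\<in>ob J. cmp E c' (fob G c) (fob G (fob D j)) (?Gl j) H = l' j)"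
      \<comment> \<open>Transposition is onto at \<open>c\<close>: every competitor \<open>H\<close>
        comes from some \<open>h'\<close>, to which uniqueness in the given limit applies.\<close>
      then obtain h' where h': "h' \<in> arr C u c" and H_eq: "?t c h' = H"
        using universal_ex1[OF un c] by blast
      have "cmp C u c (fob D j) (l j) h' = k j" if j: "j \<in> ob J" for j
      proof (rule universal_eqI[OF un Gf c' Dj[OF j] _ k[OF j]])
        show "cmp C u c (fob D j) (l j) h' \<in> arr C u (fob D j)"
          using cmp_in_arr[OF C u c Dj[OF j] h' l[OF j]] .
        show "?t (fob D j) (cmp C u c (fob D j) (l j) h') = ?t (fob D j) (k j)"
          using t_cmp[OF c Dj[OF j] h' l[OF j]] H H_eq tk[OF j] j by simp
      qed
      then show "H = ?t c h"
        using h_unique[OF h'] H_eq by simp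
    qed
  qed
qed


section \<open>Karoubi envelopes\<close>

lemma karoubi_simps:
  "(x \<in> ob (karoubi C)) = (fst x \<in> ob C \<and> snd x \<in> arr C (fst x) (fst x) \<and>
     cmp C (fst x) (fst x) (fst x) (snd x) (snd x) = snd x)"
  "(f \<in> arr (karoubi C) x y) = (f \<in> arr C (fst x) (fst y) \<and>
     cmp C (fst x) (fst y) (fst y) (snd y) (cmp C (fst x) (fst x) (fst y) f (snd x)) = f)"
  "cmp (karoubi C) x y z g f = cmp C (fst x) (fst y) (fst z) g f"
  "ide (karoubi C) x = snd x"
  by (auto simp: karoubi_def split: prod.splits)

lemma karoubi_func_simps:
  "fob (karoubi_func G) x = (fob G (fst x), farr G (fst x) (fst x) (snd x))"
  "farr (karoubi_func G) x y f = farr G (fst x) (fst y) f"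
  by (auto simp: karoubi_func_def split: prod.splits)

text \<open>The envelope imposes only the two-sided condition \<open>d f e = f\<close>. Idempotence
  of \<open>e\<close> and \<open>d\<close> splits it into \<open>f e = f\<close> and
  \<open>d f = f\<close>, the form in which it is stable under composition.\<close>

lemma karoubi_absorb:
  assumes "category C" and "x \<in> ob (karoubi C)" and "y \<in> ob (karoubi C)"
    and "f \<in> arr (karoubi C) x y"
  shows "cmp C (fst x) (fst x) (fst y) f (snd x) = f"
    and "cmp C (fst x) (fst y) (fst y) (snd y) f = f"
proof -
  obtain x' e y' d where xy: "x = (x', e)" "y = (y', d)"
    by (metis surj_pair)
  have x: "x' \<in> ob C" "e \<in> arr C x' x'" "cmp C x' x' x' e e = e"
    and y: "y' \<in> ob C" "d \<in> arr C y' y'" "cmp C y' y' y' d d = d"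
    and f: "f \<in> arr C x' y'" "cmp C x' y' y' d (cmp C x' x' y' f e) = f"
    using assms(2-4) by (auto simp: karoubi_simps xy)
  note fe = cmp_in_arr[OF assms(1) x(1) x(1) y(1) x(2) f(1)]
  have "cmp C x' x' y' f e = cmp C x' x' y' (cmp C x' y' y' d (cmp C x' x' y' f e)) e"
    using f by simp
  also have "\<dots> = cmp C x' y' y' d (cmp C x' x' y' (cmp C x' x' y' f e) e)"
    using cmp_assoc[OF assms(1) x(1) x(1) y(1) y(1) x(2) fe y(2)] by simp
  also have "cmp C x' x' y' (cmp C x' x' y' f e) e = cmp C x' x' y' f e"
    using cmp_assoc[OF assms(1) x(1) x(1) x(1) y(1) x(2) x(2) f(1)] x by simp
  finally show "cmp C (fst x) (fst x) (fst y) f (snd x) = f"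
    using f xy by simp
  have "cmp C x' y' y' d f = cmp C x' y' y' d (cmp C x' y' y' d (cmp C x' x' y' f e))"
    using f by simp
  also have "\<dots> = f"
    using cmp_assoc[OF assms(1) x(1) y(1) y(1) y(1) fe y(2) y(2)] y f by simp
  finally show "cmp C (fst x) (fst y) (fst y) (snd y) f = f"
    using xy by simp
qed

lemma karoubi_arrI:
  assumes "f \<in> arr C (fst x) (fst y)" and "cmp C (fst x) (fst x) (fst y) f (snd x) = f"
    and "cmp C (fst x) (fst y) (fst y) (snd y) f = f"
  shows "f \<in> arr (karoubi C) x y"
  using assms by (simp add: karoubi_simps)

lemma karoubi_obD:
  assumes "x \<in> ob (karoubi C)"
  shows "fst x \<in> ob C" and "snd x \<in> arr C (fst x) (fst x)"
    and "cmp C (fst x) (fst x) (fst x) (snd x) (snd x) = snd x"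
  using assms by (simp_all add: karoubi_simps)

lemma karoubi_arrD: "f \<in> arr (karoubi C) x y \<Longrightarrow> f \<in> arr C (fst x) (fst y)"
  by (simp add: karoubi_simps)

lemma category_karoubi:
  assumes C: "category C"
  shows "category (karoubi C)"
proof (rule categoryI)
  show "ide (karoubi C) x \<in> arr (karoubi C) x x" if "x \<in> ob (karoubi C)" for x
    using that by (simp add: karoubi_simps)
next
  fix x y z f g
  assume a: "x \<in> ob (karoubi C)" "y \<in> ob (karoubi C)" "z \<in> ob (karoubi C)"
    "f \<in> arr (karoubi C) x y" "g \<in> arr (karoubi C) y z"
  note o = a(1-3)[THEN karoubi_obD(1)] and i = a(1-3)[THEN karoubi_obD(2)]
    and fg = a(4,5)[THEN karoubi_arrD]
  have "cmp C (fst x) (fst y) (fst z) g f \<in> arr (karoubi C) x z"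
  proof (rule karoubi_arrI)
    show "cmp C (fst x) (fst y) (fst z) g f \<in> arr C (fst x) (fst z)"
      by (rule cmp_in_arr[OF C o fg])
    show "cmp C (fst x) (fst x) (fst z) (cmp C (fst x) (fst y) (fst z) g f) (snd x) =
        cmp C (fst x) (fst y) (fst z) g f"
      using cmp_assoc[OF C o(1) o(1) o(2,3) i(1) fg] karoubi_absorb(1)[OF C a(1,2,4)] by simp
    show "cmp C (fst x) (fst z) (fst z) (snd z) (cmp C (fst x) (fst y) (fst z) g f) =
        cmp C (fst x) (fst y) (fst z) g f"
      using cmp_assoc[OF C o o(3) fg i(3)] karoubi_absorb(2)[OF C a(2,3,5)] by simp
  qed
  then show "cmp (karoubi C) x y z g f \<in> arr (karoubi C) x z"
    by (simp add: karoubi_simps)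
next
  fix w x y z f g h
  assume a: "w \<in> ob (karoubi C)" "x \<in> ob (karoubi C)" "y \<in> ob (karoubi C)" "z \<in> ob (karoubi C)"
    "f \<in> arr (karoubi C) w x" "g \<in> arr (karoubi C) x y" "h \<in> arr (karoubi C) y z"
  show "cmp (karoubi C) w y z h (cmp (karoubi C) w x y g f) =
      cmp (karoubi C) w x z (cmp (karoubi C) x y z h g) f"
    using cmp_assoc[OF C a(1-4)[THEN karoubi_obD(1)] a(5-7)[THEN karoubi_arrD]]
    by (simp add: karoubi_simps)
qed (simp_all only: karoubi_simps(3,4) karoubi_absorb[OF C])

lemma is_functor_karoubi_func:
  assumes Gf: "is_functor C D G"
  shows "is_functor (karoubi C) (karoubi D) (karoubi_func G)"
proof (rule is_functorI)
  show "category (karoubi C)" "category (karoubi D)"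
    using functor_category1[OF Gf] functor_category2[OF Gf] by (simp_all add: category_karoubi)
  show "fob (karoubi_func G) x \<in> ob (karoubi D)" if "x \<in> ob (karoubi C)" for x
  proof -
    note x = karoubi_obD[OF that]
    show ?thesis
      using fob_in_ob[OF Gf x(1)] farr_in_arr[OF Gf x(1) x(1) x(2)]
        farr_cmp[OF Gf x(1) x(1) x(1) x(2) x(2)] x(3)
      by (simp add: karoubi_simps karoubi_func_simps)
  qed
  show "farr (karoubi_func G) x y f \<in> arr (karoubi D) (fob (karoubi_func G) x) (fob (karoubi_func G) y)"
    if a: "x \<in> ob (karoubi C)" "y \<in> ob (karoubi C)" "f \<in> arr (karoubi C) x y" for x y f
  proof -
    note x = karoubi_obD[OF a(1)] and y = karoubi_obD[OF a(2)] and f = karoubi_arrD[OF a(3)]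
      and absorb = karoubi_absorb[OF functor_category1[OF Gf] a]
    show ?thesis
      using farr_in_arr[OF Gf x(1) y(1) f] farr_cmp[OF Gf x(1) x(1) y(1) x(2) f]
        farr_cmp[OF Gf x(1) y(1) y(1) f y(2)] absorb
      by (intro karoubi_arrI) (simp_all add: karoubi_func_simps)
  qed
  show "farr (karoubi_func G) x x (ide (karoubi C) x) = ide (karoubi D) (fob (karoubi_func G) x)" for x
    by (simp add: karoubi_simps karoubi_func_simps)
  show "farr (karoubi_func G) x z (cmp (karoubi C) x y z g f) =
      cmp (karoubi D) (fob (karoubi_func G) x) (fob (karoubi_func G) y) (fob (karoubi_func G) z)
        (farr (karoubi_func G) y z g) (farr (karoubi_func G) x y f)"
    if a: "x \<in> ob (karoubi C)" "y \<in> ob (karoubi C)" "z \<in> ob (karoubi C)"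
      "f \<in> arr (karoubi C) x y" "g \<in> arr (karoubi C) y z" for x y z f g
    using farr_cmp[OF Gf a(1-3)[THEN karoubi_obD(1)] a(4,5)[THEN karoubi_arrD]]
    by (simp add: karoubi_simps karoubi_func_simps)
qed

text \<open>An idempotent \<open>e\<close> on \<open>x\<close> lifts along the universal arrow \<open>n\<close> to an idempotent \<open>d\<close> on \<open>u\<close>, and
  \<open>n \<circ> e\<close> is then universal for \<open>(x, e)\<close>.\<close>

lemma universal_arrow_karoubi:
  assumes Gf: "is_functor C D G" and x: "x \<in> ob (karoubi D)"
    and un: "universal_arrow C D G (fst x) u n"
  shows "\<exists>v m. universal_arrow (karoubi C) (karoubi D) (karoubi_func G) x v m"
proof -
  obtain w e where we: "x = (w, e)"
    by force
  have w: "w \<in> ob D" and e: "e \<in> arr D w w" and ee: "cmp D w w w e e = e"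
    using karoubi_obD[OF x] by (simp_all add: we)
  note C = functor_category1[OF Gf] and D = functor_category2[OF Gf]
  note un = un[unfolded we fst_conv]
  note u = universal_ob[OF un] and n = universal_arr[OF un] and Gob = fob_in_ob[OF Gf]
    and Garr = farr_in_arr[OF Gf]
  let ?t = "\<lambda>y g. cmp D w (fob G u) (fob G y) (farr G u y g) n"
  let ?ne = "cmp D w w (fob G u) n e"
  have ne: "?ne \<in> arr D w (fob G u)"
    by (rule cmp_in_arr[OF D w w Gob[OF u] e n])
  have t_cmp: "?t z (cmp C u y z h g) = cmp D w (fob G y) (fob G z) (farr G y z h) (?t y g)"
    if "y \<in> ob C" "z \<in> ob C" "g \<in> arr C u y" "h \<in> arr C y z" for y z g h
    using farr_cmp[OF Gf u that]
      cmp_assoc[OF D w Gob[OF u] Gob[OF that(1)] Gob[OF that(2)] n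
        Garr[OF u that(1,3)] Garr[OF that(1,2,4)]]
    by simp
  have t_e: "cmp D w (fob G u) (fob G y) (farr G u y g) ?ne = cmp D w w (fob G y) (?t y g) e"
    if "y \<in> ob C" "g \<in> arr C u y" for y g
    using cmp_assoc[OF D w w Gob[OF u] Gob[OF that(1)] e n Garr[OF u that]] .
  have nee: "cmp D w w (fob G u) ?ne e = ?ne"
    using cmp_assoc[OF D w w w Gob[OF u] e e n] ee by simp
  obtain d where d: "d \<in> arr C u u" and td: "?t u d = ?ne"
    using universal_ex1[OF un u ne] by blast
  note dd_in = cmp_in_arr[OF C u u u d d]
  \<comment> \<open>Both sides are \<open>n e\<close>: the left one is
    \<open>G d (n e) = (G d n) e = (n e) e\<close>.\<close>
  have "?t u (cmp C u u u d d) = ?t u d"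
    using t_cmp[OF u u d d] t_e[OF u d] td nee by simp
  then have dd: "cmp C u u u d d = d"
    using universal_eqI[OF un Gf w u dd_in d] by blast
  have "universal_arrow (karoubi C) (karoubi D) (karoubi_func G) (w, e) (u, d) ?ne"
    unfolding universal_arrow_def
  proof (intro conjI ballI)
    show "(u, d) \<in> ob (karoubi C)"
      using u d dd by (simp add: karoubi_simps)
    show "?ne \<in> arr (karoubi D) (w, e) (fob (karoubi_func G) (u, d))"
      using ne nee t_e[OF u d] td
      by (intro karoubi_arrI) (simp_all add: karoubi_func_simps)
  next
    fix y f
    assume y: "y \<in> ob (karoubi C)" and f: "f \<in> arr (karoubi D) (w, e) (fob (karoubi_func G) y)"
    obtain z a where za: "y = (z, a)"
      by force
    have z: "z \<in> ob C" and a: "a \<in> arr C z z"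
      using y by (simp_all add: karoubi_simps za)
    note Gy = fob_in_ob[OF is_functor_karoubi_func[OF Gf] y]
    have x': "(w, e) \<in> ob (karoubi D)"
      using x we by simp
    have f': "f \<in> arr D w (fob G z)"
      using karoubi_arrD[OF f] by (simp add: karoubi_func_simps za)
    have fe: "cmp D w w (fob G z) f e = f"
      and af: "cmp D w (fob G z) (fob G z) (farr G z z a) f = f"
      using karoubi_absorb[OF D x' Gy f] by (simp_all add: karoubi_func_simps za)
    obtain g where g: "g \<in> arr C u z" and tg: "?t z g = f"
      and g_unique: "\<And>g'. g' \<in> arr C u z \<Longrightarrow> ?t z g' = f \<Longrightarrow> g' = g"
      using universal_ex1[OF un z f'] by blast
    \<comment> \<open>Transposition turns precomposition with \<open>d\<close> into precomposition
      with \<open>e\<close>, so arrows absorbing \<open>d\<close> match arrows absorbing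
      \<open>e\<close>.\<close>
    have tgd: "?t z (cmp C u u z h d) = cmp D w w (fob G z) (?t z h) e" if "h \<in> arr C u z" for h
      using t_cmp[OF u z d that] td t_e[OF z that] by simp
    have gd: "cmp C u u z g d = g"
      by (rule g_unique) (use cmp_in_arr[OF C u u z d g] tgd[OF g] tg fe in simp_all)
    have ag: "cmp C u z z a g = g"
      by (rule g_unique) (use cmp_in_arr[OF C u z z g a] t_cmp[OF z z g a] tg af in simp_all)
    show "\<exists>!g. g \<in> arr (karoubi C) (u, d) y \<and>
      cmp (karoubi D) (w, e) (fob (karoubi_func G) (u, d)) (fob (karoubi_func G) y)
        (farr (karoubi_func G) (u, d) y g) ?ne = f"
    proof (intro ex1I conjI)
      show "g \<in> arr (karoubi C) (u, d) y"
        using g gd ag by (intro karoubi_arrI) (simp_all add: za)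
      show "cmp (karoubi D) (w, e) (fob (karoubi_func G) (u, d)) (fob (karoubi_func G) y)
        (farr (karoubi_func G) (u, d) y g) ?ne = f"
        using t_e[OF z g] tg fe by (simp add: karoubi_simps karoubi_func_simps za)
    next
      fix h
      assume h: "h \<in> arr (karoubi C) (u, d) y \<and>
        cmp (karoubi D) (w, e) (fob (karoubi_func G) (u, d)) (fob (karoubi_func G) y)
          (farr (karoubi_func G) (u, d) y h) ?ne = f"
      have h': "h \<in> arr C u z"
        using h karoubi_arrD by (fastforce simp: za)
      have "(u, d) \<in> ob (karoubi C)"
        using u d dd by (simp add: karoubi_simps)
      then have hd: "cmp C u u z h d = h"
        using karoubi_absorb(1)[OF C _ y, of "(u, d)" h] h by (simp add: za)
      \<comment> \<open>The assumption on \<open>h\<close> evaluates it at \<open>n e\<close>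
        instead of \<open>n\<close>. The factor \<open>e\<close> is traded for \<open>d\<close>,
        which \<open>h\<close> absorbs, and then uniqueness at \<open>n\<close> applies.\<close>
      have "?t z (cmp C u u z h d) = f"
        using h t_e[OF z h'] tgd[OF h'] by (simp add: karoubi_simps karoubi_func_simps za)
      then show "h = g"
        using g_unique h' hd by simp
    qed
  qed
  then show ?thesis
    unfolding we by blast
qed

section \<open>Additive hulls\<close>

text \<open>Hom-sets are mere subsets of one commutative monoid type, hence the closure conditions.
  This is the structure on which finite sums, and so matrix composition, rely.\<close>

definition biadditive :: "('o, 'm::comm_monoid_add) cat \<Rightarrow> bool" where
  "biadditive C \<longleftrightarrow>
     (\<forall>x\<in>ob C. \<forall>y\<in>ob C. 0 \<in> arr C x y \<and> (\<forall>f\<in>arr C x y. \<forall>g\<in>arr C x y. f + g \<in> arr C x y)) \<and>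
     (\<forall>x\<in>ob C. \<forall>y\<in>ob C. \<forall>z\<in>ob C.
        (\<forall>f\<in>arr C x y. cmp C x y z 0 f = 0) \<and> (\<forall>g\<in>arr C y z. cmp C x y z g 0 = 0) \<and>
        (\<forall>f\<in>arr C x y. \<forall>f'\<in>arr C x y. \<forall>g\<in>arr C y z.
          cmp C x y z g (f + f') = cmp C x y z g f + cmp C x y z g f') \<and>
        (\<forall>f\<in>arr C x y. \<forall>g\<in>arr C y z. \<forall>g'\<in>arr C y z.
          cmp C x y z (g + g') f = cmp C x y z g f + cmp C x y z g' f))"

lemma
  assumes "biadditive C"
  shows zero_in_arr: "\<lbrakk>x \<in> ob C; y \<in> ob C\<rbrakk> \<Longrightarrow> 0 \<in> arr C x y"
    and add_in_arr: "\<lbrakk>x \<in> ob C; y \<in> ob C; f \<in> arr C x y; g \<in> arr C x y\<rbrakk> \<Longrightarrow> f + g \<in> arr C x y"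
    and cmp_zero_right: "\<lbrakk>x \<in> ob C; y \<in> ob C; z \<in> ob C; g \<in> arr C y z\<rbrakk> \<Longrightarrow> cmp C x y z g 0 = 0"
    and cmp_zero_left: "\<lbrakk>x \<in> ob C; y \<in> ob C; z \<in> ob C; f \<in> arr C x y\<rbrakk> \<Longrightarrow> cmp C x y z 0 f = 0"
    and cmp_add_right: "\<lbrakk>x \<in> ob C; y \<in> ob C; z \<in> ob C; f \<in> arr C x y; f' \<in> arr C x y; g \<in> arr C y z\<rbrakk>
      \<Longrightarrow> cmp C x y z g (f + f') = cmp C x y z g f + cmp C x y z g f'"
    and cmp_add_left: "\<lbrakk>x \<in> ob C; y \<in> ob C; z \<in> ob C; f \<in> arr C x y; g \<in> arr C y z; g' \<in> arr C y z\<rbrakk>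
      \<Longrightarrow> cmp C x y z (g + g') f = cmp C x y z g f + cmp C x y z g' f"
  using assms by (simp_all add: biadditive_def)

lemma sum_in_arr:
  assumes "biadditive C" and "x \<in> ob C" and "y \<in> ob C" and "\<And>i. i \<in> I \<Longrightarrow> f i \<in> arr C x y"
  shows "sum f I \<in> arr C x y"
  using assms(4)
  by (induction I rule: infinite_finite_induct)
    (auto intro: zero_in_arr[OF assms(1-3)] add_in_arr[OF assms(1-3)])

lemma cmp_sum_right:
  assumes "biadditive C" and "x \<in> ob C" and "y \<in> ob C" and "z \<in> ob C" and "g \<in> arr C y z"
    and "\<And>i. i \<in> I \<Longrightarrow> f i \<in> arr C x y"
  shows "cmp C x y z g (sum f I) = (\<Sum>i\<in>I. cmp C x y z g (f i))"
  using assms(6)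
proof (induction I rule: infinite_finite_induct)
  case (insert i I)
  then show ?case
    using cmp_add_right[OF assms(1-4) _ _ assms(5)] sum_in_arr[OF assms(1-3), of I f] by simp
qed (simp_all add: cmp_zero_right[OF assms(1-5)])

lemma cmp_sum_left:
  assumes "biadditive C" and "x \<in> ob C" and "y \<in> ob C" and "z \<in> ob C" and "f \<in> arr C x y"
    and "\<And>i. i \<in> I \<Longrightarrow> g i \<in> arr C y z"
  shows "cmp C x y z (sum g I) f = (\<Sum>i\<in>I. cmp C x y z (g i) f)"
  using assms(6)
proof (induction I rule: infinite_finite_induct)
  case (insert i I)
  then show ?case
    using cmp_add_left[OF assms(1-5)] sum_in_arr[OF assms(1,3,4), of I g] by simp
qed (simp_all add: cmp_zero_left[OF assms(1-5)])

lemma additive_hull_simps: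
  "(xs \<in> ob (additive_hull C)) = (set xs \<subseteq> ob C)"
  "(M \<in> arr (additive_hull C) xs ys) = (\<forall>i j. if i < length ys \<and> j < length xs
     then M i j \<in> arr C (xs ! j) (ys ! i) else M i j = 0)"
  "cmp (additive_hull C) xs ys zs N M = (\<lambda>i k. if i < length zs \<and> k < length xs
     then \<Sum>j<length ys. cmp C (xs ! k) (ys ! j) (zs ! i) (N i j) (M j k) else 0)"
  "ide (additive_hull C) xs = (\<lambda>i j. if i = j \<and> i < length xs then ide C (xs ! i) else 0)"
  by (simp_all add: additive_hull_def)

lemma additive_hull_func_simps:
  "fob (additive_hull_func G) xs = map (fob G) xs"
  "farr (additive_hull_func G) xs ys M = (\<lambda>i j. if i < length ys \<and> j < length xs
     then farr G (xs ! j) (ys ! i) (M i j) else 0)"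
  by (simp_all add: additive_hull_func_def)

lemma additive_hull_obD: "xs \<in> ob (additive_hull C) \<Longrightarrow> i < length xs \<Longrightarrow> xs ! i \<in> ob C"
  by (auto simp: additive_hull_simps)

lemma additive_hull_arrD:
  "M \<in> arr (additive_hull C) xs ys \<Longrightarrow> i < length ys \<Longrightarrow> j < length xs \<Longrightarrow>
     M i j \<in> arr C (xs ! j) (ys ! i)"
  "M \<in> arr (additive_hull C) xs ys \<Longrightarrow> \<not> (i < length ys \<and> j < length xs) \<Longrightarrow> M i j = 0"
  unfolding additive_hull_simps by meson+

lemma additive_hull_arrI:
  assumes "\<And>i j. \<lbrakk>i < length ys; j < length xs\<rbrakk> \<Longrightarrow> M i j \<in> arr C (xs ! j) (ys ! i)"
    and "\<And>i j. \<not> (i < length ys \<and> j < length xs) \<Longrightarrow> M i j = 0"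
  shows "M \<in> arr (additive_hull C) xs ys"
  unfolding additive_hull_simps using assms by auto

lemma category_additive_hull:
  assumes C: "category C" and P: "biadditive C"
  shows "category (additive_hull C)"
proof (rule categoryI)
  show "ide (additive_hull C) xs \<in> arr (additive_hull C) xs xs" if "xs \<in> ob (additive_hull C)" for xs
    using that additive_hull_obD[OF that]
    by (intro additive_hull_arrI)
      (auto simp: additive_hull_simps(4) intro: ide_in_arr[OF C] zero_in_arr[OF P])
  show "cmp (additive_hull C) xs ys zs N M \<in> arr (additive_hull C) xs zs"
    if "xs \<in> ob (additive_hull C)" "ys \<in> ob (additive_hull C)" "zs \<in> ob (additive_hull C)"
      "M \<in> arr (additive_hull C) xs ys" "N \<in> arr (additive_hull C) ys zs" for xs ys zs M N
    using that(1-3)[THEN additive_hull_obD] that(4,5)[THEN additive_hull_arrD(1)]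
    by (intro additive_hull_arrI)
      (auto simp: additive_hull_simps(3) intro!: sum_in_arr[OF P] cmp_in_arr[OF C])
next
  fix xs ys M
  assume xs: "xs \<in> ob (additive_hull C)" and ys: "ys \<in> ob (additive_hull C)"
    and M: "M \<in> arr (additive_hull C) xs ys"
  note o = xs[THEN additive_hull_obD] ys[THEN additive_hull_obD] and M' = M[THEN additive_hull_arrD(1)]
  show "cmp (additive_hull C) xs xs ys M (ide (additive_hull C) xs) = M"
  proof (intro ext)
    fix i k
    show "cmp (additive_hull C) xs xs ys M (ide (additive_hull C) xs) i k = M i k"
    proof (cases "i < length ys \<and> k < length xs")
      case True
      then have "cmp (additive_hull C) xs xs ys M (ide (additive_hull C) xs) i k =
          (\<Sum>j<length xs. if j = k then M i k else 0)"
        unfolding additive_hull_simps(3,4)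
        by (auto simp del: sum.delta sum.delta' intro!: sum.cong cmp_ide_right[OF C] cmp_zero_right[OF P] o M')
      then show ?thesis
        using True by simp
    qed (use additive_hull_arrD(2)[OF M] in \<open>auto simp: additive_hull_simps(3)\<close>)
  qed
  show "cmp (additive_hull C) xs ys ys (ide (additive_hull C) ys) M = M"
  proof (intro ext)
    fix i k
    show "cmp (additive_hull C) xs ys ys (ide (additive_hull C) ys) M i k = M i k"
    proof (cases "i < length ys \<and> k < length xs")
      case True
      then have "cmp (additive_hull C) xs ys ys (ide (additive_hull C) ys) M i k =
          (\<Sum>j<length ys. if j = i then M i k else 0)"
        unfolding additive_hull_simps(3,4)
        by (auto simp del: sum.delta sum.delta' intro!: sum.cong cmp_ide_left[OF C] cmp_zero_left[OF P] o M')
      then show ?thesis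
        using True by simp
    qed (use additive_hull_arrD(2)[OF M] in \<open>auto simp: additive_hull_simps(3)\<close>)
  qed
next
  fix ws xs ys zs L M N
  assume ob: "ws \<in> ob (additive_hull C)" "xs \<in> ob (additive_hull C)" "ys \<in> ob (additive_hull C)"
      "zs \<in> ob (additive_hull C)"
    and ar: "L \<in> arr (additive_hull C) ws xs" "M \<in> arr (additive_hull C) xs ys"
      "N \<in> arr (additive_hull C) ys zs"
  note o = ob[THEN additive_hull_obD] and a = ar[THEN additive_hull_arrD(1)]
  show "cmp (additive_hull C) ws ys zs N (cmp (additive_hull C) ws xs ys M L) =
      cmp (additive_hull C) ws xs zs (cmp (additive_hull C) xs ys zs N M) L"
  proof (intro ext)
    fix i l
    show "cmp (additive_hull C) ws ys zs N (cmp (additive_hull C) ws xs ys M L) i l =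
        cmp (additive_hull C) ws xs zs (cmp (additive_hull C) xs ys zs N M) L i l"
    proof (cases "i < length zs \<and> l < length ws")
      case True
      then have i: "i < length zs" and l: "l < length ws"
        by auto
      have "cmp (additive_hull C) ws ys zs N (cmp (additive_hull C) ws xs ys M L) i l =
          (\<Sum>j<length ys. cmp C (ws ! l) (ys ! j) (zs ! i) (N i j)
            (\<Sum>k<length xs. cmp C (ws ! l) (xs ! k) (ys ! j) (M j k) (L k l)))"
        unfolding additive_hull_simps(3) using i l by (auto intro!: sum.cong)
      also have "\<dots> = (\<Sum>j<length ys. \<Sum>k<length xs. cmp C (ws ! l) (ys ! j) (zs ! i) (N i j)
            (cmp C (ws ! l) (xs ! k) (ys ! j) (M j k) (L k l)))"
        using i l o a by (intro sum.cong cmp_sum_right[OF P] cmp_in_arr[OF C]) auto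
      also have "\<dots> = (\<Sum>j<length ys. \<Sum>k<length xs. cmp C (ws ! l) (xs ! k) (zs ! i)
            (cmp C (xs ! k) (ys ! j) (zs ! i) (N i j) (M j k)) (L k l))"
        using i l o a by (intro sum.cong cmp_assoc[OF C]) auto
      also have "\<dots> = (\<Sum>k<length xs. \<Sum>j<length ys. cmp C (ws ! l) (xs ! k) (zs ! i)
            (cmp C (xs ! k) (ys ! j) (zs ! i) (N i j) (M j k)) (L k l))"
        by (rule sum.swap)
      also have "\<dots> = (\<Sum>k<length xs. cmp C (ws ! l) (xs ! k) (zs ! i)
            (\<Sum>j<length ys. cmp C (xs ! k) (ys ! j) (zs ! i) (N i j) (M j k)) (L k l))"
        using i l o a by (intro sum.cong cmp_sum_left[OF P, symmetric] cmp_in_arr[OF C]) auto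
      also have "\<dots> = cmp (additive_hull C) ws xs zs (cmp (additive_hull C) xs ys zs N M) L i l"
        unfolding additive_hull_simps(3) using i l by (auto intro!: sum.cong)
      finally show ?thesis .
    qed (auto simp: additive_hull_simps(3))
  qed
qed

definition additive_functor ::
  "('o, 'm::comm_monoid_add) cat \<Rightarrow> ('p, 'n::comm_monoid_add) cat \<Rightarrow> ('o, 'm, 'p, 'n) func \<Rightarrow> bool"
  where
  "additive_functor C D G \<longleftrightarrow> biadditive C \<and> biadditive D \<and> is_functor C D G \<and>
     (\<forall>x\<in>ob C. \<forall>y\<in>ob C. farr G x y 0 = 0 \<and>
       (\<forall>f\<in>arr C x y. \<forall>g\<in>arr C x y. farr G x y (f + g) = farr G x y f + farr G x y g))"

lemma farr_sum:
  assumes "additive_functor C D G" and "x \<in> ob C" and "y \<in> ob C" and "\<And>i. i \<in> I \<Longrightarrow> f i \<in> arr C x y"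
  shows "farr G x y (sum f I) = (\<Sum>i\<in>I. farr G x y (f i))"
  using assms(4)
proof (induction I rule: infinite_finite_induct)
  case (insert i I)
  then show ?case
    using assms(1-3) sum_in_arr[of C x y I f] by (simp add: additive_functor_def)
qed (use assms(1-3) in \<open>auto simp: additive_functor_def\<close>)

lemma is_functor_additive_hull_func:
  assumes G: "additive_functor C D G"
  shows "is_functor (additive_hull C) (additive_hull D) (additive_hull_func G)"
proof -
  have P: "biadditive C" and Q: "biadditive D" and F: "is_functor C D G"
    using G unfolding additive_functor_def by blast+
  have G0: "farr G x y 0 = 0" if "x \<in> ob C" "y \<in> ob C" for x y
    using G that unfolding additive_functor_def by blast
  show ?thesis
  proof (rule is_functorI)
    show "category (additive_hull C)" "category (additive_hull D)"
      using functor_category1[OF F] functor_category2[OF F] by (simp_all add: category_additive_hull P Q)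
    show "fob (additive_hull_func G) xs \<in> ob (additive_hull D)" if "xs \<in> ob (additive_hull C)" for xs
      using that fob_in_ob[OF F] by (auto simp: additive_hull_simps additive_hull_func_simps)
    show "farr (additive_hull_func G) xs ys M \<in>
        arr (additive_hull D) (fob (additive_hull_func G) xs) (fob (additive_hull_func G) ys)"
      if "xs \<in> ob (additive_hull C)" "ys \<in> ob (additive_hull C)" "M \<in> arr (additive_hull C) xs ys"
      for xs ys M
      using that(1,2)[THEN additive_hull_obD] that(3)[THEN additive_hull_arrD(1)]
      by (intro additive_hull_arrI) (auto simp: additive_hull_func_simps intro: farr_in_arr[OF F])
    show "farr (additive_hull_func G) xs xs (ide (additive_hull C) xs) =
        ide (additive_hull D) (fob (additive_hull_func G) xs)" if "xs \<in> ob (additive_hull C)" for xs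
      using that[THEN additive_hull_obD]
      by (auto simp: additive_hull_func_simps additive_hull_simps(4) fun_eq_iff farr_ide[OF F] G0)
  next
    fix xs ys zs M N
    assume ob: "xs \<in> ob (additive_hull C)" "ys \<in> ob (additive_hull C)" "zs \<in> ob (additive_hull C)"
      and ar: "M \<in> arr (additive_hull C) xs ys" "N \<in> arr (additive_hull C) ys zs"
    note o = ob[THEN additive_hull_obD] and a = ar[THEN additive_hull_arrD(1)]
    have *: "farr G (xs ! k) (zs ! i) (\<Sum>j<length ys. cmp C (xs ! k) (ys ! j) (zs ! i) (N i j) (M j k)) =
      (\<Sum>j<length ys. cmp D (fob G (xs ! k)) (fob G (ys ! j)) (fob G (zs ! i))
        (farr G (ys ! j) (zs ! i) (N i j)) (farr G (xs ! k) (ys ! j) (M j k)))"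
      if "i < length zs" "k < length xs" for i k
    proof -
      have "farr G (xs ! k) (zs ! i) (\<Sum>j<length ys. cmp C (xs ! k) (ys ! j) (zs ! i) (N i j) (M j k)) =
        (\<Sum>j<length ys. farr G (xs ! k) (zs ! i) (cmp C (xs ! k) (ys ! j) (zs ! i) (N i j) (M j k)))"
        using that o a
        by (intro farr_sum[OF G] cmp_in_arr[OF functor_category1[OF F]]) auto
      then show ?thesis
        using that o a by (auto intro!: sum.cong farr_cmp[OF F])
    qed
    show "farr (additive_hull_func G) xs zs (cmp (additive_hull C) xs ys zs N M) =
        cmp (additive_hull D) (fob (additive_hull_func G) xs) (fob (additive_hull_func G) ys)
          (fob (additive_hull_func G) zs)
          (farr (additive_hull_func G) ys zs N) (farr (additive_hull_func G) xs ys M)"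
      using * by (auto simp: additive_hull_func_simps additive_hull_simps(3) fun_eq_iff)
  qed
qed

text \<open>The diagonal matrix of the universal arrows of the summands is universal: composing with
  it on the right acts on column \<open>k\<close> by the universal arrow of \<open>xs ! k\<close>,
  so no sums remain and the problem separates into one universal property for each entry.\<close>

lemma universal_arrow_additive_hull:
  assumes G: "additive_functor C D G"
    and univ: "\<And>x. x \<in> ob D \<Longrightarrow> \<exists>u n. universal_arrow C D G x u n"
    and xs: "xs \<in> ob (additive_hull D)"
  shows "\<exists>us m. universal_arrow (additive_hull C) (additive_hull D) (additive_hull_func G) xs us m"
proof -
  have P: "biadditive C" and Q: "biadditive D" and F: "is_functor C D G"
    using G unfolding additive_functor_def by blast+
  obtain U N where un: "\<And>x. x \<in> ob D \<Longrightarrow> universal_arrow C D G x (U x) (N x)"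
    using univ by metis
  note x = additive_hull_obD[OF xs]
  note u = universal_ob[OF un[OF x]] and n = universal_arr[OF un[OF x]]
  let ?us = "map U xs" and ?m = "\<lambda>i j. if i = j \<and> i < length xs then N (xs ! i) else 0"
  let ?t = "\<lambda>k y g. cmp D (xs ! k) (fob G (U (xs ! k))) (fob G y) (farr G (U (xs ! k)) y g) (N (xs ! k))"
  have t: "cmp (additive_hull D) xs (map (fob G) ?us) (map (fob G) ys)
      (farr (additive_hull_func G) ?us ys M) ?m =
      (\<lambda>i k. if i < length ys \<and> k < length xs then ?t k (ys ! i) (M i k) else 0)"
    if ys: "ys \<in> ob (additive_hull C)" and M: "M \<in> arr (additive_hull C) ?us ys" for ys M
  proof (intro ext)
    fix i k
    show "cmp (additive_hull D) xs (map (fob G) ?us) (map (fob G) ys)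
      (farr (additive_hull_func G) ?us ys M) ?m i k =
      (if i < length ys \<and> k < length xs then ?t k (ys ! i) (M i k) else 0)"
    proof (cases "i < length ys \<and> k < length xs")
      case True
      then have i: "i < length ys" and k: "k < length xs"
        by auto
      have GM: "farr G (U (xs ! j)) (ys ! i) (M i j) \<in> arr D (fob G (U (xs ! j))) (fob G (ys ! i))"
        if "j < length xs" for j
        using farr_in_arr[OF F u[OF that] additive_hull_obD[OF ys i]]
          additive_hull_arrD(1)[OF M i, of j] that by simp
      have "cmp (additive_hull D) xs (map (fob G) ?us) (map (fob G) ys)
          (farr (additive_hull_func G) ?us ys M) ?m i k =
          (\<Sum>j<length xs. if j = k then ?t k (ys ! i) (M i k) else 0)"
        unfolding additive_hull_simps(3) additive_hull_func_simps(2) using i k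
        by (auto simp del: sum.delta sum.delta' intro!: sum.cong cmp_zero_right[OF Q] GM x u fob_in_ob[OF F] additive_hull_obD[OF ys])
      then show ?thesis
        using i k by simp
    qed (auto simp: additive_hull_simps(3))
  qed
  have "universal_arrow (additive_hull C) (additive_hull D) (additive_hull_func G) xs ?us ?m"
    unfolding universal_arrow_def additive_hull_func_simps(1)
  proof (intro conjI ballI)
    show "?us \<in> ob (additive_hull C)"
      using xs universal_ob[OF un] by (auto simp: additive_hull_simps)
    show "?m \<in> arr (additive_hull D) xs (map (fob G) ?us)"
      using n by (intro additive_hull_arrI) (auto intro!: zero_in_arr[OF Q] x u fob_in_ob[OF F])
  next
    fix ys f
    assume ys: "ys \<in> ob (additive_hull C)" and f: "f \<in> arr (additive_hull D) xs (map (fob G) ys)"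
    note y = additive_hull_obD[OF ys]
    have f': "f i k \<in> arr D (xs ! k) (fob G (ys ! i))" if "i < length ys" "k < length xs" for i k
      using additive_hull_arrD(1)[OF f, of i k] that by simp
    have ex1: "\<exists>!g. g \<in> arr C (U (xs ! k)) (ys ! i) \<and> ?t k (ys ! i) g = f i k"
      if "i < length ys" "k < length xs" for i k
      using universal_ex1[OF un[OF x[OF that(2)]] y[OF that(1)] f'[OF that]] .
    \<comment> \<open>The \<open>THE\<close> is justified by \<open>ex1\<close> inside the range;
      outside, \<open>0\<close> is the value that membership in the hom-set prescribes.\<close>
    define M where "M = (\<lambda>i k. if i < length ys \<and> k < length xs
      then THE g. g \<in> arr C (U (xs ! k)) (ys ! i) \<and> ?t k (ys ! i) g = f i k else 0)"
    have M: "M i k \<in> arr C (U (xs ! k)) (ys ! i) \<and> ?t k (ys ! i) (M i k) = f i k"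
      if "i < length ys" "k < length xs" for i k
      using theI'[OF ex1[OF that]] that by (simp add: M_def)
    have M_arr: "M \<in> arr (additive_hull C) ?us ys"
      using M by (intro additive_hull_arrI) (auto simp: M_def)
    show "\<exists>!g. g \<in> arr (additive_hull C) ?us ys \<and>
        cmp (additive_hull D) xs (map (fob G) ?us) (map (fob G) ys)
          (farr (additive_hull_func G) ?us ys g) ?m = f"
    proof (intro ex1I conjI)
      show "M \<in> arr (additive_hull C) ?us ys"
        by (fact M_arr)
      show "cmp (additive_hull D) xs (map (fob G) ?us) (map (fob G) ys)
          (farr (additive_hull_func G) ?us ys M) ?m = f"
        unfolding t[OF ys M_arr] using M additive_hull_arrD(2)[OF f] by (auto simp: fun_eq_iff)
    next
      fix g
      assume g: "g \<in> arr (additive_hull C) ?us ys \<and>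
        cmp (additive_hull D) xs (map (fob G) ?us) (map (fob G) ys)
          (farr (additive_hull_func G) ?us ys g) ?m = f"
      then have g_arr: "g \<in> arr (additive_hull C) ?us ys"
        and tg: "(\<lambda>i k. if i < length ys \<and> k < length xs then ?t k (ys ! i) (g i k) else 0) = f"
        using t[OF ys] by auto
      show "g = M"
      proof (intro ext)
        fix i k
        show "g i k = M i k"
        proof (cases "i < length ys \<and> k < length xs")
          case True
          then have "?t k (ys ! i) (g i k) = f i k"
            using fun_cong[OF fun_cong[OF tg], of i k] by simp
          moreover have "g i k \<in> arr C (U (xs ! k)) (ys ! i)"
            using additive_hull_arrD(1)[OF g_arr, of i k] True by simp
          ultimately show ?thesis
            using ex1[of i k] M[of i k] True by blast
        next
          case False
          then show ?thesis
            using additive_hull_arrD(2)[OF g_arr, of i k] additive_hull_arrD(2)[OF M_arr, of i k] by simp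
        qed
      qed
    qed
  qed
  then show ?thesis
    by blast
qed

section \<open>Linear categories on a twisted basis\<close>

text \<open>The shape of \<open>T0\<close> with subobjects and their composition turned into
  parameters, so that everything that is pure linear algebra is argued once for
  \<open>Vect K\<close> and for its slice.\<close>

definition linear_cat :: "'o set \<Rightarrow> ('o \<Rightarrow> 'o \<Rightarrow> 'b set) \<Rightarrow>
    ('o \<Rightarrow> 'o \<Rightarrow> 'o \<Rightarrow> 'b \<Rightarrow> 'b \<Rightarrow> ('b \<Rightarrow>\<^sub>0 'k::field)) \<Rightarrow> ('o \<Rightarrow> 'b) \<Rightarrow> ('o, 'b \<Rightarrow>\<^sub>0 'k) cat" where
  "linear_cat Ob B c u =
     \<lparr>ob = Ob, arr = (\<lambda>x y. {f. Poly_Mapping.keys f \<subseteq> B x y}),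
      cmp = (\<lambda>x y z g f. \<Sum>s\<in>Poly_Mapping.keys g. \<Sum>r\<in>Poly_Mapping.keys f.
        Poly_Mapping.map ((*) (Poly_Mapping.lookup g s * Poly_Mapping.lookup f r)) (c x y z s r)),
      ide = (\<lambda>x. Poly_Mapping.single (u x) 1)\<rparr>"

text \<open>Composition of basis elements is a category structure \<open>m\<close> deformed by
  scalars \<open>w\<close>; \<open>w_assoc\<close> is the 2-cocycle identity that makes the deformed
  product associative. The product \<open>c\<close> is prescribed on basis elements only, because
  \<open>comp_sub\<close> is meaningful only for subobjects.\<close>

locale twisted_basis =
  fixes Ob :: "'o set" and B :: "'o \<Rightarrow> 'o \<Rightarrow> 'b set"
    and c :: "'o \<Rightarrow> 'o \<Rightarrow> 'o \<Rightarrow> 'b \<Rightarrow> 'b \<Rightarrow> ('b \<Rightarrow>\<^sub>0 'k::field)" and u :: "'o \<Rightarrow> 'b"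
    and m :: "'o \<Rightarrow> 'o \<Rightarrow> 'o \<Rightarrow> 'b \<Rightarrow> 'b \<Rightarrow> 'b" and w :: "'o \<Rightarrow> 'o \<Rightarrow> 'o \<Rightarrow> 'b \<Rightarrow> 'b \<Rightarrow> 'k"
  assumes c_eq: "\<lbrakk>x \<in> Ob; y \<in> Ob; z \<in> Ob; r \<in> B x y; s \<in> B y z\<rbrakk>
      \<Longrightarrow> c x y z s r = Poly_Mapping.single (m x y z s r) (w x y z s r)"
    and m_in: "\<lbrakk>x \<in> Ob; y \<in> Ob; z \<in> Ob; r \<in> B x y; s \<in> B y z\<rbrakk> \<Longrightarrow> m x y z s r \<in> B x z"
    and u_in: "x \<in> Ob \<Longrightarrow> u x \<in> B x x"
    and m_u: "\<lbrakk>x \<in> Ob; y \<in> Ob; r \<in> B x y\<rbrakk> \<Longrightarrow> m x x y r (u x) = r"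
    and u_m: "\<lbrakk>x \<in> Ob; y \<in> Ob; r \<in> B x y\<rbrakk> \<Longrightarrow> m x y y (u y) r = r"
    and w_u: "\<lbrakk>x \<in> Ob; y \<in> Ob; r \<in> B x y\<rbrakk> \<Longrightarrow> w x x y r (u x) = 1"
    and u_w: "\<lbrakk>x \<in> Ob; y \<in> Ob; r \<in> B x y\<rbrakk> \<Longrightarrow> w x y y (u y) r = 1"
    and m_assoc: "\<lbrakk>v \<in> Ob; x \<in> Ob; y \<in> Ob; z \<in> Ob; r \<in> B v x; s \<in> B x y; q \<in> B y z\<rbrakk>
      \<Longrightarrow> m v y z q (m v x y s r) = m v x z (m x y z q s) r"
    and w_assoc: "\<lbrakk>v \<in> Ob; x \<in> Ob; y \<in> Ob; z \<in> Ob; r \<in> B v x; s \<in> B x y; q \<in> B y z\<rbrakk>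
      \<Longrightarrow> w v y z q (m v x y s r) * w v x y s r = w v x z (m x y z q s) r * w x y z q s"
begin

abbreviation L :: "('o, 'b \<Rightarrow>\<^sub>0 'k) cat" where
  "L \<equiv> linear_cat Ob B c u"

lemma L_simps:
  "ob L = Ob" "(f \<in> arr L x y) = (Poly_Mapping.keys f \<subseteq> B x y)"
  "ide L x = Poly_Mapping.single (u x) 1"
  by (simp_all add: linear_cat_def)

text \<open>The support of a sum can shrink by cancellation. Summing over arbitrary finite supersets
  \<open>R\<close> and \<open>S\<close> allows the three terms of an additivity statement to share
  one index set.\<close>

lemma cmp_L:
  assumes "x \<in> Ob" and "y \<in> Ob" and "z \<in> Ob" and f: "f \<in> arr L x y" and g: "g \<in> arr L y z"
    and R: "finite R" "Poly_Mapping.keys f \<subseteq> R" and S: "finite S" "Poly_Mapping.keys g \<subseteq> S"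
  shows "cmp L x y z g f = (\<Sum>s\<in>S. \<Sum>r\<in>R. Poly_Mapping.single (m x y z s r)
    (Poly_Mapping.lookup g s * Poly_Mapping.lookup f r * w x y z s r))" (is "_ = (\<Sum>s\<in>S. \<Sum>r\<in>R. ?t s r)")
proof -
  have "cmp L x y z g f = (\<Sum>s\<in>Poly_Mapping.keys g. \<Sum>r\<in>Poly_Mapping.keys f. ?t s r)"
    using assms(1-3) f g
    by (auto simp: linear_cat_def c_eq when_def subset_iff intro!: sum.cong)
  also have "\<dots> = (\<Sum>s\<in>S. \<Sum>r\<in>Poly_Mapping.keys f. ?t s r)"
    using S by (intro sum.mono_neutral_left) (auto simp: in_keys_iff)
  also have "\<dots> = (\<Sum>s\<in>S. \<Sum>r\<in>R. ?t s r)"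
    using R by (intro sum.cong sum.mono_neutral_left) (auto simp: in_keys_iff)
  finally show ?thesis .
qed

lemma cmp_L_single:
  assumes "x \<in> Ob" and "y \<in> Ob" and "z \<in> Ob" and "r \<in> B x y" and "s \<in> B y z"
  shows "cmp L x y z (Poly_Mapping.single s b) (Poly_Mapping.single r a) =
    Poly_Mapping.single (m x y z s r) (b * a * w x y z s r)"
  using cmp_L[OF assms(1-3), of "Poly_Mapping.single r a" "Poly_Mapping.single s b" "{r}" "{s}"] assms
  by (simp add: L_simps)

lemma biadditive_L: "biadditive L"
  unfolding biadditive_def L_simps(1)
proof (intro conjI ballI)
  fix x y z f g f'
  assume o: "x \<in> Ob" "y \<in> Ob" "z \<in> Ob" and f: "f \<in> arr L x y" and f': "f' \<in> arr L x y"
    and g: "g \<in> arr L y z"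
  let ?R = "Poly_Mapping.keys f \<union> Poly_Mapping.keys f'" and ?S = "Poly_Mapping.keys g"
  have ff': "f + f' \<in> arr L x y" "Poly_Mapping.keys (f + f') \<subseteq> ?R"
    using f f' Poly_Mapping.keys_add[of f f'] by (auto simp: L_simps)
  show "cmp L x y z g (f + f') = cmp L x y z g f + cmp L x y z g f'"
    using cmp_L[OF o ff'(1) g, of ?R ?S] cmp_L[OF o f g, of ?R ?S] cmp_L[OF o f' g, of ?R ?S] ff'
    by (simp add: lookup_add algebra_simps single_add sum.distrib)
next
  fix x y z f g g'
  assume o: "x \<in> Ob" "y \<in> Ob" "z \<in> Ob" and f: "f \<in> arr L x y" and g: "g \<in> arr L y z"
    and g': "g' \<in> arr L y z"
  let ?R = "Poly_Mapping.keys f" and ?S = "Poly_Mapping.keys g \<union> Poly_Mapping.keys g'"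
  have gg': "g + g' \<in> arr L y z" "Poly_Mapping.keys (g + g') \<subseteq> ?S"
    using g g' Poly_Mapping.keys_add[of g g'] by (auto simp: L_simps)
  show "cmp L x y z (g + g') f = cmp L x y z g f + cmp L x y z g' f"
    using cmp_L[OF o f gg'(1), of ?R ?S] cmp_L[OF o f g, of ?R ?S] cmp_L[OF o f g', of ?R ?S] gg'
    by (simp add: lookup_add algebra_simps single_add sum.distrib)
next
  fix x y f g
  assume "f \<in> arr L x y" "g \<in> arr L x y"
  then show "f + g \<in> arr L x y"
    using Poly_Mapping.keys_add[of f g] by (auto simp: L_simps)
qed (simp_all add: linear_cat_def)

lemma single_in_arr: "r \<in> B x y \<Longrightarrow> Poly_Mapping.single r a \<in> arr L x y"
  by (simp add: L_simps)

lemma sum_single_lookup: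
  "(\<Sum>k\<in>Poly_Mapping.keys f. Poly_Mapping.single k (Poly_Mapping.lookup f k)) = f"
proof (rule poly_mapping_eqI)
  fix k
  have "Poly_Mapping.lookup (\<Sum>k\<in>Poly_Mapping.keys f. Poly_Mapping.single k (Poly_Mapping.lookup f k)) k =
      (\<Sum>j\<in>Poly_Mapping.keys f. if j = k then Poly_Mapping.lookup f k else 0)"
    by (auto simp: lookup_sum lookup_single when_def intro!: sum.cong)
  then show "Poly_Mapping.lookup (\<Sum>k\<in>Poly_Mapping.keys f. Poly_Mapping.single k (Poly_Mapping.lookup f k)) k =
      Poly_Mapping.lookup f k"
    by (simp add: in_keys_iff)
qed

text \<open>Reduces identities that are additive in an arrow to basis elements. All partial sums
  stay in the hom-set, so that biadditivity is available in the \<open>add\<close> case.\<close>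

lemma arr_induct [consumes 1, case_names zero single add]:
  assumes "f \<in> arr L x y" and "P 0" and "\<And>r a. r \<in> B x y \<Longrightarrow> P (Poly_Mapping.single r a)"
    and "\<And>f g. \<lbrakk>f \<in> arr L x y; g \<in> arr L x y; P f; P g\<rbrakk> \<Longrightarrow> P (f + g)"
  shows "P f"
proof -
  let ?s = "\<lambda>K. \<Sum>k\<in>K. Poly_Mapping.single k (Poly_Mapping.lookup f k)"
  have "?s K \<in> arr L x y \<and> P (?s K)" if "finite K" "K \<subseteq> B x y" for K
    using that
  proof (induction K rule: finite_induct)
    case (insert k K)
    then have "Poly_Mapping.single k (Poly_Mapping.lookup f k) \<in> arr L x y"
      by (simp add: single_in_arr)
    moreover have "a + b \<in> arr L x y" if "a \<in> arr L x y" "b \<in> arr L x y" for a b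
      using that Poly_Mapping.keys_add[of a b] by (auto simp: L_simps)
    ultimately show ?case
      using insert assms(3,4) by simp
  qed (simp add: L_simps assms(2))
  from this[of "Poly_Mapping.keys f"] show ?thesis
    using assms(1) by (simp add: L_simps sum_single_lookup)
qed

lemma cmp_L_in_arr:
  assumes "x \<in> Ob" and "y \<in> Ob" and "z \<in> Ob" and f: "f \<in> arr L x y" and g: "g \<in> arr L y z"
  shows "cmp L x y z g f \<in> arr L x z"
proof -
  have "(\<Sum>s\<in>Poly_Mapping.keys g. \<Sum>r\<in>Poly_Mapping.keys f. Poly_Mapping.single (m x y z s r)
    (Poly_Mapping.lookup g s * Poly_Mapping.lookup f r * w x y z s r)) \<in> arr L x z"
    using assms
    by (intro sum_in_arr[OF biadditive_L]) (auto simp: L_simps(1,2) intro!: m_in)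
  then show ?thesis
    using cmp_L[OF assms finite_keys subset_refl finite_keys subset_refl] by simp
qed

lemma category_L: "category L"
proof (rule categoryI; unfold L_simps(1))
  note addl = cmp_add_left[OF biadditive_L, unfolded L_simps(1)]
    and addr = cmp_add_right[OF biadditive_L, unfolded L_simps(1)]
    and zeros = cmp_zero_left[OF biadditive_L, unfolded L_simps(1)]
      cmp_zero_right[OF biadditive_L, unfolded L_simps(1)]
  show ide: "ide L x \<in> arr L x x" if "x \<in> Ob" for x
    using that by (simp add: L_simps u_in)
  show "cmp L x y z g f \<in> arr L x z"
    if "x \<in> Ob" "y \<in> Ob" "z \<in> Ob" "f \<in> arr L x y" "g \<in> arr L y z" for x y z f g
    using that by (rule cmp_L_in_arr)
  show "cmp L x x y f (ide L x) = f" if o: "x \<in> Ob" "y \<in> Ob" and f: "f \<in> arr L x y" for x y f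
    using f
  proof (induction rule: arr_induct)
    case (add f g)
    then show ?case using o ide[OF o(1)] by (simp add: addl)
  qed (use o ide[OF o(1)] in \<open>simp_all add: zeros L_simps(3) cmp_L_single u_in m_u w_u\<close>)
  show "cmp L x y y (ide L y) f = f" if o: "x \<in> Ob" "y \<in> Ob" and f: "f \<in> arr L x y" for x y f
    using f
  proof (induction rule: arr_induct)
    case (add f g)
    then show ?case using o ide[OF o(2)] by (simp add: addr)
  qed (use o ide[OF o(2)] in \<open>simp_all add: zeros L_simps(3) cmp_L_single u_in u_m u_w\<close>)
next
  fix v x y z f g h
  assume o: "v \<in> Ob" "x \<in> Ob" "y \<in> Ob" "z \<in> Ob" and f: "f \<in> arr L v x" and g: "g \<in> arr L x y"
    and h: "h \<in> arr L y z"
  note addl = cmp_add_left[OF biadditive_L, unfolded L_simps(1)]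
    and addr = cmp_add_right[OF biadditive_L, unfolded L_simps(1)]
    and zerol = cmp_zero_left[OF biadditive_L, unfolded L_simps(1)]
    and zeror = cmp_zero_right[OF biadditive_L, unfolded L_simps(1)]
  from f show "cmp L v y z h (cmp L v x y g f) = cmp L v x z (cmp L x y z h g) f"
  proof (induction rule: arr_induct)
    case zero
    then show ?case
      using o g h cmp_L_in_arr[OF o(2-4) g h] by (simp add: zeror)
  next
    case (add f f')
    then show ?case
      using o g h cmp_L_in_arr[OF o(2-4) g h] cmp_L_in_arr[OF o(1-3) add(1) g]
        cmp_L_in_arr[OF o(1-3) add(2) g]
      by (simp add: addr)
  next
    case (single r a)
    note f = single_in_arr[OF single]
    from g show ?case
    proof (induction rule: arr_induct)
      case zero
      then show ?case
        using o f h by (simp add: zeror zerol)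
    next
      case (add g g')
      then show ?case
        using o f h cmp_L_in_arr[OF o(2-4) add(1) h] cmp_L_in_arr[OF o(2-4) add(2) h]
          cmp_L_in_arr[OF o(1-3) f add(1)] cmp_L_in_arr[OF o(1-3) f add(2)]
        by (simp add: addl addr)
    next
      case s: (single s b)
      note g = single_in_arr[OF s]
      from h show ?case
      proof (induction rule: arr_induct)
        case zero
        then show ?case
          using o f g cmp_L_in_arr[OF o(1-3) f g] by (simp add: zerol)
      next
        case (add h h')
        then show ?case
          using o f g cmp_L_in_arr[OF o(1-3) f g] cmp_L_in_arr[OF o(2-4) g add(1)]
            cmp_L_in_arr[OF o(2-4) g add(2)]
          by (simp add: addl)
      next
        case (single q d)
        \<comment> \<open>On three basis elements associativity is \<open>m_assoc\<close> for the
          basis element and the cocycle identity \<open>w_assoc\<close> for its coefficient.\<close>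
        show ?case
          using w_assoc[OF o \<open>r \<in> B v x\<close> s single] o \<open>r \<in> B v x\<close> s single
          by (simp add: cmp_L_single m_in m_assoc mult_ac)
      qed
    qed
  qed
qed

end

section \<open>Linear functors induced by maps of twisted bases\<close>

locale twisted_basis_map =
  C: twisted_basis Ob B c u m w + D: twisted_basis Ob' B' c' u' m' w'
  for Ob :: "'o set" and B :: "'o \<Rightarrow> 'o \<Rightarrow> 'b set"
    and c :: "'o \<Rightarrow> 'o \<Rightarrow> 'o \<Rightarrow> 'b \<Rightarrow> 'b \<Rightarrow> ('b \<Rightarrow>\<^sub>0 'k::field)" and u m w
    and Ob' :: "'p set" and B' :: "'p \<Rightarrow> 'p \<Rightarrow> 'c set"
    and c' :: "'p \<Rightarrow> 'p \<Rightarrow> 'p \<Rightarrow> 'c \<Rightarrow> 'c \<Rightarrow> ('c \<Rightarrow>\<^sub>0 'k)" and u' m' w' +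
  fixes F :: "'o \<Rightarrow> 'p" and \<phi> :: "'o \<Rightarrow> 'o \<Rightarrow> 'b \<Rightarrow> 'c"
  assumes F_in: "x \<in> Ob \<Longrightarrow> F x \<in> Ob'"
    and \<phi>_in: "\<lbrakk>x \<in> Ob; y \<in> Ob; r \<in> B x y\<rbrakk> \<Longrightarrow> \<phi> x y r \<in> B' (F x) (F y)"
    and \<phi>_u: "x \<in> Ob \<Longrightarrow> \<phi> x x (u x) = u' (F x)"
    and \<phi>_m: "\<lbrakk>x \<in> Ob; y \<in> Ob; z \<in> Ob; r \<in> B x y; s \<in> B y z\<rbrakk>
      \<Longrightarrow> \<phi> x z (m x y z s r) = m' (F x) (F y) (F z) (\<phi> y z s) (\<phi> x y r)"
    and \<phi>_w: "\<lbrakk>x \<in> Ob; y \<in> Ob; z \<in> Ob; r \<in> B x y; s \<in> B y z\<rbrakk>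
      \<Longrightarrow> w' (F x) (F y) (F z) (\<phi> y z s) (\<phi> x y r) = w x y z s r"
begin

definition Fun :: "('o, 'b \<Rightarrow>\<^sub>0 'k, 'p, 'c \<Rightarrow>\<^sub>0 'k) func" where
  "Fun = \<lparr>fob = F, farr = (\<lambda>x y f. \<Sum>r\<in>Poly_Mapping.keys f.
     Poly_Mapping.single (\<phi> x y r) (Poly_Mapping.lookup f r))\<rparr>"

lemma Fun_superset:
  assumes "finite R" and "Poly_Mapping.keys f \<subseteq> R"
  shows "farr Fun x y f = (\<Sum>r\<in>R. Poly_Mapping.single (\<phi> x y r) (Poly_Mapping.lookup f r))"
  unfolding Fun_def using assms by (auto simp: in_keys_iff intro!: sum.mono_neutral_left)

lemma Fun_simps:
  "fob Fun = F" "farr Fun x y 0 = 0"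
  "farr Fun x y (Poly_Mapping.single r a) = Poly_Mapping.single (\<phi> x y r) a"
  using Fun_superset[of "{r}" "Poly_Mapping.single r a"] by (simp_all add: Fun_def)

lemma Fun_add: "farr Fun x y (f + g) = farr Fun x y f + farr Fun x y g"
  using Poly_Mapping.keys_add[of f g]
  by (simp add: Fun_superset[of "Poly_Mapping.keys f \<union> Poly_Mapping.keys g"] lookup_add
      single_add sum.distrib)

lemma Fun_in_arr:
  assumes o: "x \<in> Ob" "y \<in> Ob" and f: "f \<in> arr C.L x y"
  shows "farr Fun x y f \<in> arr D.L (F x) (F y)"
  using f
proof (induction rule: C.arr_induct)
  case (add f g)
  then show ?case
    using add_in_arr[OF D.biadditive_L] F_in o by (simp add: Fun_add D.L_simps(1))
qed (use o in \<open>simp_all add: Fun_simps D.L_simps(2) \<phi>_in\<close>)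

lemma is_functor_Fun: "is_functor C.L D.L Fun"
proof (rule is_functorI[OF C.category_L D.category_L]; unfold C.L_simps(1) D.L_simps(1) Fun_simps(1))
  show "F x \<in> Ob'" if "x \<in> Ob" for x
    using that by (rule F_in)
  show "farr Fun x y f \<in> arr D.L (F x) (F y)" if "x \<in> Ob" "y \<in> Ob" "f \<in> arr C.L x y" for x y f
    using that by (rule Fun_in_arr)
  show "farr Fun x x (ide C.L x) = ide D.L (F x)" if "x \<in> Ob" for x
    using that by (simp add: C.L_simps D.L_simps Fun_simps \<phi>_u)
next
  fix x y z f g
  assume o: "x \<in> Ob" "y \<in> Ob" "z \<in> Ob" and f: "f \<in> arr C.L x y" and g: "g \<in> arr C.L y z"
  note addl = cmp_add_left[OF C.biadditive_L, unfolded C.L_simps(1)]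
      cmp_add_left[OF D.biadditive_L, unfolded D.L_simps(1)]
    and addr = cmp_add_right[OF C.biadditive_L, unfolded C.L_simps(1)]
      cmp_add_right[OF D.biadditive_L, unfolded D.L_simps(1)]
    and zeros = cmp_zero_left[OF C.biadditive_L, unfolded C.L_simps(1)]
      cmp_zero_left[OF D.biadditive_L, unfolded D.L_simps(1)]
      cmp_zero_right[OF C.biadditive_L, unfolded C.L_simps(1)]
      cmp_zero_right[OF D.biadditive_L, unfolded D.L_simps(1)]
  from f show "farr Fun x z (cmp C.L x y z g f) =
      cmp D.L (F x) (F y) (F z) (farr Fun y z g) (farr Fun x y f)"
  proof (induction rule: C.arr_induct)
    case zero
    then show ?case
      using o g Fun_in_arr[OF o(2,3) g] by (simp add: zeros F_in Fun_simps)
  next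
    case (add f f')
    then show ?case
      using o g Fun_in_arr[OF o(2,3) g] Fun_in_arr[OF o(1,2)] by (simp add: addr F_in Fun_add)
  next
    case (single r a)
    note f = C.single_in_arr[OF single]
    from g show ?case
    proof (induction rule: C.arr_induct)
      case zero
      then show ?case
        using o f Fun_in_arr[OF o(1,2) f] by (simp add: zeros F_in Fun_simps(2))
    next
      case (add g g')
      then show ?case
        using o f Fun_in_arr[OF o(2,3)] Fun_in_arr[OF o(1,2) f] by (simp add: addl F_in Fun_add)
    next
      case s: (single s b)
      then show ?case
        using o single
        by (simp add: C.cmp_L_single D.cmp_L_single Fun_simps \<phi>_in F_in \<phi>_m \<phi>_w)
    qed
  qed
qed

lemma additive_functor_Fun: "additive_functor C.L D.L Fun"
  unfolding additive_functor_def
  by (simp add: C.biadditive_L D.biadditive_L is_functor_Fun Fun_simps Fun_add)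

text \<open>A linear map that carries a basis bijectively to a basis, without scalar factors, is an
  isomorphism; here it is precomposition with \<open>n\<close>. The weights are required to be
  \<open>1\<close> so that bijectivity is not lost where a power of \<open>t\<close>
  vanishes.\<close>

lemma universal_arrow_Fun:
  assumes x: "x \<in> Ob'" and v: "v \<in> Ob" and n: "n \<in> B' x (F v)"
    and bij: "\<And>y. y \<in> Ob \<Longrightarrow> bij_betw (\<lambda>r. m' x (F v) (F y) (\<phi> v y r) n) (B v y) (B' x (F y))"
    and w: "\<And>y r. y \<in> Ob \<Longrightarrow> r \<in> B v y \<Longrightarrow> w' x (F v) (F y) (\<phi> v y r) n = 1"
  shows "universal_arrow C.L D.L Fun x v (Poly_Mapping.single n 1)"
  unfolding universal_arrow_def C.L_simps(1) Fun_simps(1)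
proof (intro conjI ballI)
  show "Poly_Mapping.single n 1 \<in> arr D.L x (F v)"
    using n by (rule D.single_in_arr)
next
  fix y f
  assume y: "y \<in> Ob" and f: "f \<in> arr D.L x (F y)"
  let ?\<psi> = "\<lambda>r. m' x (F v) (F y) (\<phi> v y r) n"
  let ?t = "\<lambda>g. cmp D.L x (F v) (F y) (farr Fun v y g) (Poly_Mapping.single n 1)"
  note n_arr = D.single_in_arr[OF n, of 1]
  note biadd = cmp_add_left[OF D.biadditive_L, unfolded D.L_simps(1)]
    cmp_zero_left[OF D.biadditive_L, unfolded D.L_simps(1)]
  have t_single: "?t (Poly_Mapping.single r a) = Poly_Mapping.single (?\<psi> r) a" if "r \<in> B v y" for r a
    using that v y x n w by (simp add: Fun_simps D.cmp_L_single \<phi>_in F_in)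
  have t_add: "?t (g + h) = ?t g + ?t h" if "g \<in> arr C.L v y" "h \<in> arr C.L v y" for g h
    using that x v y n_arr farr_in_arr[OF is_functor_Fun]
    by (simp add: Fun_add biadd F_in C.L_simps(1) Fun_simps(1))
  have t_zero: "?t 0 = 0"
    using x v y n_arr by (simp add: Fun_simps(2) biadd F_in)
  \<comment> \<open>Since \<open>?\<psi>\<close> is injective on basis elements, the coefficients of
    \<open>g\<close> can be read off from \<open>?t g\<close>. Injectivity of \<open>?t\<close>
    follows from this.\<close>
  have lookup_t: "Poly_Mapping.lookup (?t g) (?\<psi> r) = Poly_Mapping.lookup g r"
    if "g \<in> arr C.L v y" and r: "r \<in> B v y" for g r
    using that(1)
  proof (induction rule: C.arr_induct)
    case (single s a)
    then have "?\<psi> s = ?\<psi> r \<longleftrightarrow> s = r"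
      using bij_betw_imp_inj_on[OF bij[OF y]] r by (auto dest: inj_onD)
    then show ?case
      using t_single[OF single] by (simp add: lookup_single when_def)
  qed (simp_all add: t_zero t_add lookup_add)
  have surj: "\<exists>g. g \<in> arr C.L v y \<and> ?t g = f"
    using f
  proof (induction rule: D.arr_induct)
    case zero
    then show ?case
      using t_zero by (intro exI[of _ 0]) (simp add: C.L_simps(2))
  next
    case (single s a)
    then have "s \<in> ?\<psi> ` B v y"
      using bij_betw_imp_surj_on[OF bij[OF y]] by simp
    then obtain r where s: "s = ?\<psi> r" and r: "r \<in> B v y"
      by (rule imageE)
    show ?case
      using C.single_in_arr[OF r] t_single[OF r] unfolding s by (intro exI conjI)
  next
    case (add f f')
    then obtain g g' where "g \<in> arr C.L v y" "?t g = f" "g' \<in> arr C.L v y" "?t g' = f'"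
      by blast
    then show ?case
      using t_add add_in_arr[OF C.biadditive_L] v y by (intro exI[of _ "g + g'"]) (simp add: C.L_simps(1))
  qed
  have inj: "g = h" if g: "g \<in> arr C.L v y" and h: "h \<in> arr C.L v y" and eq: "?t g = ?t h" for g h
  proof (rule poly_mapping_eqI)
    fix r
    show "Poly_Mapping.lookup g r = Poly_Mapping.lookup h r"
    proof (cases "r \<in> B v y")
      case True
      then show ?thesis
        using lookup_t[OF g] lookup_t[OF h] eq by metis
    next
      case False
      then have "r \<notin> Poly_Mapping.keys g" "r \<notin> Poly_Mapping.keys h"
        using g h by (auto simp: C.L_simps(2))
      then show ?thesis
        by (simp add: in_keys_iff)
    qed
  qed
  show "\<exists>!g. g \<in> arr C.L v y \<and> ?t g = f"
    by (rule ex_ex1I, rule surj) (elim conjE, rule inj, assumption+, erule trans, erule sym)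
qed (rule v)

end

section \<open>Finite vector spaces and linear relations\<close>

lemma linear_mapI:
  assumes "vectorspace K V" and "vectorspace K W"
    and "\<And>a. a \<in> carrier V \<Longrightarrow> f a \<in> carrier W"
    and "\<And>a b. \<lbrakk>a \<in> carrier V; b \<in> carrier V\<rbrakk> \<Longrightarrow> f (a \<oplus>\<^bsub>V\<^esub> b) = f a \<oplus>\<^bsub>W\<^esub> f b"
    and "\<And>k a. \<lbrakk>k \<in> carrier K; a \<in> carrier V\<rbrakk> \<Longrightarrow> f (k \<odot>\<^bsub>V\<^esub> a) = k \<odot>\<^bsub>W\<^esub> f a"
  shows "linear_map K V W f"
  using assms unfolding linear_map_def mod_hom_def mod_hom_axioms_def module_hom_def vectorspace_def
  by auto

lemmas linear_map_dom = linear_map.axioms(1)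
  and linear_map_cod = linear_map.axioms(2)
  and linear_map_closed = mod_hom.f_im[OF linear_map.axioms(3)]
  and linear_map_add = module_hom_add[OF mod_hom.f_hom[OF linear_map.axioms(3)]]
  and linear_map_smult = module_hom_smult[OF mod_hom.f_hom[OF linear_map.axioms(3)]]
  and linear_map_zero = mod_hom.f0_is_0[OF linear_map.axioms(3)]

lemma
  assumes "vectorspace K V"
  shows vs_zero_closed: "\<zero>\<^bsub>V\<^esub> \<in> carrier V"
    and vs_add_closed: "\<lbrakk>a \<in> carrier V; b \<in> carrier V\<rbrakk> \<Longrightarrow> a \<oplus>\<^bsub>V\<^esub> b \<in> carrier V"
    and vs_smult_closed: "\<lbrakk>k \<in> carrier K; a \<in> carrier V\<rbrakk> \<Longrightarrow> k \<odot>\<^bsub>V\<^esub> a \<in> carrier V"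
    and vs_zero_add: "a \<in> carrier V \<Longrightarrow> \<zero>\<^bsub>V\<^esub> \<oplus>\<^bsub>V\<^esub> a = a"
    and vs_smult_zero: "k \<in> carrier K \<Longrightarrow> k \<odot>\<^bsub>V\<^esub> \<zero>\<^bsub>V\<^esub> = \<zero>\<^bsub>V\<^esub>"
proof -
  interpret vectorspace K V by fact
  show "\<zero>\<^bsub>V\<^esub> \<in> carrier V" by simp
  show "\<lbrakk>a \<in> carrier V; b \<in> carrier V\<rbrakk> \<Longrightarrow> a \<oplus>\<^bsub>V\<^esub> b \<in> carrier V" by simp
  show "\<lbrakk>k \<in> carrier K; a \<in> carrier V\<rbrakk> \<Longrightarrow> k \<odot>\<^bsub>V\<^esub> a \<in> carrier V" by simp
  show "a \<in> carrier V \<Longrightarrow> \<zero>\<^bsub>V\<^esub> \<oplus>\<^bsub>V\<^esub> a = a" by simp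
  show "k \<in> carrier K \<Longrightarrow> k \<odot>\<^bsub>V\<^esub> \<zero>\<^bsub>V\<^esub> = \<zero>\<^bsub>V\<^esub>" by simp
qed

lemma linear_map_comp:
  assumes "linear_map K U V f" and "linear_map K V W g"
  shows "linear_map K U W (\<lambda>a. g (f a))"
  by (rule linear_mapI[OF linear_map_dom[OF assms(1)] linear_map_cod[OF assms(2)]])
    (simp_all add: linear_map_closed[OF assms(1)] linear_map_closed[OF assms(2)]
      linear_map_add[OF assms(1)] linear_map_add[OF assms(2)]
      linear_map_smult[OF assms(1)] linear_map_smult[OF assms(2)])

lemma linear_map_cong:
  assumes "linear_map K V W f" and "\<And>a. a \<in> carrier V \<Longrightarrow> g a = f a"
  shows "linear_map K V W g"
  by (rule linear_mapI[OF linear_map_dom[OF assms(1)] linear_map_cod[OF assms(1)]])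
    (simp_all add: assms(2) linear_map_closed[OF assms(1)] linear_map_add[OF assms(1)]
      linear_map_smult[OF assms(1)] vs_add_closed[OF linear_map_dom[OF assms(1)]]
      vs_smult_closed[OF linear_map_dom[OF assms(1)]])

lemma subspaceI:
  assumes "vectorspace K V" and "R \<subseteq> carrier V" and "\<zero>\<^bsub>V\<^esub> \<in> R"
    and "\<And>a b. \<lbrakk>a \<in> R; b \<in> R\<rbrakk> \<Longrightarrow> a \<oplus>\<^bsub>V\<^esub> b \<in> R"
    and "\<And>k a. \<lbrakk>k \<in> carrier K; a \<in> R\<rbrakk> \<Longrightarrow> k \<odot>\<^bsub>V\<^esub> a \<in> R"
  shows "subspace K R V"
  using assms by (auto simp: subspace_def submodule_def vectorspace_def)

lemma
  assumes "subspace K R V"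
  shows subspace_subset: "R \<subseteq> carrier V"
    and subspace_zero: "\<zero>\<^bsub>V\<^esub> \<in> R"
    and subspace_add: "\<lbrakk>a \<in> R; b \<in> R\<rbrakk> \<Longrightarrow> a \<oplus>\<^bsub>V\<^esub> b \<in> R"
    and subspace_smult: "\<lbrakk>k \<in> carrier K; a \<in> R\<rbrakk> \<Longrightarrow> k \<odot>\<^bsub>V\<^esub> a \<in> R"
    and subspace_vectorspace: "vectorspace K V"
  using assms by (auto simp: subspace_def submodule_def)

text \<open>Closure, the equations and the existence of negatives all pass to the image of a
  surjection that respects the operations. As \<open>f\<close> need not be injective, this covers
  both copies along bijections and quotients.\<close>

lemma vectorspace_surj_image:
  assumes "vectorspace K V" and onto: "f ` carrier V = carrier W"
    and add: "\<And>a b. \<lbrakk>a \<in> carrier V; b \<in> carrier V\<rbrakk> \<Longrightarrow> f (a \<oplus>\<^bsub>V\<^esub> b) = f a \<oplus>\<^bsub>W\<^esub> f b"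
    and smult: "\<And>k a. \<lbrakk>k \<in> carrier K; a \<in> carrier V\<rbrakk> \<Longrightarrow> f (k \<odot>\<^bsub>V\<^esub> a) = k \<odot>\<^bsub>W\<^esub> f a"
    and zero: "f \<zero>\<^bsub>V\<^esub> = \<zero>\<^bsub>W\<^esub>"
  shows "vectorspace K W"
proof -
  interpret vectorspace K V by fact
  have ball: "(\<forall>v\<in>carrier W. P v) \<longleftrightarrow> (\<forall>a\<in>carrier V. P (f a))" for P
    unfolding onto[symmetric] by blast
  have in_W: "f a \<in> carrier W" if "a \<in> carrier V" for a
    using that onto by blast
  note s = add[symmetric] smult[symmetric] zero[symmetric]
  show ?thesis
  proof (rule vs_criteria)
    show "field K" by unfold_locales
    show "\<zero>\<^bsub>W\<^esub> \<in> carrier W" using in_W zero by force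
    have "\<forall>v\<in>carrier W. \<forall>w\<in>carrier W. v \<oplus>\<^bsub>W\<^esub> w \<in> carrier W"
      unfolding ball by (auto simp: s intro!: in_W)
    then show "\<forall>v w. v \<in> carrier W \<and> w \<in> carrier W \<longrightarrow> v \<oplus>\<^bsub>W\<^esub> w \<in> carrier W" by blast
    show "\<forall>v\<in>carrier W. \<exists>neg_v\<in>carrier W. v \<oplus>\<^bsub>W\<^esub> neg_v = \<zero>\<^bsub>W\<^esub>"
      unfolding ball
    proof
      fix a assume a: "a \<in> carrier V"
      then have "f a \<oplus>\<^bsub>W\<^esub> f (\<ominus>\<^bsub>V\<^esub> a) = \<zero>\<^bsub>W\<^esub>"
        by (simp add: s M.r_neg)
      then show "\<exists>neg_v\<in>carrier W. f a \<oplus>\<^bsub>W\<^esub> neg_v = \<zero>\<^bsub>W\<^esub>"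
        using in_W[OF M.a_inv_closed[OF a]] by blast
    qed
    have "\<forall>c\<in>carrier K. \<forall>v\<in>carrier W. c \<odot>\<^bsub>W\<^esub> v \<in> carrier W"
      unfolding ball by (auto simp: s intro!: in_W)
    then show "\<forall>c v. c \<in> carrier K \<and> v \<in> carrier W \<longrightarrow> c \<odot>\<^bsub>W\<^esub> v \<in> carrier W" by blast
    have "\<forall>v\<in>carrier W. \<forall>w\<in>carrier W. v \<oplus>\<^bsub>W\<^esub> w = w \<oplus>\<^bsub>W\<^esub> v"
      unfolding ball by (auto simp: s M.a_comm)
    then show "\<forall>v w. v \<in> carrier W \<and> w \<in> carrier W \<longrightarrow> v \<oplus>\<^bsub>W\<^esub> w = w \<oplus>\<^bsub>W\<^esub> v" by blast
    have "\<forall>v\<in>carrier W. \<forall>w\<in>carrier W. \<forall>x\<in>carrier W. (v \<oplus>\<^bsub>W\<^esub> w) \<oplus>\<^bsub>W\<^esub> x = v \<oplus>\<^bsub>W\<^esub> (w \<oplus>\<^bsub>W\<^esub> x)"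
      unfolding ball by (auto simp: s M.a_assoc)
    then show "\<forall>v w x. v \<in> carrier W \<and> w \<in> carrier W \<and> x \<in> carrier W \<longrightarrow>
        (v \<oplus>\<^bsub>W\<^esub> w) \<oplus>\<^bsub>W\<^esub> x = v \<oplus>\<^bsub>W\<^esub> (w \<oplus>\<^bsub>W\<^esub> x)" by blast
    show "\<forall>v\<in>carrier W. v \<oplus>\<^bsub>W\<^esub> \<zero>\<^bsub>W\<^esub> = v"
      unfolding ball by (auto simp: s)
    have "\<forall>a\<in>carrier K. \<forall>b\<in>carrier K. \<forall>v\<in>carrier W. (a \<otimes>\<^bsub>K\<^esub> b) \<odot>\<^bsub>W\<^esub> v = a \<odot>\<^bsub>W\<^esub> (b \<odot>\<^bsub>W\<^esub> v)"
      unfolding ball by (auto simp: s smult_assoc1)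
    then show "\<forall>a b v. a \<in> carrier K \<and> b \<in> carrier K \<and> v \<in> carrier W \<longrightarrow>
        (a \<otimes>\<^bsub>K\<^esub> b) \<odot>\<^bsub>W\<^esub> v = a \<odot>\<^bsub>W\<^esub> (b \<odot>\<^bsub>W\<^esub> v)" by blast
    show "\<forall>v\<in>carrier W. \<one>\<^bsub>K\<^esub> \<odot>\<^bsub>W\<^esub> v = v"
      unfolding ball by (auto simp: s)
    have "\<forall>a\<in>carrier K. \<forall>b\<in>carrier K. \<forall>v\<in>carrier W.
        (a \<oplus>\<^bsub>K\<^esub> b) \<odot>\<^bsub>W\<^esub> v = (a \<odot>\<^bsub>W\<^esub> v) \<oplus>\<^bsub>W\<^esub> (b \<odot>\<^bsub>W\<^esub> v)"
      unfolding ball by (auto simp: s smult_l_distr)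
    then show "\<forall>a b v. a \<in> carrier K \<and> b \<in> carrier K \<and> v \<in> carrier W \<longrightarrow>
        (a \<oplus>\<^bsub>K\<^esub> b) \<odot>\<^bsub>W\<^esub> v = (a \<odot>\<^bsub>W\<^esub> v) \<oplus>\<^bsub>W\<^esub> (b \<odot>\<^bsub>W\<^esub> v)" by blast
    have "\<forall>a\<in>carrier K. \<forall>v\<in>carrier W. \<forall>w\<in>carrier W.
        a \<odot>\<^bsub>W\<^esub> (v \<oplus>\<^bsub>W\<^esub> w) = (a \<odot>\<^bsub>W\<^esub> v) \<oplus>\<^bsub>W\<^esub> (a \<odot>\<^bsub>W\<^esub> w)"
      unfolding ball by (auto simp: s smult_r_distr)
    then show "\<forall>a v w. a \<in> carrier K \<and> v \<in> carrier W \<and> w \<in> carrier W \<longrightarrow>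
        a \<odot>\<^bsub>W\<^esub> (v \<oplus>\<^bsub>W\<^esub> w) = (a \<odot>\<^bsub>W\<^esub> v) \<oplus>\<^bsub>W\<^esub> (a \<odot>\<^bsub>W\<^esub> w)" by blast
  qed
qed

lemma image_module_simps:
  assumes "inj_on h (carrier M)"
  shows "carrier (image_module h M) = h ` carrier M"
    and "\<zero>\<^bsub>image_module h M\<^esub> = h \<zero>\<^bsub>M\<^esub>"
    and "\<lbrakk>a \<in> carrier M; b \<in> carrier M\<rbrakk> \<Longrightarrow> h a \<oplus>\<^bsub>image_module h M\<^esub> h b = h (a \<oplus>\<^bsub>M\<^esub> b)"
    and "a \<in> carrier M \<Longrightarrow> k \<odot>\<^bsub>image_module h M\<^esub> h a = h (k \<odot>\<^bsub>M\<^esub> a)"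
  using assms by (simp_all add: image_module_def Let_def)

lemma vectorspace_image_module:
  assumes "vectorspace K M" and "inj_on h (carrier M)"
  shows "vectorspace K (image_module h M)"
  by (rule vectorspace_surj_image[OF assms(1), of h]) (simp_all add: image_module_simps[OF assms(2)])

lemma linear_map_image_module:
  assumes "vectorspace K M" and "inj_on h (carrier M)"
  shows "linear_map K M (image_module h M) h"
  by (rule linear_mapI[OF assms(1) vectorspace_image_module[OF assms]])
    (simp_all add: image_module_simps[OF assms(2)])

lemma linear_map_inv_into:
  assumes f: "linear_map K V W f" and bij: "bij_betw f (carrier V) (carrier W)"
  shows "linear_map K W V (inv_into (carrier V) f)"
proof -
  note V = linear_map_dom[OF f] and W = linear_map_cod[OF f]
  let ?g = "inv_into (carrier V) f"
  have g: "?g b \<in> carrier V" "f (?g b) = b" if "b \<in> carrier W" for b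
    using that bij by (auto simp: bij_betw_def inv_into_into f_inv_into_f)
  have fg: "?g (f a) = a" if "a \<in> carrier V" for a
    using that bij by (auto simp: bij_betw_def)
  show ?thesis
  proof (rule linear_mapI[OF W V])
    show "?g (a \<oplus>\<^bsub>W\<^esub> b) = ?g a \<oplus>\<^bsub>V\<^esub> ?g b" if "a \<in> carrier W" "b \<in> carrier W" for a b
      using fg[OF vs_add_closed[OF V g(1)[OF that(1)] g(1)[OF that(2)]]]
        linear_map_add[OF f] g that by simp
    show "?g (k \<odot>\<^bsub>W\<^esub> a) = k \<odot>\<^bsub>V\<^esub> ?g a" if "k \<in> carrier K" "a \<in> carrier W" for k a
      using fg[OF vs_smult_closed[OF V that(1) g(1)[OF that(2)]]] linear_map_smult[OF f] g that by simp
  qed (rule g)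
qed

lemma card_vectorspace:
  assumes "vectorspace K V" and "vectorspace.fin_dim K V" and finK: "finite (carrier K)"
  shows "finite (carrier V)" and "card (carrier V) = card (carrier K) ^ vectorspace.dim K V"
proof -
  interpret vectorspace K V by fact
  obtain \<beta> where \<beta>: "finite \<beta>" "basis \<beta>"
    using finite_basis_exists assms(2) by blast
  have sub: "\<beta> \<subseteq> carrier V"
    using \<beta>(2) by (simp add: basis_def)
  have ex1: "\<And>v. v \<in> carrier V \<Longrightarrow> \<exists>!a. a \<in> \<beta> \<rightarrow>\<^sub>E carrier K \<and> lincomb a \<beta> = v"
    using basis_criterion[OF \<beta>(1) sub] \<beta>(2) by blast
  have closed: "lincomb a \<beta> \<in> carrier V" if "a \<in> \<beta> \<rightarrow>\<^sub>E carrier K" for a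
    using that sub by (intro lincomb_closed) (auto simp: PiE_def)
  \<comment> \<open>Coordinates in the basis: extensional coefficient functions make the
    representation of a vector unique, and there are \<open>card (carrier K)\<close> to the power
    \<open>card \<beta>\<close> of them.\<close>
  have bij: "bij_betw (\<lambda>a. lincomb a \<beta>) (\<beta> \<rightarrow>\<^sub>E carrier K) (carrier V)"
    unfolding bij_betw_def
  proof
    show "inj_on (\<lambda>a. lincomb a \<beta>) (\<beta> \<rightarrow>\<^sub>E carrier K)"
      using ex1 closed by (intro inj_onI) blast
    show "(\<lambda>a. lincomb a \<beta>) ` (\<beta> \<rightarrow>\<^sub>E carrier K) = carrier V"
      using ex1 closed by blast
  qed
  show "finite (carrier V)"
    using bij_betw_finite[OF bij] finite_PiE[of \<beta> "\<lambda>_. carrier K"] \<beta>(1) finK by blast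
  show "card (carrier V) = card (carrier K) ^ dim"
    using bij_betw_same_card[OF bij] card_PiE[OF \<beta>(1), of "\<lambda>_. carrier K"] dim_basis[OF \<beta>]
    by (simp add: prod_constant)
qed

lemma fin_dim_if_finite:
  assumes "vectorspace K V" and "finite (carrier V)"
  shows "vectorspace.fin_dim K V"
proof -
  interpret vectorspace K V by fact
  have "carrier V \<subseteq> span (carrier V)"
    by (rule in_own_span) simp
  then have "gen_set (carrier V)"
    using span_is_subset2[of "carrier V"] by blast
  then show ?thesis
    unfolding fin_dim_def using assms(2) by blast
qed

text \<open>Over a finite field finite dimension and finiteness coincide. Finiteness is the form
  that serves counting and copying into \<open>'v\<close>.\<close>

lemma Vect_ob_iff:
  assumes "finite (carrier K)"
  shows "V \<in> ob (Vect K) \<longleftrightarrow> vectorspace K V \<and> finite (carrier V)"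
  using card_vectorspace(1)[OF _ _ assms] fin_dim_if_finite by (auto simp: Vect_def)

lemma card_subspace:
  assumes "subspace K R V" and "finite (carrier K)" and "finite (carrier V)"
  shows "card R = card (carrier K) ^ vectorspace.dim K (V\<lparr>carrier := R\<rparr>)"
proof -
  have vs: "vectorspace K (V\<lparr>carrier := R\<rparr>)"
    using vectorspace.subspace_is_vs[OF subspace_vectorspace[OF assms(1)] assms(1)] .
  have "finite R"
    using finite_subset[OF subspace_subset[OF assms(1)] assms(3)] .
  then show ?thesis
    using card_vectorspace(2)[OF vs fin_dim_if_finite[OF vs] assms(2)] by simp
qed

text \<open>Products, pullbacks and direct sums are formed on pairs, while objects of the categories
  have elements in \<open>'v\<close>. A finite space can be copied onto any subset of
  \<open>'v\<close> of the same size, and an infinite type has such subsets.\<close>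

lemma realize_vectorspace:
  fixes M :: "('f, 'b) module"
  assumes inf: "infinite (UNIV :: 'v set)" and M: "vectorspace K M" and fin: "finite (carrier M)"
  obtains V :: "('f, 'v) module" and h
  where "vectorspace K V" and "finite (carrier V)" and "linear_map K V M h"
    and "bij_betw h (carrier V) (carrier M)"
proof -
  obtain T :: "'v set" where T: "finite T" "card T = card (carrier M)"
    using infinite_arbitrarily_large[OF inf] by blast
  obtain g where g: "bij_betw g (carrier M) T"
    using finite_same_card_bij[OF fin T(1)] T(2) by metis
  have inj: "inj_on g (carrier M)"
    using g by (rule bij_betw_imp_inj_on)
  let ?V = "image_module g M"
  have bij: "bij_betw g (carrier M) (carrier ?V)"
    using inj by (simp add: bij_betw_def image_module_simps[OF inj])
  show thesis
  proof (rule that)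
    show "vectorspace K ?V"
      by (rule vectorspace_image_module[OF M inj])
    show "finite (carrier ?V)"
      using fin by (simp add: image_module_simps[OF inj])
    show "linear_map K ?V M (inv_into (carrier M) g)"
      by (rule linear_map_inv_into[OF linear_map_image_module[OF M inj] bij])
    show "bij_betw (inv_into (carrier M) g) (carrier ?V) (carrier M)"
      by (rule bij_betw_inv_into[OF bij])
  qed
qed

text \<open>The quotient by \<open>I\<close> is formed on a system of representatives, so it stays in the type of \<open>V\<close>.\<close>

lemma quotient_map:
  fixes V :: "('f, 'v) module"
  assumes I: "subspace K I V" and ne: "I \<noteq> carrier V"
  obtains Q :: "('f, 'v) module" and f
  where "linear_map K V Q f" and "f ` carrier V = carrier Q" and "\<forall>a\<in>I. f a = \<zero>\<^bsub>Q\<^esub>"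
    and "\<exists>a\<in>carrier V. f a \<noteq> \<zero>\<^bsub>Q\<^esub>"
proof -
  interpret vectorspace K V
    by (rule subspace_vectorspace[OF I])
  have IV: "a \<in> carrier V" if "a \<in> I" for a
    using subspace_subset[OF I] that by blast
  have I_neg: "\<ominus>\<^bsub>V\<^esub> a \<in> I" if "a \<in> I" for a
    using subspace_smult[OF I, of "\<ominus>\<^bsub>K\<^esub> \<one>\<^bsub>K\<^esub>" a] that IV by (simp add: smult_minus_1)
  let ?E = "\<lambda>a b. b \<in> carrier V \<and> (\<exists>i\<in>I. b = a \<oplus>\<^bsub>V\<^esub> i)"
  define f where "f = (\<lambda>a. SOME b. ?E a b)"
  have Ef: "?E a (f a)" if "a \<in> carrier V" for a
    unfolding f_def
    by (rule someI[of "?E a" a]) (use that subspace_zero[OF I] in \<open>auto intro!: bexI[of _ "\<zero>\<^bsub>V\<^esub>"]\<close>)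
  have E_trans: "?E a c" if ac: "a \<in> carrier V" "?E a b" "?E b c" for a b c
  proof -
    obtain i j where "i \<in> I" "j \<in> I" "b = a \<oplus>\<^bsub>V\<^esub> i" "c = b \<oplus>\<^bsub>V\<^esub> j"
      using ac by blast
    then have "c = a \<oplus>\<^bsub>V\<^esub> (i \<oplus>\<^bsub>V\<^esub> j)"
      using ac IV by (simp add: M.a_assoc)
    then show ?thesis
      using subspace_add[OF I \<open>i \<in> I\<close> \<open>j \<in> I\<close>] ac by blast
  qed
  have E_sym: "?E b a" if ab: "a \<in> carrier V" "?E a b" for a b
  proof -
    obtain i where i: "i \<in> I" "b = a \<oplus>\<^bsub>V\<^esub> i"
      using ab by blast
    then have "a = b \<oplus>\<^bsub>V\<^esub> (\<ominus>\<^bsub>V\<^esub> i)"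
      using ab IV by (simp add: M.a_assoc M.r_neg)
    then show ?thesis
      using I_neg[OF i(1)] ab by blast
  qed
  have f_eq: "f a = f b" if ab: "a \<in> carrier V" "?E a b" for a b
  proof -
    have "?E a c \<longleftrightarrow> ?E b c" for c
      using E_trans[OF conjunct1[OF ab(2)] E_sym[OF ab], of c] E_trans[OF ab, of c] by (rule iffI)
    \<comment> \<open>\<open>SOME\<close> depends only on its predicate, so equal cosets receive the
      same representative.\<close>
    then have "?E a = ?E b"
      by (rule ext)
    then show ?thesis
      unfolding f_def by (rule arg_cong)
  qed
  have f_E: "?E a b" if ab: "a \<in> carrier V" "b \<in> carrier V" "f a = f b" for a b
  proof (rule E_trans[OF ab(1) Ef[OF ab(1)]])
    show "?E (f a) b"
      unfolding ab(3) by (rule E_sym[OF ab(2) Ef[OF ab(2)]])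
  qed
  \<comment> \<open>The operations of \<open>V\<close> are followed by \<open>f\<close>, which
    returns to the chosen representatives.\<close>
  let ?Q = "V\<lparr>carrier := f ` carrier V, add := \<lambda>a b. f (a \<oplus>\<^bsub>V\<^esub> b), smult := \<lambda>k a. f (k \<odot>\<^bsub>V\<^esub> a),
    zero := f \<zero>\<^bsub>V\<^esub>\<rparr>"
  have fV: "f a \<in> carrier V" if "a \<in> carrier V" for a
    using Ef[OF that] by blast
  have add: "f (a \<oplus>\<^bsub>V\<^esub> b) = f (f a \<oplus>\<^bsub>V\<^esub> f b)" if ab: "a \<in> carrier V" "b \<in> carrier V" for a b
  proof (rule f_eq)
    obtain i j where "i \<in> I" "j \<in> I" "f a = a \<oplus>\<^bsub>V\<^esub> i" "f b = b \<oplus>\<^bsub>V\<^esub> j"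
      using Ef[OF ab(1)] Ef[OF ab(2)] by blast
    then have "f a \<oplus>\<^bsub>V\<^esub> f b = (a \<oplus>\<^bsub>V\<^esub> b) \<oplus>\<^bsub>V\<^esub> (i \<oplus>\<^bsub>V\<^esub> j)"
      using that IV by (simp add: M.a_ac)
    then show "?E (a \<oplus>\<^bsub>V\<^esub> b) (f a \<oplus>\<^bsub>V\<^esub> f b)"
      using subspace_add[OF I \<open>i \<in> I\<close> \<open>j \<in> I\<close>] fV[OF ab(1)] fV[OF ab(2)]
      by (intro conjI bexI[of _ "i \<oplus>\<^bsub>V\<^esub> j"] M.add.m_closed)
  qed (use that in simp)
  have smult: "f (k \<odot>\<^bsub>V\<^esub> a) = f (k \<odot>\<^bsub>V\<^esub> f a)" if ka: "k \<in> carrier K" "a \<in> carrier V" for k a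
  proof (rule f_eq)
    obtain i where "i \<in> I" "f a = a \<oplus>\<^bsub>V\<^esub> i"
      using Ef[OF ka(2)] by blast
    then have "k \<odot>\<^bsub>V\<^esub> f a = (k \<odot>\<^bsub>V\<^esub> a) \<oplus>\<^bsub>V\<^esub> (k \<odot>\<^bsub>V\<^esub> i)"
      using that IV by (simp add: smult_r_distr)
    then show "?E (k \<odot>\<^bsub>V\<^esub> a) (k \<odot>\<^bsub>V\<^esub> f a)"
      using subspace_smult[OF I ka(1) \<open>i \<in> I\<close>] fV[OF ka(2)] ka(1)
      by (intro conjI bexI[of _ "k \<odot>\<^bsub>V\<^esub> i"] smult_closed)
  qed (use that in simp)
  have Q: "vectorspace K ?Q"
    by (rule vectorspace_surj_image[OF vectorspace_axioms, of f]) (simp_all add: add smult)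
  show thesis
  proof (rule that)
    show "linear_map K V ?Q f"
      by (rule linear_mapI[OF vectorspace_axioms Q]) (simp_all add: add smult)
    show "f ` carrier V = carrier ?Q"
      by simp
    show "\<forall>a\<in>I. f a = \<zero>\<^bsub>?Q\<^esub>"
      using f_eq[OF M.zero_closed, symmetric] IV by auto
    obtain a where a: "a \<in> carrier V" "a \<notin> I"
      using ne subspace_subset[OF I] by blast
    have "f a \<noteq> f \<zero>\<^bsub>V\<^esub>"
      using f_E[OF M.zero_closed a(1)] a(2) IV by auto
    then show "\<exists>a\<in>carrier V. f a \<noteq> \<zero>\<^bsub>?Q\<^esub>"
      using a(1) by auto
  qed
qed

text \<open>A subspace of the direct sum, spelled out on pairs so that \<open>O\<close> and converse
  apply directly and the two spaces may have different element types.\<close>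

definition lin_rel ::
  "('f, 'r) ring_scheme \<Rightarrow> ('f, 'b) module \<Rightarrow> ('f, 'c) module \<Rightarrow> ('b \<times> 'c) set \<Rightarrow> bool" where
  "lin_rel K V W R \<longleftrightarrow> R \<subseteq> carrier V \<times> carrier W \<and> (\<zero>\<^bsub>V\<^esub>, \<zero>\<^bsub>W\<^esub>) \<in> R \<and>
     (\<forall>a b a' b'. (a, b) \<in> R \<longrightarrow> (a', b') \<in> R \<longrightarrow> (a \<oplus>\<^bsub>V\<^esub> a', b \<oplus>\<^bsub>W\<^esub> b') \<in> R) \<and>
     (\<forall>k a b. k \<in> carrier K \<longrightarrow> (a, b) \<in> R \<longrightarrow> (k \<odot>\<^bsub>V\<^esub> a, k \<odot>\<^bsub>W\<^esub> b) \<in> R)"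

lemma
  assumes "lin_rel K V W R"
  shows lin_rel_subset: "R \<subseteq> carrier V \<times> carrier W"
    and lin_rel_zero: "(\<zero>\<^bsub>V\<^esub>, \<zero>\<^bsub>W\<^esub>) \<in> R"
    and lin_rel_add: "\<lbrakk>(a, b) \<in> R; (a', b') \<in> R\<rbrakk> \<Longrightarrow> (a \<oplus>\<^bsub>V\<^esub> a', b \<oplus>\<^bsub>W\<^esub> b') \<in> R"
    and lin_rel_smult: "\<lbrakk>k \<in> carrier K; (a, b) \<in> R\<rbrakk> \<Longrightarrow> (k \<odot>\<^bsub>V\<^esub> a, k \<odot>\<^bsub>W\<^esub> b) \<in> R"
  using assms unfolding lin_rel_def by blast+

lemma lin_relI:
  assumes "R \<subseteq> carrier V \<times> carrier W" and "(\<zero>\<^bsub>V\<^esub>, \<zero>\<^bsub>W\<^esub>) \<in> R"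
    and "\<And>a b a' b'. \<lbrakk>(a, b) \<in> R; (a', b') \<in> R\<rbrakk> \<Longrightarrow> (a \<oplus>\<^bsub>V\<^esub> a', b \<oplus>\<^bsub>W\<^esub> b') \<in> R"
    and "\<And>k a b. \<lbrakk>k \<in> carrier K; (a, b) \<in> R\<rbrakk> \<Longrightarrow> (k \<odot>\<^bsub>V\<^esub> a, k \<odot>\<^bsub>W\<^esub> b) \<in> R"
  shows "lin_rel K V W R"
  unfolding lin_rel_def using assms by blast

lemma lin_rel_comp:
  assumes "lin_rel K U V R" and "lin_rel K V W S"
  shows "lin_rel K U W (R O S)"
proof (rule lin_relI)
  show "R O S \<subseteq> carrier U \<times> carrier W"
    using lin_rel_subset[OF assms(1)] lin_rel_subset[OF assms(2)] by blast
  show "(\<zero>\<^bsub>U\<^esub>, \<zero>\<^bsub>W\<^esub>) \<in> R O S"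
    using lin_rel_zero[OF assms(1)] lin_rel_zero[OF assms(2)] by blast
  show "(a \<oplus>\<^bsub>U\<^esub> a', b \<oplus>\<^bsub>W\<^esub> b') \<in> R O S" if "(a, b) \<in> R O S" "(a', b') \<in> R O S" for a b a' b'
    using that lin_rel_add[OF assms(1)] lin_rel_add[OF assms(2)] by blast
  show "(k \<odot>\<^bsub>U\<^esub> a, k \<odot>\<^bsub>W\<^esub> b) \<in> R O S" if "k \<in> carrier K" "(a, b) \<in> R O S" for k a b
    using that lin_rel_smult[OF assms(1)] lin_rel_smult[OF assms(2)] by blast
qed

lemma lin_rel_converse:
  assumes "lin_rel K V W R"
  shows "lin_rel K W V (R\<inverse>)"
  using assms by (auto simp: lin_rel_def)

text \<open>Used twice: with structure maps it gives products in the slice, with arbitrary arrows it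
  gives pullbacks.\<close>

lemma lin_rel_equalizer:
  assumes f: "linear_map K V X f" and g: "linear_map K W X g"
  shows "lin_rel K V W {(a, b). a \<in> carrier V \<and> b \<in> carrier W \<and> f a = g b}"
  by (rule lin_relI)
    (auto simp: linear_map_zero[OF f] linear_map_zero[OF g] linear_map_add[OF f] linear_map_add[OF g]
      linear_map_smult[OF f] linear_map_smult[OF g] vs_zero_closed[OF linear_map_dom[OF f]]
      vs_zero_closed[OF linear_map_dom[OF g]] vs_add_closed[OF linear_map_dom[OF f]]
      vs_add_closed[OF linear_map_dom[OF g]] vs_smult_closed[OF linear_map_dom[OF f]]
      vs_smult_closed[OF linear_map_dom[OF g]])

lemma vectorspace_lin_rel:
  assumes "vectorspace K V" and "vectorspace K W" and "lin_rel K V W R"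
  shows "vectorspace K (direct_sum V W\<lparr>carrier := R\<rparr>)"
proof -
  have vs: "vectorspace K (direct_sum V W)"
    using assms by (intro direct_sum_is_vs)
  have "subspace K R (direct_sum V W)"
    using lin_rel_subset[OF assms(3)] lin_rel_zero[OF assms(3)] lin_rel_add[OF assms(3)]
      lin_rel_smult[OF assms(3)]
    by (intro subspaceI[OF vs]) (auto simp: direct_sum_def)
  then show ?thesis
    by (rule vectorspace.subspace_is_vs[OF vs])
qed

text \<open>The kernel of the map \<open>(a, b, c) \<mapsto> (a, c)\<close> from the chains with
  \<open>(a, b) \<in> R\<close> and \<open>(b, c) \<in> S\<close> onto \<open>R O S\<close>,
  recorded by the middle vector. Its dimension is the exponent of \<open>t\<close> in the
  composite.\<close>

definition overlap :: "('f, 'b) module \<Rightarrow> ('f, 'd) module \<Rightarrow> ('b \<times> 'c) set \<Rightarrow> ('c \<times> 'd) set \<Rightarrow> 'c set"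
  where "overlap V W R S = {b. (\<zero>\<^bsub>V\<^esub>, b) \<in> R \<and> (b, \<zero>\<^bsub>W\<^esub>) \<in> S}"

lemma subspace_overlap:
  assumes "vectorspace K U" and "vectorspace K V" and "vectorspace K W"
    and R: "lin_rel K U V R" and S: "lin_rel K V W S"
  shows "subspace K (overlap U W R S) V"
proof (rule subspaceI[OF assms(2)])
  show "overlap U W R S \<subseteq> carrier V"
    using lin_rel_subset[OF R] by (auto simp: overlap_def)
  show "\<zero>\<^bsub>V\<^esub> \<in> overlap U W R S"
    using lin_rel_zero[OF R] lin_rel_zero[OF S] by (simp add: overlap_def)
  show "a \<oplus>\<^bsub>V\<^esub> b \<in> overlap U W R S" if "a \<in> overlap U W R S" "b \<in> overlap U W R S" for a b
    using that lin_rel_add[OF R, of "\<zero>\<^bsub>U\<^esub>" a "\<zero>\<^bsub>U\<^esub>" b] lin_rel_add[OF S, of a "\<zero>\<^bsub>W\<^esub>" b "\<zero>\<^bsub>W\<^esub>"]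
      vs_zero_add[OF assms(1) vs_zero_closed[OF assms(1)]]
      vs_zero_add[OF assms(3) vs_zero_closed[OF assms(3)]]
    by (simp add: overlap_def)
  show "k \<odot>\<^bsub>V\<^esub> a \<in> overlap U W R S" if "k \<in> carrier K" "a \<in> overlap U W R S" for k a
    using that lin_rel_smult[OF R that(1), of "\<zero>\<^bsub>U\<^esub>" a] lin_rel_smult[OF S that(1), of a "\<zero>\<^bsub>W\<^esub>"]
      vs_smult_zero[OF assms(1)] vs_smult_zero[OF assms(3)]
    by (simp add: overlap_def)
qed

section \<open>Counting chains of related vectors\<close>

lemma card_eq_card_image_mult:
  assumes "finite T" and "\<And>c. c \<in> p ` T \<Longrightarrow> card {x \<in> T. p x = c} = n"
  shows "card T = card (p ` T) * n"
proof -
  have "card T = (\<Sum>c\<in>p ` T. card {x \<in> T. p x = c})"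
    using sum.image_gen[OF assms(1), of "\<lambda>_. 1::nat" p] by simp
  then show ?thesis
    using assms(2) by simp
qed

text \<open>Chains \<open>0, b, c, 0\<close> are fibred over \<open>c\<close>. The possible
  \<open>c\<close> form the overlap of \<open>R O S\<close> with \<open>Q\<close>, and for a fixed
  \<open>c\<close> the possible \<open>b\<close> form a translate, by any particular solution
  \<open>b0\<close>, of the overlap of \<open>R\<close> with \<open>S\<close>.\<close>

lemma card_double_overlap:
  assumes U: "vectorspace K U" and V: "vectorspace K V" and W: "vectorspace K W"
    and R: "lin_rel K U V R" and S: "lin_rel K V W S"
    and fin: "finite (carrier V)" "finite (carrier W)"
  shows "card {(b, c). (\<zero>\<^bsub>U\<^esub>, b) \<in> R \<and> (b, c) \<in> S \<and> (c, \<zero>\<^bsub>X\<^esub>) \<in> Q} =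
    card (overlap U X (R O S) Q) * card (overlap U W R S)"
proof -
  interpret V: vectorspace K V by fact
  interpret W: vectorspace K W by fact
  let ?T = "{(b, c). (\<zero>\<^bsub>U\<^esub>, b) \<in> R \<and> (b, c) \<in> S \<and> (c, \<zero>\<^bsub>X\<^esub>) \<in> Q}"
  have "?T \<subseteq> carrier V \<times> carrier W"
    using lin_rel_subset[OF S] by blast
  then have finT: "finite ?T"
    using fin finite_subset by blast
  have img: "snd ` ?T = overlap U X (R O S) Q"
    by (force simp: overlap_def)
  have zU: "\<zero>\<^bsub>U\<^esub> \<oplus>\<^bsub>U\<^esub> \<zero>\<^bsub>U\<^esub> = \<zero>\<^bsub>U\<^esub>" "(\<ominus>\<^bsub>K\<^esub> \<one>\<^bsub>K\<^esub>) \<odot>\<^bsub>U\<^esub> \<zero>\<^bsub>U\<^esub> = \<zero>\<^bsub>U\<^esub>"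
    using vs_zero_add[OF U vs_zero_closed[OF U]] vs_smult_zero[OF U] by simp_all
  have "card {x \<in> ?T. snd x = c} = card (overlap U W R S)" if "c \<in> snd ` ?T" for c
  proof -
    obtain b0 where b0: "(\<zero>\<^bsub>U\<^esub>, b0) \<in> R" "(b0, c) \<in> S" and c: "(c, \<zero>\<^bsub>X\<^esub>) \<in> Q"
      using \<open>c \<in> snd ` ?T\<close> by auto
    have b0V: "b0 \<in> carrier V" and cW: "c \<in> carrier W"
      using lin_rel_subset[OF S] b0(2) by auto
    have RV: "b \<in> carrier V" if "(\<zero>\<^bsub>U\<^esub>, b) \<in> R" for b
      using that lin_rel_subset[OF R] by auto
    have neg: "(\<zero>\<^bsub>U\<^esub>, \<ominus>\<^bsub>V\<^esub> b0) \<in> R" "(\<ominus>\<^bsub>V\<^esub> b0, \<ominus>\<^bsub>W\<^esub> c) \<in> S"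
      using lin_rel_smult[OF R _ b0(1), of "\<ominus>\<^bsub>K\<^esub> \<one>\<^bsub>K\<^esub>"] lin_rel_smult[OF S _ b0(2), of "\<ominus>\<^bsub>K\<^esub> \<one>\<^bsub>K\<^esub>"]
        b0V cW by (simp_all add: V.smult_minus_1 W.smult_minus_1 zU)
    have "bij_betw (\<lambda>b. (b \<oplus>\<^bsub>V\<^esub> b0, c)) (overlap U W R S) {x \<in> ?T. snd x = c}"
    proof (rule bij_betw_byWitness[where f' = "\<lambda>x. fst x \<oplus>\<^bsub>V\<^esub> (\<ominus>\<^bsub>V\<^esub> b0)"])
      show "\<forall>b\<in>overlap U W R S. fst (b \<oplus>\<^bsub>V\<^esub> b0, c) \<oplus>\<^bsub>V\<^esub> (\<ominus>\<^bsub>V\<^esub> b0) = b"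
        using RV b0V by (auto simp: overlap_def V.M.a_assoc V.M.r_neg)
      show "\<forall>x\<in>{x \<in> ?T. snd x = c}. (fst x \<oplus>\<^bsub>V\<^esub> (\<ominus>\<^bsub>V\<^esub> b0) \<oplus>\<^bsub>V\<^esub> b0, c) = x"
        using RV b0V by (auto simp: V.M.a_assoc V.M.l_neg)
      show "(\<lambda>b. (b \<oplus>\<^bsub>V\<^esub> b0, c)) ` overlap U W R S \<subseteq> {x \<in> ?T. snd x = c}"
      proof clarsimp
        fix b
        assume "b \<in> overlap U W R S"
        then have b: "(\<zero>\<^bsub>U\<^esub>, b) \<in> R" "(b, \<zero>\<^bsub>W\<^esub>) \<in> S"
          by (simp_all add: overlap_def)
        show "(\<zero>\<^bsub>U\<^esub>, b \<oplus>\<^bsub>V\<^esub> b0) \<in> R \<and> (b \<oplus>\<^bsub>V\<^esub> b0, c) \<in> S \<and> (c, \<zero>\<^bsub>X\<^esub>) \<in> Q"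
          using lin_rel_add[OF R b(1) b0(1)] lin_rel_add[OF S b(2) b0(2)] zU c cW by simp
      qed
      show "(\<lambda>x. fst x \<oplus>\<^bsub>V\<^esub> (\<ominus>\<^bsub>V\<^esub> b0)) ` {x \<in> ?T. snd x = c} \<subseteq> overlap U W R S"
      proof clarsimp
        fix b
        assume b: "(\<zero>\<^bsub>U\<^esub>, b) \<in> R" "(b, c) \<in> S"
        show "b \<oplus>\<^bsub>V\<^esub> (\<ominus>\<^bsub>V\<^esub> b0) \<in> overlap U W R S"
          using lin_rel_add[OF R b(1) neg(1)] lin_rel_add[OF S b(2) neg(2)] zU cW
          by (simp add: overlap_def W.M.r_neg)
      qed
    qed
    then show ?thesis
      by (rule bij_betw_same_card[symmetric])
  qed
  then show ?thesis
    using card_eq_card_image_mult[OF finT, of snd] img by simp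
qed

text \<open>Both sides count the same chains \<open>0, b, c, 0\<close>, fibred over \<open>c\<close>
  on the left and over \<open>b\<close> on the right. The second count is the first one for the
  converse relations, with the chain read backwards.\<close>

lemma overlap_cocycle:
  assumes vs: "vectorspace K U" "vectorspace K V" "vectorspace K W" "vectorspace K X"
    and fin: "finite (carrier V)" "finite (carrier W)"
    and R: "lin_rel K U V R" and S: "lin_rel K V W S" and Q: "lin_rel K W X Q"
  shows "card (overlap U X (R O S) Q) * card (overlap U W R S) =
    card (overlap U X R (S O Q)) * card (overlap V X S Q)"
proof -
  let ?T = "{(b, c). (\<zero>\<^bsub>U\<^esub>, b) \<in> R \<and> (b, c) \<in> S \<and> (c, \<zero>\<^bsub>X\<^esub>) \<in> Q}"
    and ?T' = "{(c, b). (\<zero>\<^bsub>X\<^esub>, c) \<in> Q\<inverse> \<and> (c, b) \<in> S\<inverse> \<and> (b, \<zero>\<^bsub>U\<^esub>) \<in> R\<inverse>}"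
  have "card ?T' = card ?T"
    by (rule bij_betw_same_card[of prod.swap], rule bij_betw_byWitness[where f' = prod.swap]) auto
  moreover have "overlap X U (Q\<inverse> O S\<inverse>) (R\<inverse>) = overlap U X R (S O Q)"
    and "overlap X V (Q\<inverse>) (S\<inverse>) = overlap V X S Q"
    by (auto simp: overlap_def)
  ultimately show ?thesis
    using card_double_overlap[OF vs(1-3) R S fin, of X Q]
      card_double_overlap[OF vs(4,3,2) lin_rel_converse[OF Q] lin_rel_converse[OF S] fin(2,1), of U "R\<inverse>"]
    by simp
qed

section \<open>Relations in slices of the category of vector spaces\<close>

text \<open>Both \<open>Vect K\<close> and its slice over \<open>V0\<close> are instances; for the former take \<open>V0\<close> to be a zero space.
  An object \<open>x\<close> has underlying space \<open>U x\<close> and structure map \<open>\<pi> x : U x \<rightarrow> V0\<close>.\<close>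

locale vect_slice =
  fixes K :: "('f, 'r) ring_scheme" and A :: "('o, 'v \<Rightarrow> 'v) cat" and U :: "'o \<Rightarrow> ('f, 'v) module"
    and \<pi> :: "'o \<Rightarrow> 'v \<Rightarrow> 'v" and V0 :: "('f, 'v) module"
    and mk :: "('f, 'v) module \<Rightarrow> ('v \<Rightarrow> 'v) \<Rightarrow> 'o"
    and \<delta> :: "('o, 'v \<Rightarrow> 'v, 'k::field) degree" and t :: 'k
  assumes field_K: "field K" and finite_K: "finite (carrier K)" and infinite_v: "infinite (UNIV :: 'v set)"
    and U_vs: "x \<in> ob A \<Longrightarrow> vectorspace K (U x)"
    and U_finite: "x \<in> ob A \<Longrightarrow> finite (carrier (U x))"
    and \<pi>_linear: "x \<in> ob A \<Longrightarrow> linear_map K (U x) V0 (\<pi> x)"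
    and arr_iff: "\<lbrakk>x \<in> ob A; y \<in> ob A\<rbrakk> \<Longrightarrow> f \<in> arr A x y \<longleftrightarrow>
      f \<in> extensional (carrier (U x)) \<and> linear_map K (U x) (U y) f \<and> (\<forall>a\<in>carrier (U x). \<pi> y (f a) = \<pi> x a)"
    and cmp_eq: "cmp A x y z g f = compose (carrier (U x)) g f"
    and ide_eq: "ide A x = (\<lambda>a\<in>carrier (U x). a)"
    and mk_ob: "\<lbrakk>linear_map K V V0 p; finite (carrier V)\<rbrakk> \<Longrightarrow> mk V p \<in> ob A"
    and U_mk: "\<lbrakk>linear_map K V V0 p; finite (carrier V)\<rbrakk> \<Longrightarrow> U (mk V p) = V"
    and \<pi>_mk: "\<lbrakk>linear_map K V V0 p; finite (carrier V); a \<in> carrier V\<rbrakk> \<Longrightarrow> \<pi> (mk V p) a = p a"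
    and \<delta>_eq: "\<delta> x y e = vect_deg K t (U x) (U y) e"
begin

abbreviation E :: "'o \<Rightarrow> 'v set" where
  "E x \<equiv> carrier (U x)"

lemma
  assumes "x \<in> ob A" and "y \<in> ob A" and "f \<in> arr A x y"
  shows arr_linear: "linear_map K (U x) (U y) f"
    and arr_closed: "a \<in> E x \<Longrightarrow> f a \<in> E y"
    and arr_over: "a \<in> E x \<Longrightarrow> \<pi> y (f a) = \<pi> x a"
    and arr_extensional: "f \<in> extensional (E x)"
  using assms linear_map_closed by (auto simp: arr_iff)

lemma cmp_apply: "a \<in> E x \<Longrightarrow> cmp A x y z g f a = g (f a)"
  by (simp add: cmp_eq compose_eq)

lemma restrict_in_arr:
  assumes "x \<in> ob A" and "y \<in> ob A" and "linear_map K (U x) (U y) f"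
    and "\<And>a. a \<in> E x \<Longrightarrow> \<pi> y (f a) = \<pi> x a"
  shows "restrict f (E x) \<in> arr A x y"
  using assms linear_map_cong[OF assms(3), of "restrict f (E x)"] by (simp add: arr_iff)

lemma arr_eqI:
  assumes "x \<in> ob A" and "y \<in> ob A" and "f \<in> arr A x y" and "g \<in> arr A x y"
    and "\<And>a. a \<in> E x \<Longrightarrow> f a = g a"
  shows "f = g"
  using extensionalityI[OF arr_extensional[OF assms(1,2,3)] arr_extensional[OF assms(1,2,4)]] assms(5)
  by blast

lemma cmp_closed:
  assumes "x \<in> ob A" and "y \<in> ob A" and "z \<in> ob A" and "f \<in> arr A x y" and "g \<in> arr A y z"
  shows "cmp A x y z g f \<in> arr A x z"
proof -
  have "restrict (\<lambda>a. g (f a)) (E x) \<in> arr A x z"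
    using assms
    by (intro restrict_in_arr linear_map_comp[OF arr_linear[OF assms(1,2,4)] arr_linear[OF assms(2,3,5)]])
      (simp_all add: arr_over[OF assms(1,2,4)] arr_over[OF assms(2,3,5)] arr_closed[OF assms(1,2,4)])
  then show ?thesis
    by (simp add: cmp_eq compose_def)
qed

lemma ide_closed:
  assumes "x \<in> ob A"
  shows "ide A x \<in> arr A x x"
  unfolding ide_eq
  by (rule restrict_in_arr[OF assms assms]) (auto intro: linear_mapI U_vs[OF assms])

lemma cmp_eq_iff:
  assumes "w \<in> ob A" and "x \<in> ob A" and "z \<in> ob A" and "f \<in> arr A w x" and "g \<in> arr A x z"
    and "h \<in> arr A w z"
  shows "cmp A w x z g f = h \<longleftrightarrow> (\<forall>a\<in>E w. g (f a) = h a)"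
  using arr_eqI[OF assms(1,3) cmp_closed[OF assms(1-5)] assms(6)] by (auto simp: cmp_apply)


subsection \<open>Tabulations\<close>

text \<open>The points of the product of \<open>x\<close> and \<open>y\<close> in the slice: the
  fibre product over \<open>V0\<close>, which is all of \<open>E x \<times> E y\<close> when
  \<open>V0\<close> is a zero space.\<close>

definition fib :: "'o \<Rightarrow> 'o \<Rightarrow> ('v \<times> 'v) set" where
  "fib x y = {(a, b). a \<in> E x \<and> b \<in> E y \<and> \<pi> x a = \<pi> y b}"

definition rels :: "'o \<Rightarrow> 'o \<Rightarrow> ('v \<times> 'v) set set" where
  "rels x y = {R. lin_rel K (U x) (U y) R \<and> R \<subseteq> fib x y}"

definition tabulates :: "'o \<Rightarrow> 'o \<Rightarrow> ('v \<times> 'v) set \<Rightarrow> 'o \<times> ('v \<Rightarrow> 'v) \<times> ('v \<Rightarrow> 'v) \<Rightarrow> bool" where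
  "tabulates x y R = (\<lambda>(p, u, v). p \<in> ob A \<and> u \<in> arr A p x \<and> v \<in> arr A p y \<and>
     bij_betw (\<lambda>a. (u a, v a)) (E p) R)"

text \<open>The universal property common to products and pullbacks: pairs of arrows with values in
  \<open>R\<close> factor uniquely. Its equivalence with the elementwise \<open>tabulates\<close>
  settles both kinds of limit at once.\<close>

definition represents :: "'o \<Rightarrow> 'o \<Rightarrow> ('v \<times> 'v) set \<Rightarrow> 'o \<times> ('v \<Rightarrow> 'v) \<times> ('v \<Rightarrow> 'v) \<Rightarrow> bool" where
  "represents x y R = (\<lambda>(p, u, v). p \<in> ob A \<and> u \<in> arr A p x \<and> v \<in> arr A p y \<and>
     (\<forall>a\<in>E p. (u a, v a) \<in> R) \<and>
     (\<forall>w\<in>ob A. \<forall>f\<in>arr A w x. \<forall>g\<in>arr A w y. (\<forall>a\<in>E w. (f a, g a) \<in> R) \<longrightarrow>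
        (\<exists>!h. h \<in> arr A w p \<and> cmp A w p x u h = f \<and> cmp A w p y v h = g)))"

text \<open>The relation with componentwise operations is itself a finite vector space; a copy of it
  in \<open>'v\<close>, with the two coordinate maps as legs, is a tabulation.\<close>

lemma ex_tabulates:
  assumes x: "x \<in> ob A" and y: "y \<in> ob A" and R: "R \<in> rels x y"
  obtains P where "tabulates x y R P"
proof -
  have lin: "lin_rel K (U x) (U y) R" and fib: "R \<subseteq> fib x y"
    using R by (auto simp: rels_def)
  let ?M = "direct_sum (U x) (U y)\<lparr>carrier := R\<rparr>"
  have M: "vectorspace K ?M"
    using vectorspace_lin_rel[OF U_vs[OF x] U_vs[OF y] lin] .
  have "finite (E x \<times> E y)"
    using U_finite x y by simp
  then have finM: "finite (carrier ?M)"
    using finite_subset[OF lin_rel_subset[OF lin]] by simp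
  obtain V :: "('f, 'v) module" and h where "vectorspace K V" and V: "finite (carrier V)"
    and h: "linear_map K V ?M h" and bijM: "bij_betw h (carrier V) (carrier ?M)"
    by (rule realize_vectorspace[OF infinite_v M finM])
  have bij: "bij_betw h (carrier V) R"
    using bijM by simp
  have hR: "h a \<in> R" if "a \<in> carrier V" for a
    using bij that by (auto simp: bij_betw_def)
  have h_in: "fst (h a) \<in> E x" "snd (h a) \<in> E y" "\<pi> x (fst (h a)) = \<pi> y (snd (h a))" if "a \<in> carrier V" for a
    using hR[OF that] fib by (auto simp: fib_def)
  have u: "linear_map K V (U x) (\<lambda>a. fst (h a))"
    by (rule linear_mapI[OF linear_map_dom[OF h] U_vs[OF x]])
      (simp_all add: h_in linear_map_add[OF h] linear_map_smult[OF h] direct_sum_def)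
  have v: "linear_map K V (U y) (\<lambda>a. snd (h a))"
    by (rule linear_mapI[OF linear_map_dom[OF h] U_vs[OF y]])
      (simp_all add: h_in linear_map_add[OF h] linear_map_smult[OF h] direct_sum_def)
  \<comment> \<open>The structure map is taken through the first leg; since \<open>R\<close> lies in
    the fibre product, the second leg gives the same map.\<close>
  note p = linear_map_comp[OF u \<pi>_linear[OF x]]
  let ?p = "mk V (\<lambda>a. \<pi> x (fst (h a)))"
  note simps = U_mk[OF p V] \<pi>_mk[OF p V]
  note P = mk_ob[OF p V]
  have "restrict (\<lambda>a. fst (h a)) (E ?p) \<in> arr A ?p x" "restrict (\<lambda>a. snd (h a)) (E ?p) \<in> arr A ?p y"
    using u v by (intro restrict_in_arr P x y; simp add: simps h_in)+
  moreover have "bij_betw (\<lambda>a. (restrict (\<lambda>a. fst (h a)) (E ?p) a, restrict (\<lambda>a. snd (h a)) (E ?p) a)) (E ?p) R"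
    by (subst bij_betw_cong[where g = h]) (use bij in \<open>simp_all add: simps(1)\<close>)
  ultimately have "tabulates x y R (?p, restrict (\<lambda>a. fst (h a)) (E ?p), restrict (\<lambda>a. snd (h a)) (E ?p))"
    using P by (simp add: tabulates_def)
  then show thesis
    by (rule that)
qed

lemma tabulates_lift:
  assumes x: "x \<in> ob A" and y: "y \<in> ob A" and P: "tabulates x y R (p, u, v)"
    and w: "w \<in> ob A" and f: "f \<in> arr A w x" and g: "g \<in> arr A w y" and R: "\<And>a. a \<in> E w \<Longrightarrow> (f a, g a) \<in> R"
  obtains h where "h \<in> arr A w p" and "\<And>a. a \<in> E w \<Longrightarrow> u (h a) = f a" and "\<And>a. a \<in> E w \<Longrightarrow> v (h a) = g a"
proof -
  have p: "p \<in> ob A" and u: "u \<in> arr A p x" and v: "v \<in> arr A p y"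
    and bij: "bij_betw (\<lambda>a. (u a, v a)) (E p) R"
    using P by (auto simp: tabulates_def)
  let ?h = "\<lambda>a. inv_into (E p) (\<lambda>a. (u a, v a)) (f a, g a)"
  have h: "?h a \<in> E p" "u (?h a) = f a" "v (?h a) = g a" if "a \<in> E w" for a
  proof -
    have *: "(f a, g a) \<in> (\<lambda>a. (u a, v a)) ` E p"
      using bij R[OF that] by (simp add: bij_betw_def)
    show "?h a \<in> E p"
      by (rule inv_into_into[OF *])
    show "u (?h a) = f a" "v (?h a) = g a"
      using f_inv_into_f[OF *] by simp_all
  qed
  \<comment> \<open>An element of \<open>E p\<close> is determined by its two legs, so linearity of
    \<open>?h\<close> can be checked after applying \<open>u\<close> and \<open>v\<close>.\<close>
  have hm: "?h a = b" if "a \<in> E w" "b \<in> E p" "u b = f a" "v b = g a" for a b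
    using inv_into_f_f[OF bij_betw_imp_inj_on[OF bij] that(2)] that by simp
  note lin = arr_linear[OF p x u] arr_linear[OF p y v] arr_linear[OF w x f] arr_linear[OF w y g]
  note adds = lin[THEN linear_map_add] and smults = lin[THEN linear_map_smult]
  have hl: "linear_map K (U w) (U p) ?h"
  proof (rule linear_mapI[OF U_vs[OF w] U_vs[OF p]])
    fix a b
    assume "a \<in> E w" "b \<in> E w"
    then show "?h (a \<oplus>\<^bsub>U w\<^esub> b) = ?h a \<oplus>\<^bsub>U p\<^esub> ?h b"
      by (intro hm vs_add_closed[OF U_vs[OF w]] vs_add_closed[OF U_vs[OF p]] h)
        (simp_all add: adds h)
  next
    fix k a
    assume "k \<in> carrier K" "a \<in> E w"
    then show "?h (k \<odot>\<^bsub>U w\<^esub> a) = k \<odot>\<^bsub>U p\<^esub> ?h a"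
      by (intro hm vs_smult_closed[OF U_vs[OF w]] vs_smult_closed[OF U_vs[OF p]] h)
        (simp_all add: smults h)
  qed (rule h)
  have "\<pi> p (?h a) = \<pi> w a" if "a \<in> E w" for a
    using arr_over[OF p x u h(1)[OF that]] arr_over[OF w x f that] h(2)[OF that] by simp
  then have "restrict ?h (E w) \<in> arr A w p"
    by (rule restrict_in_arr[OF w p hl])
  then show thesis
    using h by (intro that[of "restrict ?h (E w)"]) simp_all
qed

lemma lift_arr:
  assumes w: "w \<in> ob A" and d: "d \<in> ob A" and z: "z \<in> ob A" and m: "m \<in> arr A d z" and inj: "inj_on m (E d)"
    and f: "f \<in> arr A w z" and sub: "f ` E w \<subseteq> m ` E d"
  obtains h where "h \<in> arr A w d" and "\<And>a. a \<in> E w \<Longrightarrow> m (h a) = f a"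
proof -
  \<comment> \<open>An injective arrow, used for both legs, tabulates the diagonal on its image.
    Lifting along it is thereby an instance of \<open>tabulates_lift\<close>.\<close>
  have tab: "tabulates z z {(a, b). a \<in> m ` E d \<and> b = a} (d, m, m)"
    using d m inj by (auto simp: tabulates_def bij_betw_def inj_on_def)
  show thesis
    by (rule tabulates_lift[OF z z tab w f f]) (use sub in blast, rule that, assumption, simp)
qed

lemma represents_if_tabulates:
  assumes x: "x \<in> ob A" and y: "y \<in> ob A" and P: "tabulates x y R (p, u, v)"
  shows "represents x y R (p, u, v)"
proof -
  have p: "p \<in> ob A" and u: "u \<in> arr A p x" and v: "v \<in> arr A p y"
    and bij: "bij_betw (\<lambda>a. (u a, v a)) (E p) R"
    using P by (auto simp: tabulates_def)
  have "\<exists>!h. h \<in> arr A w p \<and> cmp A w p x u h = f \<and> cmp A w p y v h = g"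
    if w: "w \<in> ob A" and f: "f \<in> arr A w x" and g: "g \<in> arr A w y" and fg: "\<forall>a\<in>E w. (f a, g a) \<in> R" for w f g
  proof (rule ex_ex1I)
    show "\<exists>h. h \<in> arr A w p \<and> cmp A w p x u h = f \<and> cmp A w p y v h = g"
    proof (rule tabulates_lift[OF x y P w f g])
      fix h
      assume "h \<in> arr A w p" "\<And>a. a \<in> E w \<Longrightarrow> u (h a) = f a" "\<And>a. a \<in> E w \<Longrightarrow> v (h a) = g a"
      then show ?thesis
        by (intro exI[of _ h]) (simp add: cmp_eq_iff w p x y u v f g)
    qed (use fg in blast)
    fix h h'
    assume h: "h \<in> arr A w p \<and> cmp A w p x u h = f \<and> cmp A w p y v h = g"
      and h': "h' \<in> arr A w p \<and> cmp A w p x u h' = f \<and> cmp A w p y v h' = g"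
    show "h = h'"
    proof (rule arr_eqI[OF w p])
      fix a
      assume a: "a \<in> E w"
      have "u (h a) = u (h' a)" "v (h a) = v (h' a)"
        using h h' cmp_apply[OF a] by metis+
      then show "h a = h' a"
        using inj_onD[OF bij_betw_imp_inj_on[OF bij]] arr_closed[OF w p _ a] h h' by blast
    qed (use h h' in auto)
  qed
  then show ?thesis
    using p u v bij by (auto simp: represents_def bij_betw_def)
qed

text \<open>Compare with a tabulation \<open>(p', u', v')\<close> that exists independently. The
  universal properties give \<open>k : p \<rightarrow> p'\<close> and
  \<open>h : p' \<rightarrow> p\<close> compatible with the legs; \<open>h k = id\<close> yields
  injectivity of the pairing on \<open>p\<close>, and \<open>h\<close> yields surjectivity.\<close>

lemma tabulates_if_represents:
  assumes x: "x \<in> ob A" and y: "y \<in> ob A" and R: "R \<in> rels x y" and P: "represents x y R (p, u, v)"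
  shows "tabulates x y R (p, u, v)"
proof -
  have p: "p \<in> ob A" and u: "u \<in> arr A p x" and v: "v \<in> arr A p y" and uv: "\<And>a. a \<in> E p \<Longrightarrow> (u a, v a) \<in> R"
    and univ: "\<And>w f g. \<lbrakk>w \<in> ob A; f \<in> arr A w x; g \<in> arr A w y; \<forall>a\<in>E w. (f a, g a) \<in> R\<rbrakk> \<Longrightarrow>
      \<exists>!h. h \<in> arr A w p \<and> cmp A w p x u h = f \<and> cmp A w p y v h = g"
    using P by (auto simp: represents_def)
  obtain p' u' v' where P': "tabulates x y R (p', u', v')"
    using ex_tabulates[OF x y R] by (metis prod_cases3)
  have p': "p' \<in> ob A" and u': "u' \<in> arr A p' x" and v': "v' \<in> arr A p' y"
    and bij': "bij_betw (\<lambda>a. (u' a, v' a)) (E p') R"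
    using P' by (auto simp: tabulates_def)
  have uv': "(u' a, v' a) \<in> R" if "a \<in> E p'" for a
    using bij' that by (auto simp: bij_betw_def)
  obtain h where h: "h \<in> arr A p' p" and uh: "cmp A p' p x u h = u'" and vh: "cmp A p' p y v h = v'"
    using univ[OF p' u' v'] uv' by blast
  obtain k where k: "k \<in> arr A p p'" and uk: "\<And>a. a \<in> E p \<Longrightarrow> u' (k a) = u a"
    and vk: "\<And>a. a \<in> E p \<Longrightarrow> v' (k a) = v a"
    using tabulates_lift[OF x y P' p u v uv] by blast
  have uh': "u (h a) = u' a" and vh': "v (h a) = v' a" if "a \<in> E p'" for a
    using cmp_apply[OF that] uh vh by metis+
  have "cmp A p p' p h k = ide A p"
  proof -
    have "\<exists>!h. h \<in> arr A p p \<and> cmp A p p x u h = u \<and> cmp A p p y v h = v"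
      using univ[OF p u v] uv by blast
    moreover have "cmp A p p' p h k \<in> arr A p p" "ide A p \<in> arr A p p"
      using cmp_closed[OF p p' p k h] ide_closed[OF p] .
    moreover have "cmp A p p x u (ide A p) = u" "cmp A p p y v (ide A p) = v"
      unfolding cmp_eq_iff[OF p p x ide_closed[OF p] u u] cmp_eq_iff[OF p p y ide_closed[OF p] v v]
      by (simp_all add: ide_eq)
    moreover have "cmp A p p x u (cmp A p p' p h k) = u" "cmp A p p y v (cmp A p p' p h k) = v"
      using arr_closed[OF p p' k]
      by (simp_all add: cmp_eq_iff p x y u v cmp_closed[OF p p' p k h] cmp_apply uh' vh' uk vk)
    ultimately show ?thesis
      by blast
  qed
  then have hk: "h (k a) = a" if "a \<in> E p" for a
    using cmp_apply[OF that, of p' p h k] that by (simp add: ide_eq)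
  have "bij_betw (\<lambda>a. (u a, v a)) (E p) R"
    unfolding bij_betw_def
  proof
    show "inj_on (\<lambda>a. (u a, v a)) (E p)"
    proof (rule inj_onI)
      fix a b
      assume a: "a \<in> E p" and b: "b \<in> E p" and eq: "(u a, v a) = (u b, v b)"
      then have "(u' (k a), v' (k a)) = (u' (k b), v' (k b))"
        by (simp add: uk vk)
      then have "k a = k b"
        using inj_onD[OF bij_betw_imp_inj_on[OF bij'] _ arr_closed[OF p p' k a] arr_closed[OF p p' k b]] by simp
      then show "a = b"
        using hk a b by metis
    qed
    show "(\<lambda>a. (u a, v a)) ` E p = R"
    proof
      show "R \<subseteq> (\<lambda>a. (u a, v a)) ` E p"
      proof
        fix ab
        assume "ab \<in> R"
        then obtain c where c: "c \<in> E p'" and ab: "ab = (u' c, v' c)"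
          using bij' by (auto simp: bij_betw_def)
        have "ab = (u (h c), v (h c))"
          using uh'[OF c] vh'[OF c] ab by simp
        then show "ab \<in> (\<lambda>a. (u a, v a)) ` E p"
          using arr_closed[OF p' p h c] by blast
      qed
    qed (use uv in auto)
  qed
  then show ?thesis
    using p u v by (simp add: tabulates_def)
qed

lemma fib_in_rels: "x \<in> ob A \<Longrightarrow> y \<in> ob A \<Longrightarrow> fib x y \<in> rels x y"
  using lin_rel_equalizer[OF \<pi>_linear \<pi>_linear] by (simp add: rels_def fib_def)

lemma is_product_iff:
  assumes x: "x \<in> ob A" and y: "y \<in> ob A"
  shows "is_product A x y P \<longleftrightarrow> tabulates x y (fib x y) P"
proof -
  obtain p u v where P: "P = (p, u, v)"
    by (metis prod_cases3)
  have in_fib: "(f a, g a) \<in> fib x y" if "w \<in> ob A" "f \<in> arr A w x" "g \<in> arr A w y" "a \<in> E w" for w f g a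
    using that arr_closed arr_over x y by (simp add: fib_def)
  have "is_product A x y (p, u, v) \<longleftrightarrow> represents x y (fib x y) (p, u, v)"
    unfolding is_product_def represents_def using in_fib by auto
  then show ?thesis
    using represents_if_tabulates[OF x y, of "fib x y" p u v]
      tabulates_if_represents[OF x y fib_in_rels[OF x y], of p u v] P by blast
qed

definition pb :: "'o \<Rightarrow> 'o \<Rightarrow> ('v \<Rightarrow> 'v) \<Rightarrow> ('v \<Rightarrow> 'v) \<Rightarrow> ('v \<times> 'v) set" where
  "pb x y f g = {(a, b). a \<in> E x \<and> b \<in> E y \<and> f a = g b}"

lemma pb_in_rels:
  assumes x: "x \<in> ob A" and y: "y \<in> ob A" and z: "z \<in> ob A" and f: "f \<in> arr A x z" and g: "g \<in> arr A y z"
  shows "pb x y f g \<in> rels x y"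
proof -
  have "lin_rel K (U x) (U y) (pb x y f g)"
    unfolding pb_def by (rule lin_rel_equalizer[OF arr_linear[OF x z f] arr_linear[OF y z g]])
  moreover have "pb x y f g \<subseteq> fib x y"
    using arr_over[OF x z f] arr_over[OF y z g] by (fastforce simp: pb_def fib_def)
  ultimately show ?thesis
    by (simp add: rels_def)
qed

lemma is_pullback_iff:
  assumes x: "x \<in> ob A" and y: "y \<in> ob A" and z: "z \<in> ob A" and f: "f \<in> arr A x z" and g: "g \<in> arr A y z"
  shows "is_pullback A x y z f g P \<longleftrightarrow> tabulates x y (pb x y f g) P"
proof -
  obtain p u v where P: "P = (p, u, v)"
    by (metis prod_cases3)
  have in_pb: "cmp A w x z f a = cmp A w y z g b \<longleftrightarrow> (\<forall>c\<in>E w. (a c, b c) \<in> pb x y f g)"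
    if "w \<in> ob A" "a \<in> arr A w x" "b \<in> arr A w y" for w a b
    using that arr_closed[OF that(1) x that(2)] arr_closed[OF that(1) y that(3)]
    by (simp add: pb_def cmp_eq_iff[OF that(1) x z that(2) f cmp_closed[OF that(1) y z that(3) g]] cmp_apply)
  have "is_pullback A x y z f g (p, u, v) \<longleftrightarrow> represents x y (pb x y f g) (p, u, v)"
    unfolding is_pullback_def represents_def using in_pb by auto
  then show ?thesis
    using represents_if_tabulates[OF x y, of "pb x y f g" p u v]
      tabulates_if_represents[OF x y pb_in_rels[OF assms], of p u v] P by blast
qed


subsection \<open>Monomorphisms, epimorphisms and images\<close>

text \<open>For the forward direction take the kernel pair of \<open>m\<close>: its projections
  \<open>u\<close> and \<open>v\<close> have the same composite with \<open>m\<close>, so they are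
  equal, and every pair \<open>(a, b)\<close> with \<open>m a = m b\<close> is of the form
  \<open>(u c, v c)\<close>.\<close>

lemma is_mono_iff:
  assumes x: "x \<in> ob A" and y: "y \<in> ob A"
  shows "is_mono A x y m \<longleftrightarrow> m \<in> arr A x y \<and> inj_on m (E x)"
proof
  assume mono: "is_mono A x y m"
  then have m: "m \<in> arr A x y"
    by (simp add: is_mono_def)
  obtain p u v where P: "tabulates x x (pb x x m m) (p, u, v)"
    using ex_tabulates[OF x x pb_in_rels[OF x x y m m]] by (metis prod_cases3)
  have p: "p \<in> ob A" and u: "u \<in> arr A p x" and v: "v \<in> arr A p x"
    and bij: "bij_betw (\<lambda>a. (u a, v a)) (E p) (pb x x m m)"
    using P by (auto simp: tabulates_def)
  have "cmp A p x y m u = cmp A p x y m v"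
  proof (rule arr_eqI[OF p y cmp_closed[OF p x y u m] cmp_closed[OF p x y v m]])
    show "cmp A p x y m u a = cmp A p x y m v a" if "a \<in> E p" for a
      using bij that by (auto simp: cmp_apply bij_betw_def pb_def)
  qed
  then have uv: "u = v"
    using mono p u v by (auto simp: is_mono_def)
  have "inj_on m (E x)"
  proof (rule inj_onI)
    fix a b
    assume "a \<in> E x" "b \<in> E x" "m a = m b"
    then have "(a, b) \<in> (\<lambda>a. (u a, v a)) ` E p"
      using bij by (simp add: bij_betw_def pb_def)
    then show "a = b"
      using uv by auto
  qed
  then show "m \<in> arr A x y \<and> inj_on m (E x)"
    using m by simp
next
  assume m: "m \<in> arr A x y \<and> inj_on m (E x)"
  show "is_mono A x y m"
    unfolding is_mono_def
  proof (intro conjI ballI impI)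
    fix w f g
    assume w: "w \<in> ob A" and f: "f \<in> arr A w x" and g: "g \<in> arr A w x"
      and eq: "cmp A w x y m f = cmp A w x y m g"
    show "f = g"
    proof (rule arr_eqI[OF w x f g])
      fix a
      assume a: "a \<in> E w"
      have "m (f a) = m (g a)"
        using eq cmp_apply[OF a] by metis
      then show "f a = g a"
        using m arr_closed[OF w x f a] arr_closed[OF w x g a] by (auto dest: inj_onD)
    qed
  qed (use m in blast)
qed

lemma subspace_image:
  assumes x: "x \<in> ob A" and y: "y \<in> ob A" and f: "f \<in> arr A x y"
  shows "subspace K (f ` E x) (U y)"
proof -
  note lf = arr_linear[OF x y f]
  show ?thesis
  proof (rule subspaceI[OF U_vs[OF y]])
    show "f ` E x \<subseteq> E y"
      using arr_closed[OF x y f] by blast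
    show "\<zero>\<^bsub>U y\<^esub> \<in> f ` E x"
      using linear_map_zero[OF lf] vs_zero_closed[OF U_vs[OF x]] by (metis imageI)
    show "a \<oplus>\<^bsub>U y\<^esub> b \<in> f ` E x" if "a \<in> f ` E x" "b \<in> f ` E x" for a b
      using that linear_map_add[OF lf, symmetric] vs_add_closed[OF U_vs[OF x]] by (auto simp del: image_iff)
    show "k \<odot>\<^bsub>U y\<^esub> a \<in> f ` E x" if "k \<in> carrier K" "a \<in> f ` E x" for k a
      using that linear_map_smult[OF lf, symmetric] vs_smult_closed[OF U_vs[OF x]] by auto
  qed
qed

text \<open>A tabulation of the diagonal on \<open>S\<close> has equal legs, so each leg alone is
  injective with image \<open>S\<close>.\<close>

lemma ex_mono_onto:
  assumes z: "z \<in> ob A" and S: "subspace K S (U z)"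
  obtains d m where "d \<in> ob A" and "m \<in> arr A d z" and "inj_on m (E d)" and "m ` E d = S"
proof -
  let ?R = "{(a, b). a \<in> S \<and> a = b}"
  have "lin_rel K (U z) (U z) ?R"
    using subspace_subset[OF S] subspace_zero[OF S] subspace_add[OF S] subspace_smult[OF S]
    by (intro lin_relI) auto
  moreover have "?R \<subseteq> fib z z"
    using subspace_subset[OF S] by (auto simp: fib_def)
  ultimately have "?R \<in> rels z z"
    by (simp add: rels_def)
  then obtain p u v where P: "tabulates z z ?R (p, u, v)"
    using ex_tabulates[OF z z] by (metis prod_cases3)
  then have bij: "bij_betw (\<lambda>a. (u a, v a)) (E p) ?R"
    by (simp add: tabulates_def)
  then have uv: "v a = u a" if "a \<in> E p" for a
    using that by (auto simp: bij_betw_def)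
  have "inj_on u (E p)"
    using bij_betw_imp_inj_on[OF bij] uv by (auto simp: inj_on_def)
  moreover have "u ` E p = S"
  proof -
    have "u ` E p = fst ` (\<lambda>a. (u a, v a)) ` E p"
      by (simp add: image_image)
    also have "\<dots> = S"
      using bij by (force simp: bij_betw_def)
    finally show ?thesis .
  qed
  ultimately show thesis
    using P that by (auto simp: tabulates_def)
qed

text \<open>If \<open>e\<close> is not onto, then \<open>a \<mapsto> (a, 0)\<close> and \<open>a \<mapsto> (a, [a])\<close> are different morphisms to
  \<open>U y \<oplus> U y / e(U x)\<close> that agree after composition with \<open>e\<close>.\<close>

lemma is_epi_iff:
  assumes x: "x \<in> ob A" and y: "y \<in> ob A"
  shows "is_epi A x y e \<longleftrightarrow> e \<in> arr A x y \<and> e ` E x = E y"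
proof
  assume epi: "is_epi A x y e"
  then have e: "e \<in> arr A x y"
    by (simp add: is_epi_def)
  note I = subspace_image[OF x y e]
  have "e ` E x = E y"
  proof (rule ccontr)
    assume "e ` E x \<noteq> E y"
    then obtain Q :: "('f, 'v) module" and q where q: "linear_map K (U y) Q q" and onto: "q ` E y = carrier Q"
      and qI: "\<forall>a\<in>e ` E x. q a = \<zero>\<^bsub>Q\<^esub>" and q_ne: "\<exists>a\<in>E y. q a \<noteq> \<zero>\<^bsub>Q\<^esub>"
      by (rule quotient_map[OF I])
    note Q = linear_map_cod[OF q]
    let ?M = "direct_sum (U y) Q"
    have M: "vectorspace K ?M"
      by (rule direct_sum_is_vs[OF U_vs[OF y] Q])
    have "finite (carrier Q)"
      using U_finite[OF y] by (simp add: onto[symmetric])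
    then have finM: "finite (carrier ?M)"
      using U_finite[OF y] by (simp add: direct_sum_def)
    obtain W :: "('f, 'v) module" and h where "vectorspace K W" and W: "finite (carrier W)"
      and h: "linear_map K W ?M h" and bij: "bij_betw h (carrier W) (carrier ?M)"
      by (rule realize_vectorspace[OF infinite_v M finM])
    let ?k = "inv_into (carrier W) h"
    note k = linear_map_inv_into[OF h bij]
    have hk: "h (?k c) = c" if "c \<in> carrier ?M" for c
      using bij that by (simp add: bij_betw_def f_inv_into_f)
    have M_carrier: "carrier ?M = E y \<times> carrier Q"
      by (simp add: direct_sum_def)
    have fst_h: "linear_map K W (U y) (\<lambda>a. fst (h a))"
      using linear_map_closed[OF h]
      by (intro linear_mapI[OF linear_map_dom[OF h] U_vs[OF y]])
        (auto simp: linear_map_add[OF h] linear_map_smult[OF h] direct_sum_def mem_Times_iff)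
    note p = linear_map_comp[OF fst_h \<pi>_linear[OF y]]
    \<comment> \<open>The structure map depends on the \<open>U y\<close> component only, so that
      both maps into this object are morphisms over \<open>V0\<close>.\<close>
    let ?w = "mk W (\<lambda>a. \<pi> y (fst (h a)))"
    note w = mk_ob[OF p W] and simps = U_mk[OF p W] \<pi>_mk[OF p W]
    have l1: "linear_map K (U y) ?M (\<lambda>a. (a, \<zero>\<^bsub>Q\<^esub>))"
      using inj1_linear[OF U_vs[OF y] Q] by (simp add: inj1_def)
    have l2: "linear_map K (U y) ?M (\<lambda>a. (a, q a))"
      by (rule linear_mapI[OF U_vs[OF y] M])
        (simp_all add: direct_sum_def linear_map_closed[OF q] linear_map_add[OF q] linear_map_smult[OF q])
    have in_arr: "restrict (\<lambda>a. ?k (a, g a)) (E y) \<in> arr A y ?w"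
      if "linear_map K (U y) ?M (\<lambda>a. (a, g a))" for g
      using that linear_map_comp[OF that k] linear_map_closed[OF that] linear_map_closed[OF k]
      by (intro restrict_in_arr[OF y w]) (auto simp: simps hk)
    let ?f = "restrict (\<lambda>a. ?k (a, \<zero>\<^bsub>Q\<^esub>)) (E y)" and ?g = "restrict (\<lambda>a. ?k (a, q a)) (E y)"
    note f = in_arr[OF l1] and g = in_arr[OF l2]
    have "cmp A x y ?w ?f e = cmp A x y ?w ?g e"
      by (rule arr_eqI[OF x w cmp_closed[OF x y w e f] cmp_closed[OF x y w e g]])
        (simp add: cmp_apply arr_closed[OF x y e] qI)
    then have "?f = ?g"
      using epi w f g by (auto simp: is_epi_def)
    then have "q a = \<zero>\<^bsub>Q\<^esub>" if "a \<in> E y" for a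
    proof -
      have "?k (a, \<zero>\<^bsub>Q\<^esub>) = ?k (a, q a)"
        using fun_cong[OF \<open>?f = ?g\<close>, of a] that by simp
      moreover have "(a, \<zero>\<^bsub>Q\<^esub>) \<in> carrier ?M" "(a, q a) \<in> carrier ?M"
        using that linear_map_closed[OF q] vs_zero_closed[OF Q] by (simp_all add: M_carrier)
      ultimately have "(a, \<zero>\<^bsub>Q\<^esub>) = (a, q a)"
        using hk by metis
      then show ?thesis
        by simp
    qed
    then show False
      using q_ne by blast
  qed
  then show "e \<in> arr A x y \<and> e ` E x = E y"
    using e by simp
next
  assume e: "e \<in> arr A x y \<and> e ` E x = E y"
  show "is_epi A x y e"
    unfolding is_epi_def
  proof (intro conjI ballI impI)
    fix w f g
    assume w: "w \<in> ob A" and f: "f \<in> arr A y w" and g: "g \<in> arr A y w"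
      and eq: "cmp A x y w f e = cmp A x y w g e"
    show "f = g"
    proof (rule arr_eqI[OF y w f g])
      fix b
      assume "b \<in> E y"
      then obtain a where a: "a \<in> E x" and b: "b = e a"
        using e by blast
      show "f b = g b"
        using eq cmp_apply[OF a] b by metis
    qed
  qed (use e in blast)
qed

lemma is_image_iff:
  assumes x: "x \<in> ob A" and y: "y \<in> ob A" and f: "f \<in> arr A x y"
  shows "is_image A x y f (i, e, n) \<longleftrightarrow> i \<in> ob A \<and> e \<in> arr A x i \<and> e ` E x = E i \<and>
    n \<in> arr A i y \<and> inj_on n (E i) \<and> (\<forall>a\<in>E x. n (e a) = f a)"
  unfolding is_image_def using is_epi_iff[OF x] is_mono_iff[OF _ y] cmp_eq_iff[OF x _ y _ _ f]
  by (auto simp: cmp_apply)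

lemma ex_image:
  assumes x: "x \<in> ob A" and y: "y \<in> ob A" and f: "f \<in> arr A x y"
  shows "\<exists>I. is_image A x y f I"
proof -
  obtain i n where i: "i \<in> ob A" and n: "n \<in> arr A i y" and inj: "inj_on n (E i)" and img: "n ` E i = f ` E x"
    using ex_mono_onto[OF y subspace_image[OF assms]] by metis
  obtain e where e: "e \<in> arr A x i" and ne: "\<And>a. a \<in> E x \<Longrightarrow> n (e a) = f a"
    using lift_arr[OF x i y n inj f] img by blast
  have "b \<in> e ` E x" if b: "b \<in> E i" for b
  proof -
    obtain a where a: "a \<in> E x" "n b = f a"
      using img b by (metis imageE imageI)
    then have "b = e a"
      using inj_onD[OF inj, of b "e a"] ne[OF a(1)] arr_closed[OF x i e a(1)] b by simp
    then show ?thesis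
      using a(1) by blast
  qed
  then have "e ` E x = E i"
    using arr_closed[OF x i e] by blast
  then show ?thesis
    using is_image_iff[OF assms, of i e n] i e n inj ne by blast
qed

subsection \<open>Subobjects and linear relations\<close>

definition prj :: "'o \<Rightarrow> 'o \<Rightarrow> 'v \<Rightarrow> 'v \<times> 'v" where
  "prj x y c = (proj1 A x y c, proj2 A x y c)"

lemma
  assumes x: "x \<in> ob A" and y: "y \<in> ob A"
  shows prod_ob: "prod_ob A x y \<in> ob A"
    and proj1_arr: "proj1 A x y \<in> arr A (prod_ob A x y) x"
    and proj2_arr: "proj2 A x y \<in> arr A (prod_ob A x y) y"
    and bij_prj: "bij_betw (prj x y) (E (prod_ob A x y)) (fib x y)"
    and is_product_product: "is_product A x y (prod_ob A x y, proj1 A x y, proj2 A x y)"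
proof -
  obtain P where "tabulates x y (fib x y) P"
    by (rule ex_tabulates[OF x y fib_in_rels[OF x y]])
  then have "is_product A x y P"
    by (simp add: is_product_iff[OF x y])
  then have "is_product A x y (product A x y)"
    unfolding product_def by (rule someI)
  then show prod: "is_product A x y (prod_ob A x y, proj1 A x y, proj2 A x y)"
    by (simp add: prod_ob_def proj1_def proj2_def)
  then have tab: "tabulates x y (fib x y) (prod_ob A x y, proj1 A x y, proj2 A x y)"
    by (simp add: is_product_iff[OF x y])
  have prj: "prj x y = (\<lambda>c. (proj1 A x y c, proj2 A x y c))"
    by (simp add: fun_eq_iff prj_def)
  show "prod_ob A x y \<in> ob A" "proj1 A x y \<in> arr A (prod_ob A x y) x"
    "proj2 A x y \<in> arr A (prod_ob A x y) y" "bij_betw (prj x y) (E (prod_ob A x y)) (fib x y)"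
    using tab by (simp_all add: tabulates_def prj)
qed

lemma
  assumes x: "x \<in> ob A" and y: "y \<in> ob A" and w: "w \<in> ob A" and f: "f \<in> arr A w x" and g: "g \<in> arr A w y"
  shows tuple_arr: "tuple A w x y f g \<in> arr A w (prod_ob A x y)"
    and prj_tuple: "a \<in> E w \<Longrightarrow> prj x y (tuple A w x y f g a) = (f a, g a)"
proof -
  have "\<exists>!h. h \<in> arr A w (prod_ob A x y) \<and> cmp A w (prod_ob A x y) x (proj1 A x y) h = f \<and>
      cmp A w (prod_ob A x y) y (proj2 A x y) h = g"
    using is_product_product[OF x y] w f g by (simp add: is_product_def)
  from theI'[OF this] have t: "tuple A w x y f g \<in> arr A w (prod_ob A x y)"
    "cmp A w (prod_ob A x y) x (proj1 A x y) (tuple A w x y f g) = f"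
    "cmp A w (prod_ob A x y) y (proj2 A x y) (tuple A w x y f g) = g"
    by (simp_all add: tuple_def)
  then show "tuple A w x y f g \<in> arr A w (prod_ob A x y)"
    by simp
  show "prj x y (tuple A w x y f g a) = (f a, g a)" if a: "a \<in> E w"
    using cmp_apply[OF a, of "prod_ob A x y" x "proj1 A x y" "tuple A w x y f g"]
      cmp_apply[OF a, of "prod_ob A x y" y "proj2 A x y" "tuple A w x y f g"] t(2,3)
    by (simp add: prj_def)
qed

lemma is_mono_lift_iso:
  assumes z: "z \<in> ob A" and d: "d \<in> ob A" "is_mono A d z m" and d': "d' \<in> ob A" "is_mono A d' z m'"
    and img: "m' ` E d' = m ` E d"
  shows "\<exists>i. is_iso A d d' i \<and> cmp A d d' z m' i = m"
proof -
  have m: "m \<in> arr A d z" "inj_on m (E d)" and m': "m' \<in> arr A d' z" "inj_on m' (E d')"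
    using d d' is_mono_iff z by auto
  obtain i where i: "i \<in> arr A d d'" "\<And>a. a \<in> E d \<Longrightarrow> m' (i a) = m a"
    using lift_arr[OF d(1) d'(1) z m' m(1)] img by blast
  obtain j where j: "j \<in> arr A d' d" "\<And>a. a \<in> E d' \<Longrightarrow> m (j a) = m' a"
    using lift_arr[OF d'(1) d(1) z m m'(1)] img by blast
  have i_in: "i a \<in> E d'" if "a \<in> E d" for a
    using arr_closed[OF d(1) d'(1) i(1) that] .
  have j_in: "j a \<in> E d" if "a \<in> E d'" for a
    using arr_closed[OF d'(1) d(1) j(1) that] .
  have ji: "j (i a) = a" if "a \<in> E d" for a
    using inj_onD[OF m(2), of "j (i a)" a] i(2) j(2) i_in j_in that by simp
  have ij: "i (j a) = a" if "a \<in> E d'" for a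
    using inj_onD[OF m'(2), of "i (j a)" a] i(2) j(2) i_in j_in that by simp
  have "cmp A d d' d j i = ide A d" "cmp A d' d d' i j = ide A d'"
    unfolding cmp_eq_iff[OF d(1) d'(1) d(1) i(1) j(1) ide_closed[OF d(1)]]
      cmp_eq_iff[OF d'(1) d(1) d'(1) j(1) i(1) ide_closed[OF d'(1)]]
    by (simp_all add: ide_eq ij ji)
  moreover have "cmp A d d' z m' i = m"
    unfolding cmp_eq_iff[OF d(1) d'(1) z i(1) m'(1) m(1)] by (simp add: i)
  ultimately show ?thesis
    using i(1) j(1) unfolding is_iso_def by blast
qed

text \<open>An isomorphism over \<open>z\<close> preserves the image, and conversely two injective
  arrows with the same image lift through each other. A subobject is therefore nothing but the image
  of its representatives.\<close>

lemma sub_class_eq: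
  assumes z: "z \<in> ob A" and d: "d \<in> ob A" and mono: "is_mono A d z m"
  shows "sub_class A z (d, m) = {(d', m'). d' \<in> ob A \<and> is_mono A d' z m' \<and> m' ` E d' = m ` E d}"
proof -
  have "m' ` E d' = m ` E d" if d': "d' \<in> ob A" and i: "is_iso A d d' i" "cmp A d d' z m' i = m" for d' m' i
  proof -
    obtain j where ij: "i \<in> arr A d d'" "j \<in> arr A d' d" "cmp A d' d d' i j = ide A d'"
      using i(1) by (auto simp: is_iso_def)
    have "i (j b) = b" if "b \<in> E d'" for b
      using cmp_apply[OF that, of d d' i j] ij(3) that by (simp add: ide_eq)
    then have "i ` E d = E d'"
      using arr_closed[OF d d' ij(1)] arr_closed[OF d' d ij(2)] by (metis image_eqI image_subsetI subsetI subset_antisym)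
    moreover have "m a = m' (i a)" if "a \<in> E d" for a
      using cmp_apply[OF that] i(2) by metis
    ultimately show ?thesis
      by (metis (no_types, lifting) image_cong image_image)
  qed
  then have iff: "(\<exists>i. is_iso A d d' i \<and> cmp A d d' z m' i = m) \<longleftrightarrow> m' ` E d' = m ` E d"
    if "d' \<in> ob A" "is_mono A d' z m'" for d' m'
    using that is_mono_lift_iso[OF z d mono that] by blast
  have "(d', m') \<in> sub_class A z (d, m) \<longleftrightarrow> d' \<in> ob A \<and> is_mono A d' z m' \<and> m' ` E d' = m ` E d" for d' m'
    unfolding sub_class_def prod.case mem_Collect_eq using iff[of d' m'] by blast
  then show ?thesis
    by (simp add: set_eq_iff)
qed

lemma subobjects_sub_rep:
  assumes z: "z \<in> ob A" and r: "r \<in> subobjects A z"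
  obtains d m where "sub_rep r = (d, m)" and "d \<in> ob A" and "is_mono A d z m" and "r = sub_class A z (d, m)"
proof -
  obtain d0 m0 where d0: "d0 \<in> ob A" "is_mono A d0 z m0" and r0: "r = sub_class A z (d0, m0)"
    using r by (auto simp: subobjects_def)
  have "(d0, m0) \<in> r"
    using d0 by (simp add: r0 sub_class_eq[OF z d0])
  then have "sub_rep r \<in> r"
    unfolding sub_rep_def by (rule someI)
  moreover obtain d m where dm: "sub_rep r = (d, m)"
    by force
  ultimately have "(d, m) \<in> sub_class A z (d0, m0)"
    using r0 by simp
  then have d: "d \<in> ob A" "is_mono A d z m" "m ` E d = m0 ` E d0"
    by (simp_all add: sub_class_eq[OF z d0])
  have "r = sub_class A z (d, m)"
    unfolding r0 sub_class_eq[OF z d0] sub_class_eq[OF z d(1,2)] d(3) ..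
  then show thesis
    using that dm d by blast
qed

definition rel :: "'o \<Rightarrow> 'o \<Rightarrow> ('o, 'v \<Rightarrow> 'v) subobj \<Rightarrow> ('v \<times> 'v) set" where
  "rel x y r = prj x y ` snd (sub_rep r) ` E (fst (sub_rep r))"

text \<open>Meaningful on \<open>rels x y\<close>, which \<open>bij_betw_rel\<close> shows to be the
  range of \<open>rel x y\<close> on subobjects.\<close>

definition sub :: "'o \<Rightarrow> 'o \<Rightarrow> ('v \<times> 'v) set \<Rightarrow> ('o, 'v \<Rightarrow> 'v) subobj" where
  "sub x y = inv_into (subobjects A (prod_ob A x y)) (rel x y)"

lemma sub_class_in_subobjects:
  "\<lbrakk>d \<in> ob A; is_mono A d z m\<rbrakk> \<Longrightarrow> sub_class A z (d, m) \<in> subobjects A z"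
  unfolding subobjects_def by blast

text \<open>All members of a class have the same image, so \<open>rel\<close> may be computed from
  any representative and not only from the one picked by \<open>sub_rep\<close>.\<close>

lemma rel_sub_class:
  assumes x: "x \<in> ob A" and y: "y \<in> ob A" and d: "d \<in> ob A" and mono: "is_mono A d (prod_ob A x y) m"
  shows "rel x y (sub_class A (prod_ob A x y) (d, m)) = (\<lambda>a. prj x y (m a)) ` E d"
proof -
  note z = prod_ob[OF x y]
  let ?r = "sub_class A (prod_ob A x y) (d, m)"
  obtain d' m' where r: "sub_rep ?r = (d', m')" and d': "d' \<in> ob A" "is_mono A d' (prod_ob A x y) m'"
    and eq: "?r = sub_class A (prod_ob A x y) (d', m')"
    using subobjects_sub_rep[OF z sub_class_in_subobjects[OF d mono]] by blast
  have "(d', m') \<in> ?r"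
    unfolding eq using d' by (simp add: sub_class_eq[OF z d'])
  then have "m' ` E d' = m ` E d"
    by (simp add: sub_class_eq[OF z d mono])
  then show ?thesis
    by (simp add: rel_def r image_image[symmetric, of "prj x y" m])
qed

lemma rel_in_rels:
  assumes x: "x \<in> ob A" and y: "y \<in> ob A" and r: "r \<in> subobjects A (prod_ob A x y)"
  shows "rel x y r \<in> rels x y"
proof -
  note z = prod_ob[OF x y]
  obtain d m where sr: "sub_rep r = (d, m)" and d: "d \<in> ob A" and mono: "is_mono A d (prod_ob A x y) m"
    by (rule subobjects_sub_rep[OF z r])
  have m: "m \<in> arr A d (prod_ob A x y)"
    using mono is_mono_iff[OF d z] by blast
  note p1 = arr_linear[OF z x proj1_arr[OF x y]] and p2 = arr_linear[OF z y proj2_arr[OF x y]]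
  note S = subspace_image[OF d z m]
  have S_sub: "c \<in> E (prod_ob A x y)" if "c \<in> m ` E d" for c
    using subspace_subset[OF S] that by blast
  have rel: "rel x y r = prj x y ` m ` E d"
    by (simp add: rel_def sr)
  have "lin_rel K (U x) (U y) (prj x y ` m ` E d)"
  proof (rule lin_relI)
    have "prj x y ` m ` E d \<subseteq> fib x y"
      using bij_prj[OF x y] S_sub by (auto simp: bij_betw_def)
    then show "prj x y ` m ` E d \<subseteq> E x \<times> E y"
      by (auto simp: fib_def)
    have "(\<zero>\<^bsub>U x\<^esub>, \<zero>\<^bsub>U y\<^esub>) = prj x y \<zero>\<^bsub>U (prod_ob A x y)\<^esub>"
      by (simp add: prj_def linear_map_zero[OF p1] linear_map_zero[OF p2])
    then show "(\<zero>\<^bsub>U x\<^esub>, \<zero>\<^bsub>U y\<^esub>) \<in> prj x y ` m ` E d"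
      using subspace_zero[OF S] by (metis imageI)
  next
    fix a b a' b'
    assume "(a, b) \<in> prj x y ` m ` E d" "(a', b') \<in> prj x y ` m ` E d"
    then obtain c c' where c: "c \<in> m ` E d" "(a, b) = prj x y c" and c': "c' \<in> m ` E d" "(a', b') = prj x y c'"
      by (elim imageE) blast
    then have "(a \<oplus>\<^bsub>U x\<^esub> a', b \<oplus>\<^bsub>U y\<^esub> b') = prj x y (c \<oplus>\<^bsub>U (prod_ob A x y)\<^esub> c')"
      using S_sub by (simp add: prj_def linear_map_add[OF p1] linear_map_add[OF p2])
    then show "(a \<oplus>\<^bsub>U x\<^esub> a', b \<oplus>\<^bsub>U y\<^esub> b') \<in> prj x y ` m ` E d"
      using subspace_add[OF S c(1) c'(1)] by (metis imageI)
  next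
    fix k a b
    assume k: "k \<in> carrier K" and "(a, b) \<in> prj x y ` m ` E d"
    then obtain c where c: "c \<in> m ` E d" "(a, b) = prj x y c"
      by (elim imageE) blast
    then have "(k \<odot>\<^bsub>U x\<^esub> a, k \<odot>\<^bsub>U y\<^esub> b) = prj x y (k \<odot>\<^bsub>U (prod_ob A x y)\<^esub> c)"
      using S_sub k by (simp add: prj_def linear_map_smult[OF p1] linear_map_smult[OF p2])
    then show "(k \<odot>\<^bsub>U x\<^esub> a, k \<odot>\<^bsub>U y\<^esub> b) \<in> prj x y ` m ` E d"
      using subspace_smult[OF S k c(1)] by (metis imageI)
  qed
  moreover have "prj x y ` m ` E d \<subseteq> fib x y"
    using bij_prj[OF x y] S_sub by (auto simp: bij_betw_def)
  ultimately show ?thesis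
    unfolding rel rels_def by blast
qed

lemma inj_on_rel:
  assumes x: "x \<in> ob A" and y: "y \<in> ob A"
  shows "inj_on (rel x y) (subobjects A (prod_ob A x y))"
proof (rule inj_onI)
  note z = prod_ob[OF x y]
  fix r r'
  assume r: "r \<in> subobjects A (prod_ob A x y)" and r': "r' \<in> subobjects A (prod_ob A x y)"
    and eq: "rel x y r = rel x y r'"
  obtain d m where sr: "sub_rep r = (d, m)" and d: "d \<in> ob A" "is_mono A d (prod_ob A x y) m"
    and r_eq: "r = sub_class A (prod_ob A x y) (d, m)"
    by (rule subobjects_sub_rep[OF z r])
  obtain d' m' where sr': "sub_rep r' = (d', m')" and d': "d' \<in> ob A" "is_mono A d' (prod_ob A x y) m'"
    and r'_eq: "r' = sub_class A (prod_ob A x y) (d', m')"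
    by (rule subobjects_sub_rep[OF z r'])
  have "m ` E d \<subseteq> E (prod_ob A x y)" "m' ` E d' \<subseteq> E (prod_ob A x y)"
    using d d' is_mono_iff[OF _ z] arr_closed[OF _ z] by blast+
  moreover have "prj x y ` m ` E d = prj x y ` m' ` E d'"
    using eq by (simp add: rel_def sr sr')
  ultimately have "m ` E d = m' ` E d'"
    using inj_on_image_eq_iff[OF bij_betw_imp_inj_on[OF bij_prj[OF x y]], of "m ` E d" "m' ` E d'"]
    by simp
  then show "r = r'"
    by (simp add: r_eq r'_eq sub_class_eq[OF z d] sub_class_eq[OF z d'])
qed

text \<open>The subobject is found by pairing the legs of a tabulation of \<open>R\<close> into the
  product; the pairing is injective because the legs jointly are.\<close>

lemma
  assumes x: "x \<in> ob A" and y: "y \<in> ob A" and R: "R \<in> rels x y"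
  shows sub_in: "sub x y R \<in> subobjects A (prod_ob A x y)" and rel_sub: "rel x y (sub x y R) = R"
proof -
  note z = prod_ob[OF x y]
  obtain p u v where P: "tabulates x y R (p, u, v)"
    using ex_tabulates[OF x y R] by (metis prod_cases3)
  then have p: "p \<in> ob A" and u: "u \<in> arr A p x" and v: "v \<in> arr A p y"
    and bij: "bij_betw (\<lambda>a. (u a, v a)) (E p) R"
    by (auto simp: tabulates_def)
  let ?m = "tuple A p x y u v"
  note m = tuple_arr[OF x y p u v] and prj_m = prj_tuple[OF x y p u v]
  have "inj_on ?m (E p)"
  proof (rule inj_onI)
    fix a b
    assume a: "a \<in> E p" and b: "b \<in> E p" and "?m a = ?m b"
    then have "prj x y (?m a) = prj x y (?m b)"
      by (intro arg_cong[where f = "prj x y"])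
    then show "a = b"
      unfolding prj_m[OF a] prj_m[OF b] by (rule inj_onD[OF bij_betw_imp_inj_on[OF bij] _ a b])
  qed
  then have mono: "is_mono A p (prod_ob A x y) ?m"
    using m by (simp add: is_mono_iff[OF p z])
  have "rel x y (sub_class A (prod_ob A x y) (p, ?m)) = R"
    using rel_sub_class[OF x y p mono] bij prj_m by (simp add: bij_betw_def)
  then have "R \<in> rel x y ` subobjects A (prod_ob A x y)"
    using sub_class_in_subobjects[OF p mono] by blast
  then show "sub x y R \<in> subobjects A (prod_ob A x y)" "rel x y (sub x y R) = R"
    unfolding sub_def by (rule inv_into_into, rule f_inv_into_f)
qed

lemma sub_rel:
  assumes "x \<in> ob A" and "y \<in> ob A" and "r \<in> subobjects A (prod_ob A x y)"
  shows "sub x y (rel x y r) = r"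
  unfolding sub_def using inv_into_f_f[OF inj_on_rel[OF assms(1,2)] assms(3)] .

lemma bij_betw_rel:
  assumes "x \<in> ob A" and "y \<in> ob A"
  shows "bij_betw (rel x y) (subobjects A (prod_ob A x y)) (rels x y)"
    and "bij_betw (sub x y) (rels x y) (subobjects A (prod_ob A x y))"
proof -
  show bij: "bij_betw (rel x y) (subobjects A (prod_ob A x y)) (rels x y)"
    unfolding bij_betw_def
  proof
    show "rel x y ` subobjects A (prod_ob A x y) = rels x y"
    proof
      show "rels x y \<subseteq> rel x y ` subobjects A (prod_ob A x y)"
        using rel_sub[OF assms] sub_in[OF assms] by (metis image_eqI subsetI)
    qed (use rel_in_rels[OF assms] in blast)
  qed (rule inj_on_rel[OF assms])
  show "bij_betw (sub x y) (rels x y) (subobjects A (prod_ob A x y))"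
    unfolding sub_def by (rule bij_betw_inv_into[OF bij])
qed

lemma sub_eqI:
  assumes "x \<in> ob A" and "y \<in> ob A" and "r \<in> subobjects A (prod_ob A x y)" and "rel x y r = R"
  shows "sub x y R = r"
  using sub_rel[OF assms(1-3)] assms(4) by simp


subsection \<open>Composition of relations\<close>

lemma rels_comp:
  assumes "R \<in> rels x y" and "S \<in> rels y z"
  shows "R O S \<in> rels x z"
proof -
  have "lin_rel K (U x) (U z) (R O S)"
    using assms lin_rel_comp by (auto simp: rels_def)
  moreover have "R O S \<subseteq> fib x z"
    using assms by (fastforce simp: rels_def fib_def)
  ultimately show ?thesis
    by (simp add: rels_def)
qed

abbreviation ov :: "'o \<Rightarrow> 'o \<Rightarrow> ('v \<times> 'v) set \<Rightarrow> ('v \<times> 'v) set \<Rightarrow> 'v set" where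
  "ov x z \<equiv> overlap (U x) (U z)"

text \<open>As \<open>card (carrier K) > 1\<close>, the exponent is determined by its power.\<close>

definition weight :: "'o \<Rightarrow> 'o \<Rightarrow> ('v \<times> 'v) set \<Rightarrow> ('v \<times> 'v) set \<Rightarrow> 'k" where
  "weight x z R S = t ^ (THE d. card (ov x z R S) = card (carrier K) ^ d)"

lemma card_K: "1 < card (carrier K)"
proof -
  interpret field K by (rule field_K)
  have "card {\<zero>\<^bsub>K\<^esub>, \<one>\<^bsub>K\<^esub>} \<le> card (carrier K)"
    by (rule card_mono[OF finite_K]) simp
  then show ?thesis
    by simp
qed

lemma weight_eqI:
  assumes "card (ov x z R S) = card (carrier K) ^ d"
  shows "weight x z R S = t ^ d"
  unfolding weight_def using assms card_K by simp

lemma card_ov: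
  assumes "x \<in> ob A" and "y \<in> ob A" and "z \<in> ob A" and "R \<in> rels x y" and "S \<in> rels y z"
  obtains d where "card (ov x z R S) = card (carrier K) ^ d"
  using card_subspace[OF subspace_overlap[OF U_vs[OF assms(1)] U_vs[OF assms(2)] U_vs[OF assms(3)]]
      finite_K U_finite[OF assms(2)]] assms(4,5)
  by (auto simp: rels_def)

text \<open>The counting identity equates two powers of \<open>card (carrier K)\<close>, a number
  above \<open>1\<close>, hence the exponents agree in the natural numbers. Only then are they
  placed on \<open>t\<close>, so the identity holds for every \<open>t\<close>, \<open>0\<close>
  included.\<close>

lemma weight_cocycle:
  assumes o: "v \<in> ob A" "x \<in> ob A" "y \<in> ob A" "z \<in> ob A"
    and R: "R \<in> rels v x" and S: "S \<in> rels x y" and Q: "Q \<in> rels y z"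
  shows "weight v z (R O S) Q * weight v y R S = weight v z R (S O Q) * weight x z S Q"
proof -
  obtain a where a: "card (ov v z (R O S) Q) = card (carrier K) ^ a"
    by (rule card_ov[OF o(1,3,4) rels_comp[OF R S] Q])
  obtain b where b: "card (ov v y R S) = card (carrier K) ^ b"
    by (rule card_ov[OF o(1,2,3) R S])
  obtain c where c: "card (ov v z R (S O Q)) = card (carrier K) ^ c"
    by (rule card_ov[OF o(1,2,4) R rels_comp[OF S Q]])
  obtain d where d: "card (ov x z S Q) = card (carrier K) ^ d"
    by (rule card_ov[OF o(2,3,4) S Q])
  have "card (carrier K) ^ (a + b) = card (carrier K) ^ (c + d)"
    using overlap_cocycle[OF o[THEN U_vs] U_finite[OF o(2)] U_finite[OF o(3)], of R S Q] R S Q a b c d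
    by (simp add: rels_def power_add)
  then have "a + b = c + d"
    using card_K by simp
  then show ?thesis
    by (simp add: weight_eqI[OF a] weight_eqI[OF b] weight_eqI[OF c] weight_eqI[OF d] power_add[symmetric])
qed

text \<open>A bijection of sets suffices to compare the kernel with the overlap: over a finite field
  the dimension of a finite space is determined by its cardinality.\<close>

lemma vect_deg_eq:
  assumes x: "x \<in> ob A" and y: "y \<in> ob A" and e: "e \<in> arr A x y"
    and bij: "bij_betw g {a \<in> E x. e a = \<zero>\<^bsub>U y\<^esub>} (ov w z R S)"
  shows "\<delta> x y e = weight w z R S"
proof -
  note lin = arr_linear[OF x y e]
  have ker: "mod_hom.ker (U x) (U y) e = {a \<in> E x. e a = \<zero>\<^bsub>U y\<^esub>}"
    by (rule mod_hom.ker_def[OF linear_map.axioms(3)[OF lin]])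
  have "card (mod_hom.ker (U x) (U y) e) =
      card (carrier K) ^ vectorspace.dim K (U x\<lparr>carrier := mod_hom.ker (U x) (U y) e\<rparr>)"
    by (rule card_subspace[OF linear_map.kerT_is_subspace[OF lin] finite_K U_finite[OF x]])
  then show ?thesis
    using weight_eqI[of w z R S] bij_betw_same_card[OF bij] by (simp add: \<delta>_eq vect_deg_def ker)
qed

lemma sub_rep_legs:
  assumes x: "x \<in> ob A" and y: "y \<in> ob A" and r: "r \<in> subobjects A (prod_ob A x y)" and sr: "sub_rep r = (d, m)"
  defines "f \<equiv> cmp A d (prod_ob A x y) x (proj1 A x y) m" and "g \<equiv> cmp A d (prod_ob A x y) y (proj2 A x y) m"
  shows "d \<in> ob A" and "f \<in> arr A d x" and "g \<in> arr A d y" and "bij_betw (\<lambda>a. (f a, g a)) (E d) (rel x y r)"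
proof -
  note xy = prod_ob[OF x y]
  obtain d' m' where "sub_rep r = (d', m')" "d' \<in> ob A" "is_mono A d' (prod_ob A x y) m'"
    by (rule subobjects_sub_rep[OF xy r])
  then have dm: "d \<in> ob A" "is_mono A d (prod_ob A x y) m"
    using sr by simp_all
  show d: "d \<in> ob A"
    by (rule dm(1))
  have m: "m \<in> arr A d (prod_ob A x y)" "inj_on m (E d)"
    using dm(2) is_mono_iff[OF d xy] by auto
  show "f \<in> arr A d x" "g \<in> arr A d y"
    unfolding f_def g_def by (rule cmp_closed; fact d x y xy m(1) proj1_arr[OF x y] proj2_arr[OF x y])+
  have fg: "(f a, g a) = prj x y (m a)" if "a \<in> E d" for a
    using that by (simp add: f_def g_def cmp_apply prj_def)
  show "bij_betw (\<lambda>a. (f a, g a)) (E d) (rel x y r)"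
    unfolding bij_betw_def
  proof
    have "inj_on (\<lambda>a. prj x y (m a)) (E d)"
      using inj_on_subset[OF bij_betw_imp_inj_on[OF bij_prj[OF x y]], of "m ` E d"]
        arr_closed[OF d xy m(1)] comp_inj_on[OF m(2)] by (auto simp: comp_def)
    then show "inj_on (\<lambda>a. (f a, g a)) (E d)"
      using fg by (simp cong: inj_on_cong)
    show "(\<lambda>a. (f a, g a)) ` E d = rel x y r"
      using fg by (simp add: rel_def sr image_image)
  qed
qed

text \<open>A point of the pullback is a chain \<open>a, b, c\<close> with \<open>(a, b)\<close> and
  \<open>(b, c)\<close> in the two relations. The map to the product of \<open>x\<close> and
  \<open>z\<close> forgets \<open>b\<close>, so its image is the relational composite and its kernel
  consists of the chains \<open>0, b, 0\<close>, that is, of the overlap. This holds for whatever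
  pullback and factorization are chosen.\<close>

lemma comp_sub_eq:
  assumes x: "x \<in> ob A" and y: "y \<in> ob A" and z: "z \<in> ob A"
    and r: "r \<in> subobjects A (prod_ob A x y)" and s: "s \<in> subobjects A (prod_ob A y z)"
  shows "comp_sub A \<delta> x y z s r =
    Poly_Mapping.single (sub x z (rel x y r O rel y z s)) (weight x z (rel x y r) (rel y z s))"
proof -
  note xz = prod_ob[OF x z]
  obtain d m where sr: "sub_rep r = (d, m)"
    by force
  obtain d' m' where ss: "sub_rep s = (d', m')"
    by force
  define f1 where "f1 = cmp A d (prod_ob A x y) x (proj1 A x y) m"
  define f2 where "f2 = cmp A d (prod_ob A x y) y (proj2 A x y) m"
  define g1 where "g1 = cmp A d' (prod_ob A y z) y (proj1 A y z) m'"
  define g2 where "g2 = cmp A d' (prod_ob A y z) z (proj2 A y z) m'"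
  note d = sub_rep_legs(1)[OF x y r sr] and d' = sub_rep_legs(1)[OF y z s ss]
  note f1 = sub_rep_legs(2)[OF x y r sr, folded f1_def] and f2 = sub_rep_legs(3)[OF x y r sr, folded f2_def]
    and g1 = sub_rep_legs(2)[OF y z s ss, folded g1_def] and g2 = sub_rep_legs(3)[OF y z s ss, folded g2_def]
    and bij_f = sub_rep_legs(4)[OF x y r sr, folded f1_def f2_def]
    and bij_g = sub_rep_legs(4)[OF y z s ss, folded g1_def g2_def]
  have f_rel: "(f1 a, f2 a) \<in> rel x y r" if "a \<in> E d" for a
    using bij_betw_apply[OF bij_f that] by simp
  have g_rel: "(g1 a, g2 a) \<in> rel y z s" if "a \<in> E d'" for a
    using bij_betw_apply[OF bij_g that] by simp
  have rel_f: "\<exists>c\<in>E d. w = (f1 c, f2 c)" if "w \<in> rel x y r" for w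
    using that bij_betw_imp_surj_on[OF bij_f] by blast
  have rel_g: "\<exists>c\<in>E d'. w = (g1 c, g2 c)" if "w \<in> rel y z s" for w
    using that bij_betw_imp_surj_on[OF bij_g] by blast
  obtain P0 where "tabulates d d' (pb d d' f2 g1) P0"
    by (rule ex_tabulates[OF d d' pb_in_rels[OF d d' y f2 g1]])
  \<comment> \<open>The pullback always exists, so the branch of \<open>comp_sub\<close> with value
    \<open>0\<close> is never taken.\<close>
  then have exP: "\<exists>P. is_pullback A d d' y f2 g1 P"
    using is_pullback_iff[OF d d' y f2 g1] by blast
  obtain p u v where P_eq: "(SOME P. is_pullback A d d' y f2 g1 P) = (p, u, v)"
    by (metis prod_cases3)
  have "is_pullback A d d' y f2 g1 (p, u, v)"
    using someI_ex[OF exP] P_eq by simp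
  then have "tabulates d d' (pb d d' f2 g1) (p, u, v)"
    using is_pullback_iff[OF d d' y f2 g1] by blast
  then have p: "p \<in> ob A" and u: "u \<in> arr A p d" and v: "v \<in> arr A p d'"
    and bij_p: "bij_betw (\<lambda>a. (u a, v a)) (E p) (pb d d' f2 g1)"
    by (auto simp: tabulates_def)
  have uv_pb: "u a \<in> E d" "v a \<in> E d'" "f2 (u a) = g1 (v a)" if "a \<in> E p" for a
    using bij_p that by (auto simp: bij_betw_def pb_def)
  define a1 where "a1 = cmp A p d x f1 u"
  define a2 where "a2 = cmp A p d' z g2 v"
  have a1: "a1 \<in> arr A p x" and a2: "a2 \<in> arr A p z"
    unfolding a1_def a2_def by (rule cmp_closed; fact p d d' x z u v f1 g2)+
  define k where "k = tuple A p x z a1 a2"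
  have k: "k \<in> arr A p (prod_ob A x z)"
    unfolding k_def by (rule tuple_arr[OF x z p a1 a2])
  have prj_k: "prj x z (k a) = (f1 (u a), g2 (v a))" if "a \<in> E p" for a
    using prj_tuple[OF x z p a1 a2 that] that by (simp add: k_def a1_def a2_def cmp_apply)
  obtain i e n where I_eq: "(SOME I. is_image A p (prod_ob A x z) k I) = (i, e, n)"
    by (metis prod_cases3)
  have "is_image A p (prod_ob A x z) k (i, e, n)"
    using someI_ex[OF ex_image[OF p xz k]] I_eq by simp
  then have i: "i \<in> ob A" and e: "e \<in> arr A p i" and e_onto: "e ` E p = E i"
    and n: "n \<in> arr A i (prod_ob A x z)" and n_inj: "inj_on n (E i)" and ne: "\<And>a. a \<in> E p \<Longrightarrow> n (e a) = k a"
    by (auto simp: is_image_iff[OF p xz k])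
  have n_mono: "is_mono A i (prod_ob A x z) n"
    using n n_inj by (simp add: is_mono_iff[OF i xz])
  have cs: "comp_sub A \<delta> x y z s r = Poly_Mapping.single (sub_class A (prod_ob A x z) (i, n)) (\<delta> p i e)"
    unfolding comp_sub_def sr ss Let_def prod.case f1_def[symmetric] f2_def[symmetric]
      g1_def[symmetric] g2_def[symmetric] if_P[OF exP] P_eq a1_def[symmetric] a2_def[symmetric]
      k_def[symmetric] I_eq ..
  have "(\<lambda>a. prj x z (n a)) ` E i = (\<lambda>a. prj x z (k a)) ` E p"
    unfolding e_onto[symmetric] image_image using ne by simp
  also have "\<dots> = (\<lambda>a. (f1 (u a), g2 (v a))) ` E p"
    using prj_k by simp
  also have "\<dots> = rel x y r O rel y z s"
  proof (intro subset_antisym subsetI)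
    fix w
    assume "w \<in> (\<lambda>a. (f1 (u a), g2 (v a))) ` E p"
    then obtain a where a: "a \<in> E p" and w: "w = (f1 (u a), g2 (v a))"
      by blast
    show "w \<in> rel x y r O rel y z s"
      unfolding w using f_rel[OF uv_pb(1)[OF a]] g_rel[OF uv_pb(2)[OF a]] uv_pb(3)[OF a] by auto
  next
    fix w
    assume "w \<in> rel x y r O rel y z s"
    then obtain w1 b w2 where w: "w = (w1, w2)" and r': "(w1, b) \<in> rel x y r" and s': "(b, w2) \<in> rel y z s"
      by blast
    obtain c where c: "c \<in> E d" "(w1, b) = (f1 c, f2 c)"
      using rel_f[OF r'] by blast
    obtain c' where c': "c' \<in> E d'" "(b, w2) = (g1 c', g2 c')"
      using rel_g[OF s'] by blast
    \<comment> \<open>Representatives \<open>c\<close> and \<open>c'\<close> that agree in the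
      middle vector \<open>b\<close> form a point of the pullback.\<close>
    have "(c, c') \<in> (\<lambda>a. (u a, v a)) ` E p"
      using bij_p c c' by (simp add: bij_betw_def pb_def)
    then show "w \<in> (\<lambda>a. (f1 (u a), g2 (v a))) ` E p"
      using c c' w by auto
  qed
  finally have "rel x z (sub_class A (prod_ob A x z) (i, n)) = rel x y r O rel y z s"
    using rel_sub_class[OF x z i n_mono] by simp
  then have sub: "sub x z (rel x y r O rel y z s) = sub_class A (prod_ob A x z) (i, n)"
    using sub_eqI[OF x z sub_class_in_subobjects[OF i n_mono]] by blast
  let ?ker = "{a \<in> E p. e a = \<zero>\<^bsub>U i\<^esub>}"
  have n0: "n \<zero>\<^bsub>U i\<^esub> = \<zero>\<^bsub>U (prod_ob A x z)\<^esub>"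
    by (rule linear_map_zero[OF arr_linear[OF i xz n]])
  have prj0: "prj x z \<zero>\<^bsub>U (prod_ob A x z)\<^esub> = (\<zero>\<^bsub>U x\<^esub>, \<zero>\<^bsub>U z\<^esub>)"
    by (simp add: prj_def linear_map_zero[OF arr_linear[OF xz x proj1_arr[OF x z]]]
        linear_map_zero[OF arr_linear[OF xz z proj2_arr[OF x z]]])
  \<comment> \<open>\<open>n\<close> and \<open>prj x z\<close> are injective, so \<open>e a\<close>
    vanishes exactly when both outer vectors of the chain do.\<close>
  have ker_iff: "e a = \<zero>\<^bsub>U i\<^esub> \<longleftrightarrow> f1 (u a) = \<zero>\<^bsub>U x\<^esub> \<and> g2 (v a) = \<zero>\<^bsub>U z\<^esub>" if a: "a \<in> E p" for a
  proof -
    have "e a = \<zero>\<^bsub>U i\<^esub> \<longleftrightarrow> n (e a) = n \<zero>\<^bsub>U i\<^esub>"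
      using inj_on_eq_iff[OF n_inj arr_closed[OF p i e a] vs_zero_closed[OF U_vs[OF i]]] by simp
    also have "\<dots> \<longleftrightarrow> prj x z (k a) = prj x z \<zero>\<^bsub>U (prod_ob A x z)\<^esub>"
      using inj_on_eq_iff[OF bij_betw_imp_inj_on[OF bij_prj[OF x z]] arr_closed[OF p xz k a]
        vs_zero_closed[OF U_vs[OF xz]]] ne[OF a] n0 by simp
    finally show ?thesis
      by (simp add: prj_k[OF a] prj0)
  qed
  \<comment> \<open>A kernel element is a chain from \<open>0\<close> to \<open>0\<close>, and its
    middle vector \<open>f2 (u a)\<close> determines it.\<close>
  have "bij_betw (\<lambda>a. f2 (u a)) ?ker (ov x z (rel x y r) (rel y z s))"
    unfolding bij_betw_def
  proof
    show "inj_on (\<lambda>a. f2 (u a)) ?ker"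
    proof (rule inj_onI)
      fix a b
      assume a: "a \<in> ?ker" and b: "b \<in> ?ker" and eq: "f2 (u a) = f2 (u b)"
      have ap: "a \<in> E p" and bp: "b \<in> E p"
        using a b by auto
      have "(f1 (u a), f2 (u a)) = (f1 (u b), f2 (u b))" "(g1 (v a), g2 (v a)) = (g1 (v b), g2 (v b))"
        using a b eq ker_iff uv_pb(3)[OF ap] uv_pb(3)[OF bp] by auto
      then have "u a = u b" "v a = v b"
        using inj_onD[OF bij_betw_imp_inj_on[OF bij_f] _ uv_pb(1)[OF ap] uv_pb(1)[OF bp]]
          inj_onD[OF bij_betw_imp_inj_on[OF bij_g] _ uv_pb(2)[OF ap] uv_pb(2)[OF bp]] by auto
      then show "a = b"
        using inj_onD[OF bij_betw_imp_inj_on[OF bij_p] _ ap bp] by simp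
    qed
    show "(\<lambda>a. f2 (u a)) ` ?ker = ov x z (rel x y r) (rel y z s)"
    proof (intro subset_antisym subsetI)
      fix b
      assume "b \<in> (\<lambda>a. f2 (u a)) ` ?ker"
      then obtain a where a: "a \<in> E p" "e a = \<zero>\<^bsub>U i\<^esub>" and b: "b = f2 (u a)"
        by blast
      show "b \<in> ov x z (rel x y r) (rel y z s)"
        using f_rel[OF uv_pb(1)[OF a(1)]] g_rel[OF uv_pb(2)[OF a(1)]] ker_iff[OF a(1)] a(2)
          uv_pb(3)[OF a(1)] b by (simp add: overlap_def)
    next
      fix b
      assume "b \<in> ov x z (rel x y r) (rel y z s)"
      then have b: "(\<zero>\<^bsub>U x\<^esub>, b) \<in> rel x y r" "(b, \<zero>\<^bsub>U z\<^esub>) \<in> rel y z s"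
        by (simp_all add: overlap_def)
      obtain c where c: "c \<in> E d" "(\<zero>\<^bsub>U x\<^esub>, b) = (f1 c, f2 c)"
        using rel_f[OF b(1)] by blast
      obtain c' where c': "c' \<in> E d'" "(b, \<zero>\<^bsub>U z\<^esub>) = (g1 c', g2 c')"
        using rel_g[OF b(2)] by blast
      have "(c, c') \<in> (\<lambda>a. (u a, v a)) ` E p"
        using bij_p c c' by (simp add: bij_betw_def pb_def)
      then obtain a where a: "a \<in> E p" "c = u a" "c' = v a"
        by blast
      then show "b \<in> (\<lambda>a. f2 (u a)) ` ?ker"
        using ker_iff[OF a(1)] c c' by (intro image_eqI[of _ _ a]) simp_all
    qed
  qed
  then have "\<delta> p i e = weight x z (rel x y r) (rel y z s)"
    by (rule vect_deg_eq[OF p i e])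
  then show ?thesis
    using cs sub by simp
qed

definition diag :: "'o \<Rightarrow> ('o, 'v \<Rightarrow> 'v) subobj" where
  "diag x = sub_class A (prod_ob A x x) (x, tuple A x x x (ide A x) (ide A x))"

lemma
  assumes x: "x \<in> ob A"
  shows diag_in: "diag x \<in> subobjects A (prod_ob A x x)"
    and rel_diag: "rel x x (diag x) = Id_on (E x)"
proof -
  let ?t = "tuple A x x x (ide A x) (ide A x)"
  note t = tuple_arr[OF x x x ide_closed[OF x] ide_closed[OF x]]
  have prj_t: "prj x x (?t a) = (a, a)" if "a \<in> E x" for a
    using prj_tuple[OF x x x ide_closed[OF x] ide_closed[OF x] that] that by (simp add: ide_eq)
  have "inj_on ?t (E x)"
  proof (rule inj_onI)
    fix a b
    assume a: "a \<in> E x" and b: "b \<in> E x" and "?t a = ?t b"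
    then have "prj x x (?t a) = prj x x (?t b)"
      by (intro arg_cong[where f = "prj x x"])
    then show "a = b"
      unfolding prj_t[OF a] prj_t[OF b] by simp
  qed
  then have mono: "is_mono A x (prod_ob A x x) ?t"
    using t by (simp add: is_mono_iff[OF x prod_ob[OF x x]])
  show "diag x \<in> subobjects A (prod_ob A x x)"
    unfolding diag_def by (rule sub_class_in_subobjects[OF x mono])
  show "rel x x (diag x) = Id_on (E x)"
    unfolding diag_def rel_sub_class[OF x x x mono] using prj_t by (force simp: Id_on_def)
qed

lemma rels_Id_on:
  assumes "R \<in> rels x y"
  shows "Id_on (E x) O R = R" and "R O Id_on (E y) = R"
  using assms lin_rel_subset by (auto simp: rels_def Id_on_def) blast+

text \<open>The diagonal relates \<open>0\<close> to \<open>0\<close> alone, so the overlap has one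
  element and the exponent is \<open>0\<close>.\<close>

lemma weight_Id_on:
  assumes R: "R \<in> rels x y"
  shows "weight x y (Id_on (E x)) R = 1" and "weight x y R (Id_on (E y)) = 1"
proof -
  have "lin_rel K (U x) (U y) R"
    using R by (simp add: rels_def)
  note zero = lin_rel_zero[OF this] and subset = lin_rel_subset[OF this]
  have "ov x y (Id_on (E x)) R = {\<zero>\<^bsub>U x\<^esub>}" "ov x y R (Id_on (E y)) = {\<zero>\<^bsub>U y\<^esub>}"
    using zero subset by (auto simp: overlap_def Id_on_def)
  then show "weight x y (Id_on (E x)) R = 1" "weight x y R (Id_on (E y)) = 1"
    using weight_eqI[of x y _ _ 0] by simp_all
qed

text \<open>Transported through \<open>rel\<close> and \<open>sub\<close>, associativity is that of
  \<open>O\<close> on basis elements and \<open>weight_cocycle\<close> on scalars.\<close>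

sublocale T0: twisted_basis "ob A" "\<lambda>x y. subobjects A (prod_ob A x y)" "comp_sub A \<delta>" diag
  "\<lambda>x y z s r. sub x z (rel x y r O rel y z s)" "\<lambda>x y z s r. weight x z (rel x y r) (rel y z s)"
proof
  fix x y z r s
  assume a: "x \<in> ob A" "y \<in> ob A" "z \<in> ob A" "r \<in> subobjects A (prod_ob A x y)" "s \<in> subobjects A (prod_ob A y z)"
  show "comp_sub A \<delta> x y z s r =
      Poly_Mapping.single (sub x z (rel x y r O rel y z s)) (weight x z (rel x y r) (rel y z s))"
    by (rule comp_sub_eq[OF a])
  show "sub x z (rel x y r O rel y z s) \<in> subobjects A (prod_ob A x z)"
    using a by (intro sub_in rels_comp[of _ _ y] rel_in_rels)
next
  show "diag x \<in> subobjects A (prod_ob A x x)" if "x \<in> ob A" for x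
    using that by (rule diag_in)
next
  fix x y r
  assume a: "x \<in> ob A" "y \<in> ob A" "r \<in> subobjects A (prod_ob A x y)"
  note R = rel_in_rels[OF a]
  show "sub x y (rel x x (diag x) O rel x y r) = r" "sub x y (rel x y r O rel y y (diag y)) = r"
    "weight x y (rel x x (diag x)) (rel x y r) = 1" "weight x y (rel x y r) (rel y y (diag y)) = 1"
    by (simp_all add: rel_diag a rels_Id_on[OF R] weight_Id_on[OF R] sub_rel)
next
  fix v x y z r s q
  assume a: "v \<in> ob A" "x \<in> ob A" "y \<in> ob A" "z \<in> ob A" "r \<in> subobjects A (prod_ob A v x)"
    "s \<in> subobjects A (prod_ob A x y)" "q \<in> subobjects A (prod_ob A y z)"
  note R = rel_in_rels[OF a(1,2,5)] and S = rel_in_rels[OF a(2,3,6)] and Q = rel_in_rels[OF a(3,4,7)]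
  note RS = rel_sub[OF a(1,3) rels_comp[OF R S]] and SQ = rel_sub[OF a(2,4) rels_comp[OF S Q]]
  show "sub v z (rel v y (sub v y (rel v x r O rel x y s)) O rel y z q) =
      sub v z (rel v x r O rel x z (sub x z (rel x y s O rel y z q)))"
    by (simp add: RS SQ O_assoc)
  show "weight v z (rel v y (sub v y (rel v x r O rel x y s))) (rel y z q) * weight v y (rel v x r) (rel x y s) =
      weight v z (rel v x r) (rel x z (sub x z (rel x y s O rel y z q))) * weight x z (rel x y s) (rel y z q)"
    unfolding RS SQ by (rule weight_cocycle[OF a(1-4) R S Q])
qed

lemma T0_eq_L: "T0 A \<delta> = T0.L"
  unfolding T0_def linear_cat_def diag_def ..

end


section \<open>The functor \<open>(-) \<oplus> V\<^sub>0\<close>\<close>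

lemma Vect_simps:
  "f \<in> arr (Vect K) V W \<longleftrightarrow> f \<in> extensional (carrier V) \<and> linear_map K V W f"
  "cmp (Vect K) V W X g f = compose (carrier V) g f"
  "ide (Vect K) V = (\<lambda>v\<in>carrier V. v)"
  by (auto simp: Vect_def)

lemma slice_simps:
  "x \<in> ob (slice A z) \<longleftrightarrow> fst x \<in> ob A \<and> snd x \<in> arr A (fst x) z"
  "f \<in> arr (slice A z) x y \<longleftrightarrow> f \<in> arr A (fst x) (fst y) \<and> cmp A (fst x) (fst y) z (snd y) f = snd x"
  "cmp (slice A z) x y w g f = cmp A (fst x) (fst y) (fst w) g f"
  "ide (slice A z) x = ide A (fst x)"
  by (auto simp: slice_def split: prod.splits)

locale add_space =
  fixes K :: "('f, 'r) ring_scheme" and t :: "'k::field" and pair :: "'v \<times> 'v \<Rightarrow> 'v"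
    and V0 :: "('f, 'v) module"
  assumes field_K: "field K" and finite_K: "finite (carrier K)"
    and infinite_v: "infinite (UNIV :: 'v set)" and inj_pair: "inj pair" and V0_ob: "V0 \<in> ob (Vect K)"
begin

abbreviation VK :: "(('f, 'v) module, 'v \<Rightarrow> 'v) cat" where "VK \<equiv> Vect K"

abbreviation VS :: "(('f, 'v) module \<times> ('v \<Rightarrow> 'v), 'v \<Rightarrow> 'v) cat" where "VS \<equiv> slice VK V0"

abbreviation F where "F \<equiv> add_V0 pair V0"

lemma V0_vs: "vectorspace K V0" and V0_finite: "finite (carrier V0)"
  using V0_ob Vect_ob_iff[OF finite_K] by auto

lemma VK_ob: "V \<in> ob VK \<longleftrightarrow> vectorspace K V \<and> finite (carrier V)"
  by (rule Vect_ob_iff[OF finite_K])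

text \<open>The zero space is taken inside \<open>V0\<close>, as its zero subspace, which provides
  one with elements in \<open>'v\<close>; the structure maps are then forced to be constant.\<close>

sublocale C: vect_slice K VK "\<lambda>V. V" "\<lambda>V a. \<zero>\<^bsub>V0\<^esub>" "V0\<lparr>carrier := {\<zero>\<^bsub>V0\<^esub>}\<rparr>" "\<lambda>V p. V"
  "vect_deg K t" t
proof (rule vect_slice.intro)
  have "subspace K {\<zero>\<^bsub>V0\<^esub>} V0"
    using vs_zero_closed[OF V0_vs] vs_zero_add[OF V0_vs] vs_smult_zero[OF V0_vs]
    by (intro subspaceI[OF V0_vs]) auto
  then have Z: "vectorspace K (V0\<lparr>carrier := {\<zero>\<^bsub>V0\<^esub>}\<rparr>)"
    by (rule vectorspace.subspace_is_vs[OF V0_vs])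
  show "linear_map K V (V0\<lparr>carrier := {\<zero>\<^bsub>V0\<^esub>}\<rparr>) (\<lambda>a. \<zero>\<^bsub>V0\<^esub>)" if "V \<in> ob VK" for V
    using that VK_ob vs_zero_add[OF V0_vs vs_zero_closed[OF V0_vs]] vs_smult_zero[OF V0_vs]
    by (intro linear_mapI[OF _ Z]) auto
  show "V \<in> ob VK" if "linear_map K V (V0\<lparr>carrier := {\<zero>\<^bsub>V0\<^esub>}\<rparr>) p" "finite (carrier V)" for V p
    using that linear_map_dom VK_ob by blast
  show "\<zero>\<^bsub>V0\<^esub> = p a"
    if "linear_map K V (V0\<lparr>carrier := {\<zero>\<^bsub>V0\<^esub>}\<rparr>) p" "finite (carrier V)" "a \<in> carrier V" for V p a
    using linear_map_closed[OF that(1,3)] by simp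
qed (use field_K finite_K infinite_v VK_ob in \<open>auto simp: Vect_simps\<close>)

lemma VS_ob: "x \<in> ob VS \<longleftrightarrow> finite (carrier (fst x)) \<and> snd x \<in> extensional (carrier (fst x)) \<and>
    linear_map K (fst x) V0 (snd x)"
  using linear_map_dom by (auto simp: slice_simps Vect_simps VK_ob)

text \<open>Structure maps of objects are arrows of \<open>Vect K\<close> and hence extensional, so
  a linear map has to be restricted before it becomes one.\<close>

sublocale D: vect_slice K VS fst snd V0 "\<lambda>V p. (V, restrict p (carrier V))" "slice_deg (vect_deg K t)" t
proof (rule vect_slice.intro)
  show "f \<in> arr VS x y \<longleftrightarrow> f \<in> extensional (carrier (fst x)) \<and> linear_map K (fst x) (fst y) f \<and>
      (\<forall>a\<in>carrier (fst x). snd y (f a) = snd x a)" if "x \<in> ob VS" "y \<in> ob VS" for x y f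
  proof -
    have "snd x \<in> extensional (carrier (fst x))"
      using that by (simp add: VS_ob)
    then have "compose (carrier (fst x)) (snd y) f = snd x \<longleftrightarrow>
        (\<forall>a\<in>carrier (fst x). compose (carrier (fst x)) (snd y) f a = snd x a)"
      using extensionalityI[of "compose (carrier (fst x)) (snd y) f" "carrier (fst x)" "snd x"]
      by (metis compose_extensional)
    then have "compose (carrier (fst x)) (snd y) f = snd x \<longleftrightarrow>
        (\<forall>a\<in>carrier (fst x). snd y (f a) = snd x a)"
      by (simp add: compose_eq)
    then show ?thesis
      by (auto simp: slice_simps Vect_simps)
  qed
  show "(V, restrict p (carrier V)) \<in> ob VS" if "linear_map K V V0 p" "finite (carrier V)" for V p
    using that linear_map_cong[OF that(1), of "restrict p (carrier V)"] by (simp add: VS_ob)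
qed (use field_K finite_K infinite_v linear_map_dom in
  \<open>auto simp: VS_ob slice_simps(3,4) Vect_simps slice_deg_def\<close>)

section \<open>The functor in the coordinates given by \<open>pair\<close>\<close>

lemma inv_pair [simp]: "inv_into UNIV pair (pair c) = c"
  using inj_pair by simp

lemma pair_eq_iff [simp]: "pair c = pair d \<longleftrightarrow> c = d"
  using inj_pair by (auto dest: injD)

lemma fob_F: "fob F V = (dsum pair V V0, \<lambda>a\<in>carrier (dsum pair V V0). snd (inv_into UNIV pair a))"
  by (simp add: add_V0_def)

lemma dsum_carrier: "carrier (dsum pair V V0) = pair ` (carrier V \<times> carrier V0)"
  and dsum_zero: "\<zero>\<^bsub>dsum pair V V0\<^esub> = pair (\<zero>\<^bsub>V\<^esub>, \<zero>\<^bsub>V0\<^esub>)"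
  and dsum_add: "\<lbrakk>a \<in> carrier V; a' \<in> carrier V; c \<in> carrier V0; c' \<in> carrier V0\<rbrakk> \<Longrightarrow>
    pair (a, c) \<oplus>\<^bsub>dsum pair V V0\<^esub> pair (a', c') = pair (a \<oplus>\<^bsub>V\<^esub> a', c \<oplus>\<^bsub>V0\<^esub> c')"
  and dsum_smult: "\<lbrakk>a \<in> carrier V; c \<in> carrier V0\<rbrakk> \<Longrightarrow>
    k \<odot>\<^bsub>dsum pair V V0\<^esub> pair (a, c) = pair (k \<odot>\<^bsub>V\<^esub> a, k \<odot>\<^bsub>V0\<^esub> c)"
proof -
  have inj: "inj_on pair (carrier (direct_sum V V0))"
    using inj_pair by (rule inj_on_subset) simp
  note simps = image_module_simps[OF inj, folded dsum_def]
  show "carrier (dsum pair V V0) = pair ` (carrier V \<times> carrier V0)"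
    and "\<zero>\<^bsub>dsum pair V V0\<^esub> = pair (\<zero>\<^bsub>V\<^esub>, \<zero>\<^bsub>V0\<^esub>)"
    by (simp_all add: simps direct_sum_def)
  show "pair (a, c) \<oplus>\<^bsub>dsum pair V V0\<^esub> pair (a', c') = pair (a \<oplus>\<^bsub>V\<^esub> a', c \<oplus>\<^bsub>V0\<^esub> c')"
    if "a \<in> carrier V" "a' \<in> carrier V" "c \<in> carrier V0" "c' \<in> carrier V0"
    using that simps(3)[of "(a, c)" "(a', c')"] by (simp add: direct_sum_def)
  show "k \<odot>\<^bsub>dsum pair V V0\<^esub> pair (a, c) = pair (k \<odot>\<^bsub>V\<^esub> a, k \<odot>\<^bsub>V0\<^esub> c)"
    if "a \<in> carrier V" "c \<in> carrier V0"
    using that simps(4)[of "(a, c)" k] by (simp add: direct_sum_def)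
qed

lemma dsum_vs:
  assumes "vectorspace K V"
  shows "vectorspace K (dsum pair V V0)"
  unfolding dsum_def
  by (rule vectorspace_image_module[OF direct_sum_is_vs[OF assms V0_vs]]) (rule inj_on_subset[OF inj_pair], simp)

lemma snd_fob: "\<lbrakk>a \<in> carrier V; c \<in> carrier V0\<rbrakk> \<Longrightarrow> snd (fob F V) (pair (a, c)) = c"
  by (simp add: fob_F dsum_carrier)

lemma fst_fob: "fst (fob F V) = dsum pair V V0"
  by (simp add: fob_F)

lemma F_ob:
  assumes "V \<in> ob VK"
  shows "fob F V \<in> ob VS"
proof -
  have V: "vectorspace K V" "finite (carrier V)"
    using assms VK_ob by auto
  have "linear_map K (dsum pair V V0) V0 (snd (fob F V))"
    by (rule linear_mapI[OF dsum_vs[OF V(1)] V0_vs])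
      (auto simp: dsum_carrier dsum_add dsum_smult snd_fob vs_add_closed[OF V(1)] vs_add_closed[OF V0_vs]
        vs_smult_closed[OF V(1)] vs_smult_closed[OF V0_vs])
  then show ?thesis
    using V(2) V0_finite by (simp add: VS_ob fob_F dsum_carrier)
qed

lemma farr_F: "\<lbrakk>a \<in> carrier V; c \<in> carrier V0\<rbrakk> \<Longrightarrow> farr F V W f (pair (a, c)) = pair (f a, c)"
  by (simp add: add_V0_def dsum_carrier)

lemma farr_F_arr:
  assumes V: "V \<in> ob VK" and W: "W \<in> ob VK" and f: "f \<in> arr VK V W"
  shows "farr F V W f \<in> arr VS (fob F V) (fob F W)"
proof -
  have vs: "vectorspace K V" "vectorspace K W"
    using V W VK_ob by auto
  note lin = C.arr_linear[OF V W f]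
  note simps = farr_F linear_map_closed[OF lin] vs_add_closed[OF vs(1)] vs_add_closed[OF V0_vs]
    vs_smult_closed[OF vs(1)] vs_smult_closed[OF V0_vs] linear_map_add[OF lin] linear_map_smult[OF lin]
  have "linear_map K (dsum pair V V0) (dsum pair W V0) (farr F V W f)"
    by (rule linear_mapI[OF dsum_vs[OF vs(1)] dsum_vs[OF vs(2)]])
      (auto simp: dsum_carrier dsum_add dsum_smult simps)
  moreover have "farr F V W f \<in> extensional (carrier (dsum pair V V0))"
    by (simp add: add_V0_def)
  moreover have "snd (fob F W) (farr F V W f a) = snd (fob F V) a" if "a \<in> carrier (dsum pair V V0)" for a
    using that by (auto simp: dsum_carrier simps snd_fob)
  ultimately show ?thesis
    unfolding D.arr_iff[OF F_ob[OF V] F_ob[OF W]] fst_fob by blast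
qed

text \<open>The fibre product of \<open>V \<oplus> V0\<close> and \<open>W \<oplus> V0\<close> over
  \<open>V0\<close> is \<open>V \<oplus> W \<oplus> V0\<close>: the two \<open>V0\<close>-components
  coincide. Inside it a relation between \<open>V\<close> and \<open>W\<close> is extended by all of
  \<open>V0\<close>.\<close>

definition lift_rel :: "('v \<times> 'v) set \<Rightarrow> ('v \<times> 'v) set" where
  "lift_rel R = {(pair (a, c), pair (b, c)) |a b c. (a, b) \<in> R \<and> c \<in> carrier V0}"

lemma lift_rel_iff: "(pair (a, c), pair (b, d)) \<in> lift_rel R \<longleftrightarrow> (a, b) \<in> R \<and> c \<in> carrier V0 \<and> d = c"
  by (auto simp: lift_rel_def)

text \<open>The natural map, called \<open>N\<close>, sends the pair of \<open>(a, b)\<close> and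
  \<open>c\<close> to the pair of \<open>(a, c)\<close> and \<open>(b, c)\<close>. Composed with
  \<open>F m\<close> it stays injective, because \<open>m\<close> and \<open>prj\<close> are and
  \<open>c\<close> is still visible, so \<open>F(r)\<close> is a subobject whose pairs can be
  listed.\<close>

lemma
  assumes x: "x \<in> ob VK" and y: "y \<in> ob VK" and r: "r \<in> subobjects VK (prod_ob VK x y)"
  shows sub_map_in: "sub_map VK VS F x y r \<in> subobjects VS (prod_ob VS (fob F x) (fob F y))"
    and rel_sub_map: "D.rel (fob F x) (fob F y) (sub_map VK VS F x y r) = lift_rel (C.rel x y r)"
proof -
  note xy = C.prod_ob[OF x y]
  obtain d m where sr: "sub_rep r = (d, m)" and d: "d \<in> ob VK" and mono: "is_mono VK d (prod_ob VK x y) m"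
    by (rule C.subobjects_sub_rep[OF xy r])
  have m: "m \<in> arr VK d (prod_ob VK x y)" and m_inj: "inj_on m (carrier d)"
    using mono C.is_mono_iff[OF d xy] by auto
  have m_in: "m a \<in> carrier (prod_ob VK x y)" if "a \<in> carrier d" for a
    using C.arr_closed[OF d xy m that] .
  note Fx = F_ob[OF x] and Fy = F_ob[OF y] and Fd = F_ob[OF d] and Fxy = F_ob[OF xy]
  note P = D.prod_ob[OF Fx Fy]
  define N where "N = tuple VS (fob F (prod_ob VK x y)) (fob F x) (fob F y)
    (farr F (prod_ob VK x y) x (proj1 VK x y)) (farr F (prod_ob VK x y) y (proj2 VK x y))"
  note F1 = farr_F_arr[OF xy x C.proj1_arr[OF x y]] and F2 = farr_F_arr[OF xy y C.proj2_arr[OF x y]]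
  have N: "N \<in> arr VS (fob F (prod_ob VK x y)) (prod_ob VS (fob F x) (fob F y))"
    unfolding N_def by (rule D.tuple_arr[OF Fx Fy Fxy F1 F2])
  note Fm = farr_F_arr[OF d xy m]
  define M where "M = cmp VS (fob F d) (fob F (prod_ob VK x y)) (prod_ob VS (fob F x) (fob F y)) N
    (farr F d (prod_ob VK x y) m)"
  have M: "M \<in> arr VS (fob F d) (prod_ob VS (fob F x) (fob F y))"
    unfolding M_def by (rule D.cmp_closed[OF Fd Fxy P Fm N])
  have prj_M: "D.prj (fob F x) (fob F y) (M (pair (a, c))) =
      (pair (proj1 VK x y (m a), c), pair (proj2 VK x y (m a), c))"
    if a: "a \<in> carrier d" and c: "c \<in> carrier V0" for a c
  proof -
    have ac: "pair (a, c) \<in> carrier (fst (fob F d))" "pair (m a, c) \<in> carrier (fst (fob F (prod_ob VK x y)))"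
      using a c m_in[OF a] by (simp_all add: fst_fob dsum_carrier image_iff)
    have "M (pair (a, c)) = N (pair (m a, c))"
      unfolding M_def D.cmp_apply[OF ac(1)] using farr_F[OF a c] by simp
    then show ?thesis
      unfolding N_def using D.prj_tuple[OF Fx Fy Fxy F1 F2 ac(2)] farr_F[OF m_in[OF a] c] by simp
  qed
  have Ed: "carrier (fst (fob F d)) = pair ` (carrier d \<times> carrier V0)"
    by (simp add: fst_fob dsum_carrier)
  have "inj_on M (carrier (fst (fob F d)))"
  proof (rule inj_onI)
    fix a' b'
    assume "a' \<in> carrier (fst (fob F d))" and "b' \<in> carrier (fst (fob F d))" and eq: "M a' = M b'"
    then obtain a c b e where a: "a \<in> carrier d" "c \<in> carrier V0" "a' = pair (a, c)"
      and b: "b \<in> carrier d" "e \<in> carrier V0" "b' = pair (b, e)"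
      unfolding Ed by blast
    have "D.prj (fob F x) (fob F y) (M (pair (a, c))) = D.prj (fob F x) (fob F y) (M (pair (b, e)))"
      using eq a(3) b(3) by simp
    then have "C.prj x y (m a) = C.prj x y (m b)" and ce: "c = e"
      unfolding prj_M[OF a(1,2)] prj_M[OF b(1,2)] by (simp_all add: C.prj_def)
    then have "m a = m b"
      using inj_onD[OF bij_betw_imp_inj_on[OF C.bij_prj[OF x y]] _ m_in[OF a(1)] m_in[OF b(1)]] by blast
    then have "a = b"
      by (rule inj_onD[OF m_inj _ a(1) b(1)])
    then show "a' = b'"
      using a(3) b(3) ce by simp
  qed
  then have M_mono: "is_mono VS (fob F d) (prod_ob VS (fob F x) (fob F y)) M"
    using M D.is_mono_iff[OF Fd P] by blast
  have sm: "sub_map VK VS F x y r = sub_class VS (prod_ob VS (fob F x) (fob F y)) (fob F d, M)"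
    unfolding sub_map_def sr Let_def prod.case N_def[symmetric] M_def[symmetric] ..
  show "sub_map VK VS F x y r \<in> subobjects VS (prod_ob VS (fob F x) (fob F y))"
    unfolding sm by (rule D.sub_class_in_subobjects[OF Fd M_mono])
  have R: "C.rel x y r = (\<lambda>a. C.prj x y (m a)) ` carrier d"
    by (simp add: C.rel_def sr image_image)
  have "(\<lambda>a. D.prj (fob F x) (fob F y) (M a)) ` carrier (fst (fob F d)) =
      (\<lambda>(a, c). (pair (proj1 VK x y (m a), c), pair (proj2 VK x y (m a), c))) ` (carrier d \<times> carrier V0)"
    unfolding Ed image_image using prj_M by (intro image_cong) auto
  also have "\<dots> = lift_rel (C.rel x y r)"
    unfolding R lift_rel_def C.prj_def by auto
  finally show "D.rel (fob F x) (fob F y) (sub_map VK VS F x y r) = lift_rel (C.rel x y r)"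
    unfolding sm D.rel_sub_class[OF Fx Fy Fd M_mono] .
qed

lemma lift_rel_Id_on: "lift_rel (Id_on (carrier V)) = Id_on (carrier (dsum pair V V0))"
  unfolding dsum_carrier lift_rel_def by auto

lemma lift_rel_comp: "lift_rel (R O S) = lift_rel R O lift_rel S"
  by (fastforce simp: lift_rel_def)

text \<open>The \<open>V0\<close>-component is constant along a lifted relation, so a chain that
  starts at zero has middle vector \<open>pair (b, 0)\<close>. The overlap does not grow, which is
  the invariance of the degree under the functor.\<close>

lemma weight_lift_rel:
  "D.weight (fob F x) (fob F z) (lift_rel R) (lift_rel S) = C.weight x z R S"
proof -
  have "overlap (dsum pair x V0) (dsum pair z V0) (lift_rel R) (lift_rel S) =
      (\<lambda>b. pair (b, \<zero>\<^bsub>V0\<^esub>)) ` overlap x z R S"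
    using vs_zero_closed[OF V0_vs] by (auto simp: overlap_def lift_rel_def dsum_zero)
  moreover have "inj_on (\<lambda>b. pair (b, \<zero>\<^bsub>V0\<^esub>)) (overlap x z R S)"
    by (rule inj_onI) simp
  ultimately have "card (overlap (dsum pair x V0) (dsum pair z V0) (lift_rel R) (lift_rel S)) =
      card (overlap x z R S)"
    by (simp add: card_image)
  then show ?thesis
    by (simp add: C.weight_def D.weight_def fst_fob)
qed

sublocale twisted_basis_map "ob VK" "\<lambda>x y. subobjects VK (prod_ob VK x y)" "comp_sub VK (vect_deg K t)"
  C.diag "\<lambda>x y z s r. C.sub x z (C.rel x y r O C.rel y z s)"
  "\<lambda>x y z s r. C.weight x z (C.rel x y r) (C.rel y z s)"
  "ob VS" "\<lambda>x y. subobjects VS (prod_ob VS x y)" "comp_sub VS (slice_deg (vect_deg K t))"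
  D.diag "\<lambda>x y z s r. D.sub x z (D.rel x y r O D.rel y z s)"
  "\<lambda>x y z s r. D.weight x z (D.rel x y r) (D.rel y z s)"
  "fob F" "sub_map VK VS F"
proof
  show "fob F x \<in> ob VS" if "x \<in> ob VK" for x
    using that by (rule F_ob)
  show "sub_map VK VS F x y r \<in> subobjects VS (prod_ob VS (fob F x) (fob F y))"
    if "x \<in> ob VK" "y \<in> ob VK" "r \<in> subobjects VK (prod_ob VK x y)" for x y r
    using that by (rule sub_map_in)
  show "sub_map VK VS F x x (C.diag x) = D.diag (fob F x)" if x: "x \<in> ob VK" for x
  proof (rule inj_onD[OF D.inj_on_rel[OF F_ob[OF x] F_ob[OF x]]])
    show "D.rel (fob F x) (fob F x) (sub_map VK VS F x x (C.diag x)) =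
        D.rel (fob F x) (fob F x) (D.diag (fob F x))"
      unfolding rel_sub_map[OF x x C.diag_in[OF x]] C.rel_diag[OF x] D.rel_diag[OF F_ob[OF x]]
      by (simp add: lift_rel_Id_on fst_fob)
  qed (use x in \<open>auto intro: sub_map_in C.diag_in D.diag_in F_ob\<close>)
next
  fix x y z r s
  assume a: "x \<in> ob VK" "y \<in> ob VK" "z \<in> ob VK" "r \<in> subobjects VK (prod_ob VK x y)"
    "s \<in> subobjects VK (prod_ob VK y z)"
  note rs = C.rels_comp[OF C.rel_in_rels[OF a(1,2,4)] C.rel_in_rels[OF a(2,3,5)]]
  show "sub_map VK VS F x z (C.sub x z (C.rel x y r O C.rel y z s)) =
      D.sub (fob F x) (fob F z) (D.rel (fob F x) (fob F y) (sub_map VK VS F x y r) O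
        D.rel (fob F y) (fob F z) (sub_map VK VS F y z s))"
  proof (rule D.sub_eqI[symmetric, OF F_ob[OF a(1)] F_ob[OF a(3)]])
    show "sub_map VK VS F x z (C.sub x z (C.rel x y r O C.rel y z s)) \<in>
        subobjects VS (prod_ob VS (fob F x) (fob F z))"
      using a rs by (intro sub_map_in C.sub_in)
    show "D.rel (fob F x) (fob F z) (sub_map VK VS F x z (C.sub x z (C.rel x y r O C.rel y z s))) =
        D.rel (fob F x) (fob F y) (sub_map VK VS F x y r) O
        D.rel (fob F y) (fob F z) (sub_map VK VS F y z s)"
      unfolding rel_sub_map[OF a(1,3) C.sub_in[OF a(1,3) rs]] C.rel_sub[OF a(1,3) rs]
        rel_sub_map[OF a(1,2,4)] rel_sub_map[OF a(2,3,5)] by (rule lift_rel_comp)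
  qed
  show "D.weight (fob F x) (fob F z) (D.rel (fob F x) (fob F y) (sub_map VK VS F x y r))
      (D.rel (fob F y) (fob F z) (sub_map VK VS F y z s)) = C.weight x z (C.rel x y r) (C.rel y z s)"
    unfolding rel_sub_map[OF a(1,2,4)] rel_sub_map[OF a(2,3,5)] by (rule weight_lift_rel)
qed

lemma T0_func_eq: "T0_func VK VS F = Fun"
  unfolding T0_func_def Fun_def ..

section \<open>The universal arrow at an object of the slice\<close>

definition graph :: "('f, 'v) module \<Rightarrow> ('v \<Rightarrow> 'v) \<Rightarrow> ('v \<times> 'v) set" where
  "graph V p = {(a, pair (a, p a)) |a. a \<in> carrier V}"

lemma graph_in_rels:
  assumes x: "x \<in> ob VS"
  shows "graph (fst x) (snd x) \<in> D.rels x (fob F (fst x))"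
proof -
  have p: "linear_map K (fst x) V0 (snd x)"
    using x by (simp add: VS_ob)
  note V = linear_map_dom[OF p]
  note simps = linear_map_closed[OF p] linear_map_add[OF p] linear_map_smult[OF p] linear_map_zero[OF p]
    vs_zero_closed[OF V] vs_add_closed[OF V] vs_smult_closed[OF V]
  have "lin_rel K (fst x) (dsum pair (fst x) V0) (graph (fst x) (snd x))"
    by (rule lin_relI) (auto simp: graph_def dsum_carrier dsum_zero dsum_add dsum_smult simps)
  moreover have "graph (fst x) (snd x) \<subseteq> D.fib x (fob F (fst x))"
    by (auto simp: graph_def D.fib_def fst_fob dsum_carrier snd_fob simps)
  ultimately show ?thesis
    by (simp add: D.rels_def fst_fob)
qed

text \<open>If \<open>a\<close> is related to \<open>pair (b, c)\<close> over \<open>V0\<close>,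
  then \<open>c\<close> must be the structure map at \<open>a\<close>. A relation over
  \<open>V0\<close> into \<open>y \<oplus> V0\<close> thus carries no more information than the
  pairs \<open>(a, b)\<close>, and composition with the graph restores the forced component.\<close>

lemma bij_betw_graph_comp:
  assumes x: "x \<in> ob VS" and y: "y \<in> ob VK"
  shows "bij_betw (\<lambda>R. graph (fst x) (snd x) O lift_rel R) (C.rels (fst x) y) (D.rels x (fob F y))"
proof -
  have p: "linear_map K (fst x) V0 (snd x)"
    using x by (simp add: VS_ob)
  note V = linear_map_dom[OF p]
  have v: "fst x \<in> ob VK"
    using x by (simp add: slice_simps)
  have W: "vectorspace K y"
    using y VK_ob by blast
  \<comment> \<open>\<open>?g\<close> is composition with the graph after elimination of the middle
    vector \<open>pair (a, snd x a)\<close>; its inverse \<open>?h\<close> deletes the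
    \<open>V0\<close>-component.\<close>
  let ?g = "\<lambda>R. {(a, pair (b, snd x a)) |a b. (a, b) \<in> R}"
    and ?h = "\<lambda>S. {(a, b). b \<in> carrier y \<and> (a, pair (b, snd x a)) \<in> S}"
  note simps = linear_map_closed[OF p] linear_map_add[OF p] linear_map_smult[OF p] linear_map_zero[OF p]
    vs_zero_closed[OF V] vs_add_closed[OF V] vs_smult_closed[OF V]
    vs_zero_closed[OF W] vs_add_closed[OF W] vs_smult_closed[OF W]
  have sub: "a \<in> carrier (fst x) \<and> b \<in> carrier y" if "R \<in> C.rels (fst x) y" "(a, b) \<in> R" for R a b
    using that lin_rel_subset by (fastforce simp: C.rels_def)
  have g: "graph (fst x) (snd x) O lift_rel R = ?g R" if "R \<in> C.rels (fst x) y" for R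
    using sub[OF that] linear_map_closed[OF p] by (fastforce simp: graph_def lift_rel_def)
  have g_in: "?g R \<in> D.rels x (fob F y)" if R: "R \<in> C.rels (fst x) y" for R
  proof -
    have lin: "lin_rel K (fst x) y R"
      using R by (simp add: C.rels_def)
    have "lin_rel K (fst x) (dsum pair y V0) (?g R)"
    proof (rule lin_relI)
      show "?g R \<subseteq> carrier (fst x) \<times> carrier (dsum pair y V0)"
        using sub[OF R] by (auto simp: dsum_carrier simps)
      show "(\<zero>\<^bsub>fst x\<^esub>, \<zero>\<^bsub>dsum pair y V0\<^esub>) \<in> ?g R"
        using lin_rel_zero[OF lin] by (simp add: dsum_zero simps)
      show "(a \<oplus>\<^bsub>fst x\<^esub> a', b \<oplus>\<^bsub>dsum pair y V0\<^esub> b') \<in> ?g R" if "(a, b) \<in> ?g R" "(a', b') \<in> ?g R" for a b a' b'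
        using that sub[OF R] lin_rel_add[OF lin] by (auto simp: dsum_add simps)
      show "(k \<odot>\<^bsub>fst x\<^esub> a, k \<odot>\<^bsub>dsum pair y V0\<^esub> b) \<in> ?g R" if "k \<in> carrier K" "(a, b) \<in> ?g R" for k a b
        using that sub[OF R] lin_rel_smult[OF lin] by (auto simp: dsum_smult simps)
    qed
    moreover have "?g R \<subseteq> D.fib x (fob F y)"
      using sub[OF R] by (auto simp: D.fib_def fst_fob dsum_carrier snd_fob simps)
    ultimately show ?thesis
      by (simp add: D.rels_def fst_fob)
  qed
  have h_in: "?h S \<in> C.rels (fst x) y" if S: "S \<in> D.rels x (fob F y)" for S
  proof -
    have lin: "lin_rel K (fst x) (dsum pair y V0) S"
      using S by (simp add: D.rels_def fst_fob)
    have a_in: "a \<in> carrier (fst x)" if "(a, b) \<in> S" for a b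
      using that lin_rel_subset[OF lin] by blast
    have "lin_rel K (fst x) y (?h S)"
    proof (rule lin_relI)
      show "?h S \<subseteq> carrier (fst x) \<times> carrier y"
        using a_in by blast
      show "(\<zero>\<^bsub>fst x\<^esub>, \<zero>\<^bsub>y\<^esub>) \<in> ?h S"
        using lin_rel_zero[OF lin] by (simp add: dsum_zero simps)
      show "(a \<oplus>\<^bsub>fst x\<^esub> a', b \<oplus>\<^bsub>y\<^esub> b') \<in> ?h S" if "(a, b) \<in> ?h S" "(a', b') \<in> ?h S" for a b a' b'
        using that a_in[of a "pair (b, snd x a)"] a_in[of a' "pair (b', snd x a')"]
          lin_rel_add[OF lin, of a "pair (b, snd x a)" a' "pair (b', snd x a')"]
        by (simp add: dsum_add simps)
      show "(k \<odot>\<^bsub>fst x\<^esub> a, k \<odot>\<^bsub>y\<^esub> b) \<in> ?h S" if "k \<in> carrier K" "(a, b) \<in> ?h S" for k a b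
        using that a_in[of a "pair (b, snd x a)"] lin_rel_smult[OF lin, of k a "pair (b, snd x a)"]
        by (simp add: dsum_smult simps)
    qed
    moreover from this have "?h S \<subseteq> C.fib (fst x) y"
      using lin_rel_subset by (fastforce simp: C.fib_def)
    ultimately show ?thesis
      by (simp add: C.rels_def)
  qed
  have hg: "?h (?g R) = R" if "R \<in> C.rels (fst x) y" for R
    using sub[OF that] by auto
  have gh: "?g (?h S) = S" if S: "S \<in> D.rels x (fob F y)" for S
  proof -
    \<comment> \<open>This is where membership in the fibre product enters: it forces the
      \<open>V0\<close>-component of the second vector of \<open>w\<close>.\<close>
    have "\<exists>b. w = (fst w, pair (b, snd x (fst w))) \<and> b \<in> carrier y" if "w \<in> S" for w
    proof -
      have "w \<in> D.fib x (fob F y)"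
        using S that by (auto simp: D.rels_def)
      then show ?thesis
        by (auto simp: D.fib_def fst_fob dsum_carrier snd_fob)
    qed
    then show ?thesis
      by force
  qed
  have "bij_betw ?g (C.rels (fst x) y) (D.rels x (fob F y))"
    by (rule bij_betw_byWitness[where f' = ?h]) (use g_in h_in hg gh in auto)
  then show ?thesis
    by (rule bij_betw_cong[THEN iffD1, rotated]) (rule g[symmetric])
qed

text \<open>The universal object is the underlying space of \<open>x\<close>. The bijection of bases
  is \<open>bij_betw_graph_comp\<close>, translated from relations to subobjects on either
  side.\<close>

lemma ex_universal_arrow_Fun:
  assumes x: "x \<in> ob VS"
  shows "\<exists>v n. universal_arrow C.T0.L D.T0.L Fun x v n"
proof -
  have v: "fst x \<in> ob VK"
    using x by (simp add: slice_simps)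
  note Fv = F_ob[OF v] and G = graph_in_rels[OF x]
  let ?G = "graph (fst x) (snd x)" and ?n = "D.sub x (fob F (fst x)) (graph (fst x) (snd x))"
  note rel_n = D.rel_sub[OF x Fv G]
  have "universal_arrow C.T0.L D.T0.L Fun x (fst x) (Poly_Mapping.single ?n 1)"
  proof (rule universal_arrow_Fun[OF x v D.sub_in[OF x Fv G]])
    fix y
    assume y: "y \<in> ob VK"
    let ?f = "\<lambda>r. D.sub x (fob F y) (?G O lift_rel (C.rel (fst x) y r))"
    have "bij_betw ?f (subobjects VK (prod_ob VK (fst x) y)) (subobjects VS (prod_ob VS x (fob F y)))"
      using bij_betw_trans[OF C.bij_betw_rel(1)[OF v y]
          bij_betw_trans[OF bij_betw_graph_comp[OF x y] D.bij_betw_rel(2)[OF x F_ob[OF y]]]]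
      by (simp add: comp_def)
    then show "bij_betw (\<lambda>r. D.sub x (fob F y) (D.rel x (fob F (fst x)) ?n O
        D.rel (fob F (fst x)) (fob F y) (sub_map VK VS F (fst x) y r)))
        (subobjects VK (prod_ob VK (fst x) y)) (subobjects VS (prod_ob VS x (fob F y)))"
      by (rule bij_betw_cong[THEN iffD1, rotated]) (simp add: rel_n rel_sub_map[OF v y])
  next
    fix y r
    assume y: "y \<in> ob VK" and r: "r \<in> subobjects VK (prod_ob VK (fst x) y)"
    have p: "linear_map K (fst x) V0 (snd x)"
      using x by (simp add: VS_ob)
    have "lin_rel K (fst x) y (C.rel (fst x) y r)"
      using C.rel_in_rels[OF v y r] by (simp add: C.rels_def)
    note zero = lin_rel_zero[OF this]
    \<comment> \<open>The graph is single-valued and relates \<open>0\<close> to zero only, so the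
      overlap is trivial and the weight is \<open>t ^ 0\<close> for every \<open>t\<close>.\<close>
    have "D.ov x (fob F y) ?G (lift_rel (C.rel (fst x) y r)) = {\<zero>\<^bsub>dsum pair (fst x) V0\<^esub>}"
      using zero vs_zero_closed[OF linear_map_dom[OF p]] vs_zero_closed[OF V0_vs]
      by (auto simp: overlap_def graph_def fst_fob dsum_zero linear_map_zero[OF p] lift_rel_iff)
    then have "D.weight x (fob F y) ?G (lift_rel (C.rel (fst x) y r)) = t ^ 0"
      by (intro D.weight_eqI) simp
    then show "D.weight x (fob F y) (D.rel x (fob F (fst x)) ?n)
        (D.rel (fob F (fst x)) (fob F y) (sub_map VK VS F (fst x) y r)) = 1"
      by (simp add: rel_n rel_sub_map[OF v y r])
  qed
  then show ?thesis
    by blast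
qed

end

theorem corollary6p1p4:
  fixes K :: "('f, 'r) ring_scheme"
    and t :: "'k::field"
    and pair :: "'v \<times> 'v \<Rightarrow> 'v"
    and V0 :: "('f, 'v) module"
    and J :: "('j, 'a) cat"
  assumes "field K" and "finite (carrier K)"
    and "infinite (UNIV :: 'v set)" and "inj pair"
    and "V0 \<in> ob (Vect K)"
    and "finite_category J"
  shows "let Vect_V0 = slice (Vect K) V0;
             C = Rep_GL K t;
             D = T_cat Vect_V0 (slice_deg (vect_deg K t));
             Fbar = T_func (Vect K) Vect_V0 (add_V0 pair V0)
         in is_functor C D Fbar \<and> preserves_limits_of_shape J C D Fbar"
proof -
  interpret add_space K t pair V0
    by (rule add_space.intro) (use assms in auto)
  note add = additive_functor_Fun
  note hull = is_functor_additive_hull_func[OF add]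
  note kar = is_functor_karoubi_func[OF hull]
  have ob: "ob D.T0.L = ob VS"
    by (rule D.T0.L_simps(1))
  have univ: "\<exists>u n. universal_arrow (karoubi (additive_hull C.T0.L)) (karoubi (additive_hull D.T0.L))
      (karoubi_func (additive_hull_func Fun)) x u n"
    if "x \<in> ob (karoubi (additive_hull D.T0.L))" for x
  proof -
    \<comment> \<open>A universal arrow is first found for the formal sum underlying
      \<open>x\<close>; its idempotent is then lifted along that arrow.\<close>
    have "fst x \<in> ob (additive_hull D.T0.L)"
      by (rule karoubi_obD(1)[OF that])
    then obtain us m where "universal_arrow (additive_hull C.T0.L) (additive_hull D.T0.L)
        (additive_hull_func Fun) (fst x) us m"
      using universal_arrow_additive_hull[OF add ex_universal_arrow_Fun] unfolding ob by blast
    then show ?thesis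
      by (rule universal_arrow_karoubi[OF hull that])
  qed
  show ?thesis
    unfolding Let_def T_cat_def T_func_def C.T0_eq_L D.T0_eq_L T0_func_eq
    using kar preserves_limits_of_shape_if_universal_arrows[OF kar univ] by blast
qed

end
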